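(* Let $\mathbf{H}\in\mathbb{C}^{N\times K}$ be a matrix with i.i.d. entries of zero mean and variance $1/N$, let perfect power control (PPC) be used, and let the input covariance $\boldsymbol{\Phi}$ and the noise variance $\sigma_n^2>0$ satisfy $\boldsymbol{\Phi}/\sigma_n^2=\gamma\mathbf{I}$ with $\gamma>0$. Let the $K$ users be divided by any pairing method into pairs $\{\ell_{2m-1},\ell_{2m}\}$, $m=1,\dots,K/2$, and let $\lambda_{m,1},\lambda_{m,2}$ be the two nonzero eigenvalues of $$\boldsymbol{\Omega}=\left(\mathbf{H}_{\setminus m}\boldsymbol{\Phi}_{\setminus m}\mathbf{H}_{\setminus m}^\dagger+\sigma_n^2\mathbf{I}\right)^{-1/2}\left(\mathbf{H}_m\boldsymbol{\Phi}_m\mathbf{H}_m^\dagger\right)\left(\mathbf{H}_{\setminus m}\boldsymbol{\Phi}_{\setminus m}\mathbf{H}_{\setminus m}^\dagger+\sigma_n^2\mathbf{I}\right)^{-1/2}.$$ Then, as $K,N\to\infty$ with $\alpha=K/N$ constant, both $\lambda_{m,1}$ and $\lambda_{m,2}$ converge in probability to $$\sqrt{\frac{(1-\alpha)^2\gamma^2}{4}+\frac{(1+\alpha)\gamma}{2}+\frac14}-\frac12+\frac{(1-\alpha)\gamma}{2}.$$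
   Context: Setting: $K$ single-antenna users ($K$ even, $N\le K\le 2N$) transmit to a base station with $N$ antennas over the channel $\mathbf{y}=\mathbf{H}\mathbf{x}+\mathbf{n}$, where $\mathbf{x}\in\mathbb{C}^K$ is the vector of the users' Gaussian inputs with covariance $\boldsymbol{\Phi}$ and $\mathbf{n}\sim\mathcal{CN}(\mathbf{0},\sigma_n^2\mathbf{I})$. Perfect power control (PPC) means that each user's transmit power is proportional to the inverse of its path loss, so that the path loss is cancelled; equivalently, all users have identical power and $\mathbf{H}$ represents only the small-scale fading. For the pair $\{\ell_{2m-1},\ell_{2m}\}$: $\mathbf{H}_m\in\mathbb{C}^{N\times 2}$ consists of columns $\ell_{2m-1}$ and $\ell_{2m}$ of $\mathbf{H}$; $\mathbf{H}_{\setminus m}\in\mathbb{C}^{N\times(K-2)}$ is $\mathbf{H}$ with these two columns removed; $\boldsymbol{\Phi}_m$ is the $2\times2$ covariance matrix of the inputs of these two users; $\boldsymbol{\Phi}_{\setminus m}$ is the covariance matrix of the inputs of the remaining $K-2$ users. A pairing method is a rule partitioning the users into disjoint pairs. $\dagger$ denotes conjugate transpose and $\mathbf{I}$ the identity matrix.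
   Formalization: The law of √N times an entry of H is taken the same for all N, and a pairing method that may depend on H is covered only if this law has a finite fourth moment; pairings independent of H need only the stated variance. Without such conditions the claim is false. *)

theory Defs
  imports
    "HOL-Probability.Probability"
    "HOL-Computational_Algebra.Fundamental_Theorem_Algebra"
    "Jordan_Normal_Form.Char_Poly"
    "Jordan_Normal_Form.Schur_Decomposition"
    "Jordan_Normal_Form.DL_Submatrix"
begin

(* Users are numbered 0, ..., K - 1 (as the columns of a matrix), pairs 1, ..., K/2. *)

definition positive_definite :: "complex mat \<Rightarrow> bool" where
  "positive_definite A \<longleftrightarrow>
     square_mat A \<and> mat_adjoint A = A \<and>
     (\<forall>v \<in> carrier_vec (dim_row A). v \<noteq> 0\<^sub>v (dim_row A) \<longrightarrow> 0 < Re ((A *\<^sub>v v) \<bullet>c v))"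

(* A^(-1/2): the positive definite S with S^2 = A^(-1).  It is only applied to positive
   definite A, for which it exists and is unique. *)
definition inv_sqrt_mat :: "complex mat \<Rightarrow> complex mat" where
  "inv_sqrt_mat A =
     (THE S. S \<in> carrier_mat (dim_row A) (dim_row A) \<and> positive_definite S \<and>
             S * S * A = 1\<^sub>m (dim_row A))"

(* P is the pair of users under consideration: H_m and H_{\m} are the columns of H in P and
   outside P, Phi_m and Phi_{\m} the corresponding principal submatrices of Phi.
   submatrix keeps the remaining indices in increasing order; the products below do not
   depend on that order. *)
definition interference_plus_noise ::
    "complex mat \<Rightarrow> complex mat \<Rightarrow> real \<Rightarrow> nat set \<Rightarrow> complex mat" where
  "interference_plus_noise H Phi noise_var P =
     submatrix H UNIV (- P) * submatrix Phi (- P) (- P) * mat_adjoint (submatrix H UNIV (- P))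
     + complex_of_real noise_var \<cdot>\<^sub>m 1\<^sub>m (dim_row H)"

definition pair_signal :: "complex mat \<Rightarrow> complex mat \<Rightarrow> nat set \<Rightarrow> complex mat" where
  "pair_signal H Phi P =
     submatrix H UNIV P * submatrix Phi P P * mat_adjoint (submatrix H UNIV P)"

definition Omega_mat :: "complex mat \<Rightarrow> complex mat \<Rightarrow> real \<Rightarrow> nat set \<Rightarrow> complex mat" where
  "Omega_mat H Phi noise_var P =
     inv_sqrt_mat (interference_plus_noise H Phi noise_var P)
     * pair_signal H Phi P
     * inv_sqrt_mat (interference_plus_noise H Phi noise_var P)"

(* Nonzero eigenvalues with multiplicity, in decreasing order.  Meant for Hermitian matrices,
   whose eigenvalues are real. *)
definition nonzero_eigenvalues :: "complex mat \<Rightarrow> real list" where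
  "nonzero_eigenvalues A =
     rev (sorted_list_of_multiset (image_mset Re (filter_mset (\<lambda>z. z \<noteq> 0) (proots (char_poly A)))))"

(* The j-th nonzero eigenvalue, j = 1, 2, ...  A pair's Omega has rank at most 2 but may be
   of smaller rank for some channel realizations (e.g. discrete entries); a missing
   eigenvalue then counts as 0. *)
definition nonzero_eigenvalue :: "nat \<Rightarrow> complex mat \<Rightarrow> real" where
  "nonzero_eigenvalue j A =
     (let es = nonzero_eigenvalues A
      in if 1 \<le> j \<and> j \<le> length es then es ! (j - 1) else 0)"

(* N x K random matrix with i.i.d. entries of mean 0 and variance 1/N.  As usual for such
   ensembles, the law mu of the rescaled entries sqrt N * H_ij is a parameter, so that it can be
   kept fixed while N grows. The variance of a zero-mean complex variable Z is E |Z|^2. *)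
definition iid_channel ::
    "'a measure \<Rightarrow> complex measure \<Rightarrow> nat \<Rightarrow> nat \<Rightarrow> ('a \<Rightarrow> complex mat) \<Rightarrow> bool" where
  "iid_channel M mu N K H \<longleftrightarrow>
     (\<forall>w \<in> space M. H w \<in> carrier_mat N K) \<and>
     prob_space.indep_vars M (\<lambda>_. borel) (\<lambda>p w. H w $$ p) ({..<N} \<times> {..<K}) \<and>
     (\<forall>p \<in> {..<N} \<times> {..<K}.
        distr M borel (\<lambda>w. complex_of_real (sqrt (real N)) * H w $$ p) = mu \<and>
        integral\<^sup>L M (\<lambda>w. H w $$ p) = 0 \<and>
        integral\<^sup>L M (\<lambda>w. (norm (H w $$ p))\<^sup>2) = 1 / real N)"

(* A (possibly random) division of the K users into the pairs {l (2m - 1), l (2m)},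
   m = 1, ..., K/2. *)
definition random_pairing :: "'a measure \<Rightarrow> nat \<Rightarrow> ('a \<Rightarrow> nat \<Rightarrow> nat) \<Rightarrow> bool" where
  "random_pairing M K l \<longleftrightarrow>
     (\<forall>i \<in> {1..K}. (\<lambda>w. l w i) \<in> measurable M (count_space UNIV)) \<and>
     (\<forall>w \<in> space M. bij_betw (l w) {1..K} {..<K})"

definition user_pair :: "(nat \<Rightarrow> nat) \<Rightarrow> nat \<Rightarrow> nat set" where
  "user_pair l m = {l (2 * m - 1), l (2 * m)}"

definition pairing_indep_of_channel ::
    "'a measure \<Rightarrow> nat \<Rightarrow> nat \<Rightarrow> ('a \<Rightarrow> complex mat) \<Rightarrow> ('a \<Rightarrow> nat \<Rightarrow> nat) \<Rightarrow> bool" where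
  "pairing_indep_of_channel M N K H l \<longleftrightarrow>
     prob_space.indep_set M
       (sets (vimage_algebra (space M) (\<lambda>w. \<lambda>i\<in>{1..K}. l w i)
                (PiM {1..K} (\<lambda>_. count_space UNIV))))
       (sets (vimage_algebra (space M) (\<lambda>w. \<lambda>p\<in>{..<N} \<times> {..<K}. H w $$ p)
                (PiM ({..<N} \<times> {..<K}) (\<lambda>_. borel))))"

(* Each X n may live on its own probability space, which is harmless for a constant limit. *)
definition converges_in_probability ::
    "(nat \<Rightarrow> 'a measure) \<Rightarrow> (nat \<Rightarrow> 'a \<Rightarrow> real) \<Rightarrow> real \<Rightarrow> bool" where
  "converges_in_probability M X c \<longleftrightarrow>
     (\<forall>n. X n \<in> borel_measurable (M n)) \<and>
     (\<forall>\<epsilon>>0. (\<lambda>n. measure (M n) {w \<in> space (M n). \<bar>X n w - c\<bar> > \<epsilon>}) \<longlonglongrightarrow> 0)"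

end

(*
  A user pair sees the signal-to-interference matrix G = gamma U^* (I + gamma H' H'^* )^(-1) U,
  with U its own two columns and H' the remaining ones, and the nonzero eigenvalues of Omega are
  those of the 2 x 2 matrix G.  So it suffices that both diagonal entries of G tend to the claimed
  value c and that its off-diagonal entry tends to 0.

  Write C for the resolvent and s for its normalized trace.  A quadratic form x^* C x / N in a
  column independent of C is close to s.  The trace of the identity
  I = C (I + gamma H H^* ), with every x_k^* C x_k rewritten by the Sherman-Morrison formula, becomes
  1 = s + (1/N) sum_k phi(q_k) with phi(y) = gamma y / (1 + gamma y) and q_k close to s; hence s is
  close to the root t of 1 = t + alpha phi(t), and c = gamma t.

  If the pairing is independent of the channel, second moments suffice, after conditioning on the
  pair.  If it may depend on the channel, all pairs have to be controlled at once.  With four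
  moments all entries are at most delta sqrt N with probability tending to 1; on that event linear
  forms and diagonal parts obey a Bennett-type bound O(N^(-4)), and the off-diagonal parts of the
  quadratic forms have fourth moments O(N^(-2)), so that the union bound over K columns, resp.
  K^2 pairs, succeeds.
*)
theory Submission
  imports Defs "Jordan_Normal_Form.Spectral_Radius" "HOL-Real_Asymp.Real_Asymp"
begin

unbundle no vec_syntax

section \<open>Positive definite inverse square roots and characteristic polynomials\<close>

text \<open>For pairings that depend on the channel, the obstacle is that off-diagonal quadratic
  forms are controlled only up to probability O(N^(-2)), which pays for K events but not for K^2.
  The diagonal entries of the pair matrix, whose resolvent omits two columns, are therefore never
  bounded pair by pair. They are compared with forms whose resolvent omits a single column; the two
  differ by a rank-one update, hence by at most \<gamma> times the square of a cross term. Cross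
  terms are linear forms, and their exponential bound does pay for all pairs.

  In that case entries are never truncated either: the cut-off is an event intersected with the
  deviation events, so that the variables keep mean 0, variance 1 and independence, and it suffices
  to fix all columns but the one under study.

  Once the 2 x 2 matrix has been identified, vectors are functions on the naturals of which inner
  products read the first \<open>N\<close> coordinates; measurability and conditioning are then
  coordinatewise.\<close>

lemma mat_adjoint_carrier [simp]:
  "A \<in> carrier_mat m n \<Longrightarrow> mat_adjoint A \<in> carrier_mat n m"
  by (auto simp: mat_adjoint_def)

lemma dim_mat_adjoint [simp]:
  "dim_row (mat_adjoint A) = dim_col A" "dim_col (mat_adjoint A) = dim_row A"
  by (auto simp: mat_adjoint_def)

lemma index_mat_adjoint [simp]:
  "i < dim_col A \<Longrightarrow> j < dim_row A \<Longrightarrow> mat_adjoint A $$ (i, j) = conjugate (A $$ (j, i))"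
  by (simp add: mat_adjoint_def mat_of_rows_index)

lemma mat_adjoint_adjoint [simp]: "mat_adjoint (mat_adjoint A) = A"
  by (rule eq_matI) auto

lemma index_mult_mat_sum:
  assumes "A \<in> carrier_mat m k" "B \<in> carrier_mat k n" "i < m" "j < n"
  shows "(A * B) $$ (i, j) = (\<Sum>l<k. A $$ (i, l) * B $$ (l, j))"
  using assms by (auto simp: scalar_prod_def lessThan_atLeast0)

lemma mat_adjoint_mult:
  fixes A B :: "complex mat"
  assumes A: "A \<in> carrier_mat m k" and B: "B \<in> carrier_mat k n"
  shows "mat_adjoint (A * B) = mat_adjoint B * mat_adjoint A"
proof (rule eq_matI)
  fix i j assume ij: "i < dim_row (mat_adjoint B * mat_adjoint A)"
    "j < dim_col (mat_adjoint B * mat_adjoint A)"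
  then have ij: "i < n" "j < m" using A B by auto
  have "mat_adjoint (A * B) $$ (i, j) = cnj (\<Sum>l<k. A $$ (j, l) * B $$ (l, i))"
    using ij A B by (subst index_mat_adjoint) (auto simp: index_mult_mat_sum[OF A B] conjugate_complex_def simp
        del: index_mult_mat(1))
  also have "\<dots> = (\<Sum>l<k. mat_adjoint B $$ (i, l) * mat_adjoint A $$ (l, j))"
    using ij A B by (auto simp: cnj_sum conjugate_complex_def intro!: sum.cong)
  also have "\<dots> = (mat_adjoint B * mat_adjoint A) $$ (i, j)"
    using ij A B by (subst index_mult_mat_sum[of _ n k _ m]) auto
  finally show "mat_adjoint (A * B) $$ (i, j) = (mat_adjoint B * mat_adjoint A) $$ (i, j)" .
qed (use A B in auto)

text \<open>Gram-Schmidt on a basis that starts with \<open>v\<close> leaves the first vector alone.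
  The orthogonal vectors are normalized only afterwards, which is why the first column is a multiple
  of \<open>v\<close>.\<close>

lemma unitary_completion:
  fixes v :: "complex vec"
  assumes v: "v \<in> carrier_vec n" and v0: "v \<noteq> 0\<^sub>v n"
  shows "\<exists>U \<in> carrier_mat n n. \<exists>c. mat_adjoint U * U = 1\<^sub>m n \<and> col U 0 = c \<cdot>\<^sub>v v"
proof -
  interpret cof_vec_space n "TYPE(complex)" .
  have n: "n \<noteq> 0" using v v0 by auto
  define b where "b = basis_completion v"
  define ws where "ws = gram_schmidt n b"
  note bc = basis_completion[OF v v0, folded b_def]
  from bc obtain vs where bv: "b = v # vs" using n by (cases b) auto
  note gs = gram_schmidt_result[OF bc(2) bc(4) bc(5) ws_def]
  have len: "length ws = n" using gs bc by auto
  have wsc: "ws ! i \<in> carrier_vec n" if "i < n" for i using gs(3) len that by auto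
  have hd: "hd ws = v" unfolding ws_def bv by (rule gram_schmidt_hd[OF v])
  define r where "r i = (\<Sum>l<n. (cmod (ws ! i $ l))\<^sup>2)" for i
  have sp: "ws ! j \<bullet>c ws ! i = (\<Sum>l<n. ws ! j $ l * cnj (ws ! i $ l))" if "i < n" "j < n" for i j
    using wsc[OF that(1)] that by (simp add: scalar_prod_def lessThan_atLeast0 conjugate_complex_def)
  have rr: "ws ! i \<bullet>c ws ! i = complex_of_real (r i)" if "i < n" for i
    using that by (simp add: sp r_def complex_norm_square[symmetric])
  have orth: "ws ! j \<bullet>c ws ! i = 0 \<longleftrightarrow> j \<noteq> i" if "i < n" "j < n" for i j
    using corthogonalD[OF gs(2), of j i] that len by auto
  have rpos: "r i > 0" if "i < n" for i
  proof -
    have "r i \<noteq> 0" using orth[of i i] rr[of i] that by auto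
    moreover have "r i \<ge> 0" by (simp add: r_def sum_nonneg)
    ultimately show ?thesis by simp
  qed
  define U where "U = mat n n (\<lambda>(i, j). ws ! j $ i / complex_of_real (sqrt (r j)))"
  have U: "U \<in> carrier_mat n n" by (simp add: U_def)
  have "mat_adjoint U * U = 1\<^sub>m n"
  proof (rule eq_matI)
    fix i j assume "i < dim_row (1\<^sub>m n :: complex mat)" "j < dim_col (1\<^sub>m n :: complex mat)"
    then have ij: "i < n" "j < n" by auto
    have "(mat_adjoint U * U) $$ (i, j) = (\<Sum>l<n. mat_adjoint U $$ (i, l) * U $$ (l, j))"
      by (rule index_mult_mat_sum[OF _ U]) (use U ij in auto)
    also have "\<dots> = (\<Sum>l<n. ws ! j $ l * cnj (ws ! i $ l) / complex_of_real (sqrt (r i) * sqrt (r j)))"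
      using ij by (intro sum.cong) (auto simp: U_def conjugate_complex_def)
    also have "\<dots> = ws ! j \<bullet>c ws ! i / complex_of_real (sqrt (r i) * sqrt (r j))"
      using ij by (simp add: sp sum_divide_distrib)
    also have "\<dots> = (if i = j then 1 else 0)"
      using orth[of i j] rr[of i] rpos[of i] ij by (auto simp flip: of_real_mult)
    finally show "(mat_adjoint U * U) $$ (i, j) = 1\<^sub>m n $$ (i, j)" using ij by simp
  qed (use U in auto)
  moreover have "col U 0 = (1 / complex_of_real (sqrt (r 0))) \<cdot>\<^sub>v v"
  proof (rule eq_vecI)
    have "ws ! 0 = v" using hd hd_conv_nth[of ws] len n by auto
    then show "col U 0 $ i = ((1 / complex_of_real (sqrt (r 0))) \<cdot>\<^sub>v v) $ i"
      if "i < dim_vec ((1 / complex_of_real (sqrt (r 0))) \<cdot>\<^sub>v v)" for i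
      using that v n by (simp add: U_def)
  qed (use v U in auto)
  ultimately show ?thesis using U by blast
qed

lemma unitary_right:
  fixes U :: "complex mat"
  assumes U: "U \<in> carrier_mat n n" and "mat_adjoint U * U = 1\<^sub>m n"
  shows "U * mat_adjoint U = 1\<^sub>m n"
  using mat_mult_left_right_inverse[OF _ U assms(2)] U by simp

text \<open>Real entries are built in because only Hermitian matrices are diagonalized; the matrix
  is then its own adjoint.\<close>

definition real_diag :: "nat \<Rightarrow> (nat \<Rightarrow> real) \<Rightarrow> complex mat" where
  "real_diag n d = mat n n (\<lambda>(i, j). if i = j then complex_of_real (d i) else 0)"

lemma real_diag_carrier [simp]: "real_diag n d \<in> carrier_mat n n"
  by (simp add: real_diag_def)

lemma dim_real_diag [simp]: "dim_row (real_diag n d) = n" "dim_col (real_diag n d) = n"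
  by (simp_all add: real_diag_def)

lemma mat_adjoint_real_diag [simp]: "mat_adjoint (real_diag n d) = real_diag n d"
  by (rule eq_matI) (auto simp: real_diag_def conjugate_complex_def)

lemma real_diag_mult: "real_diag n d * real_diag n e = real_diag n (\<lambda>i. d i * e i)"
proof (rule eq_matI)
  fix i j assume "i < dim_row (real_diag n (\<lambda>i. d i * e i))" "j < dim_col (real_diag n (\<lambda>i. d i * e i))"
  then have ij: "i < n" "j < n" by (auto simp: real_diag_def)
  have "(real_diag n d * real_diag n e) $$ (i, j)
      = (\<Sum>l<n. real_diag n d $$ (i, l) * real_diag n e $$ (l, j))"
    by (rule index_mult_mat_sum) (use ij in auto)
  also have "\<dots> = (\<Sum>l<n. if l = i then (if i = j then complex_of_real (d i * e i) else 0) else 0)"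
    using ij by (intro sum.cong) (auto simp: real_diag_def)
  finally show "(real_diag n d * real_diag n e) $$ (i, j) = real_diag n (\<lambda>i. d i * e i) $$ (i, j)"
    using ij by (auto simp: real_diag_def)
qed (auto simp: real_diag_def)

text \<open>Deflation: a unitary matrix whose first column is an eigenvector brings \<open>A\<close>
  to a form with zero first column below the diagonal. Being Hermitian, this form has a zero first
  row beyond the diagonal as well, and the induction hypothesis applies to the remaining
  block.\<close>

lemma hermitian_spectral_decomposition:
  fixes A :: "complex mat"
  assumes "A \<in> carrier_mat n n" "mat_adjoint A = A"
  shows "\<exists>Q \<in> carrier_mat n n. \<exists>d. mat_adjoint Q * Q = 1\<^sub>m n \<and> A = Q * real_diag n d * mat_adjoint Q"
  using assms
proof (induction n arbitrary: A)
  case 0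
  then show ?case by (intro bexI[of _ "0\<^sub>m 0 0"] exI[of _ "\<lambda>_. 0"]) (auto intro!: eq_matI)
next
  case (Suc n)
  let ?n = "Suc n"
  note A = Suc.prems(1) and her = Suc.prems(2)
  from spectrum_non_empty[OF A] obtain e where "eigenvalue A e" by (auto simp: spectrum_def)
  then obtain v where v: "v \<in> carrier_vec ?n" "v \<noteq> 0\<^sub>v ?n" "A *\<^sub>v v = e \<cdot>\<^sub>v v"
    using A unfolding eigenvalue_def eigenvector_def by auto
  from unitary_completion[OF v(1,2)] obtain U c where
    U: "U \<in> carrier_mat ?n ?n" and UU: "mat_adjoint U * U = 1\<^sub>m ?n" and cU: "col U 0 = c \<cdot>\<^sub>v v" by auto
  note UU' = unitary_right[OF U UU]
  note Ua = mat_adjoint_carrier[OF U]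
  define B where "B = mat_adjoint U * A * U"
  have B: "B \<in> carrier_mat ?n ?n" using U A Ua by (auto simp: B_def)
  have Bher: "mat_adjoint B = B"
    unfolding B_def using U A Ua her
    by (simp add: mat_adjoint_mult[of _ ?n ?n _ ?n] assoc_mult_mat[of _ ?n ?n _ ?n _ ?n] mult_carrier_mat[of _
        ?n ?n _ ?n])
  have colB: "B $$ (i, 0) = (if i = 0 then e else 0)" if i: "i < ?n" for i
  proof -
    have "col B 0 = mat_adjoint U *\<^sub>v (A *\<^sub>v col U 0)"
      unfolding B_def using U A Ua
      by (simp add: assoc_mult_mat[of _ ?n ?n _ ?n _ ?n] mult_carrier_mat[of _ ?n ?n _ ?n] col_mult2[of
          "mat_adjoint U" ?n ?n "A * U" ?n]
          col_mult2[OF A U] del: col_mult)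
    also have "A *\<^sub>v col U 0 = e \<cdot>\<^sub>v col U 0"
      unfolding cU using A v by (simp add: mult_mat_vec[OF A v(1)] smult_smult_assoc mult.commute)
    also have "mat_adjoint U *\<^sub>v (e \<cdot>\<^sub>v col U 0) = e \<cdot>\<^sub>v (mat_adjoint U *\<^sub>v col U 0)"
      by (rule mult_mat_vec[OF Ua]) (rule carrier_vecI, use U in simp)
    also have "mat_adjoint U *\<^sub>v col U 0 = col (mat_adjoint U * U) 0"
      using col_mult2[OF Ua U] by simp
    also have "\<dots> = unit_vec ?n 0" unfolding UU by simp
    finally have "col B 0 $ i = (e \<cdot>\<^sub>v unit_vec ?n 0) $ i" by simp
    then show ?thesis using i B by (auto simp: unit_vec_def)
  qed
  have rowB: "B $$ (0, i) = (if i = 0 then e else 0)" if i: "i < ?n" for i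
  proof -
    have "B $$ (0, i) = conjugate (B $$ (i, 0))"
      using i B Bher by (metis carrier_matD index_mat_adjoint zero_less_Suc)
    then show ?thesis using colB[OF i] Bher colB[of 0] B
      by (metis conjugate_zero conjugate_id index_mat_adjoint carrier_matD zero_less_Suc)
  qed
  have e: "e = complex_of_real (Re e)"
  proof -
    have "B $$ (0, 0) = cnj (B $$ (0, 0))"
      using B Bher by (metis carrier_matD index_mat_adjoint zero_less_Suc conjugate_complex_def)
    then show ?thesis using colB[of 0] by (simp add: complex_eq_iff)
  qed
  define B' where "B' = mat n n (\<lambda>(i, j). B $$ (Suc i, Suc j))"
  have B': "B' \<in> carrier_mat n n" by (simp add: B'_def)
  have B'her: "mat_adjoint B' = B'"
  proof (rule eq_matI)
    fix i j assume "i < dim_row B'" "j < dim_col B'"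
    then have ij: "i < n" "j < n" using B' by auto
    have "mat_adjoint B $$ (Suc i, Suc j) = conjugate (B $$ (Suc j, Suc i))"
      using ij B by (intro index_mat_adjoint) auto
    then show "mat_adjoint B' $$ (i, j) = B' $$ (i, j)"
      using ij Bher by (simp add: B'_def)
  qed (use B' in auto)
  from Suc.IH[OF B' B'her] obtain Q d where
    Q: "Q \<in> carrier_mat n n" and QQ: "mat_adjoint Q * Q = 1\<^sub>m n" and
    B'Q: "B' = Q * real_diag n d * mat_adjoint Q" by auto
  \<comment> \<open>Bordering \<open>Q\<close> with 1 lets it diagonalize the lower block without
    touching the entry \<open>e\<close> already split off.\<close>
  define R where "R = four_block_mat (1\<^sub>m 1) (0\<^sub>m 1 n) (0\<^sub>m n 1) Q"
  have R: "R \<in> carrier_mat ?n ?n" using Q by (auto simp: R_def)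
  have Radj: "mat_adjoint R = four_block_mat (1\<^sub>m 1) (0\<^sub>m 1 n) (0\<^sub>m n 1) (mat_adjoint Q)"
    using Q by (intro eq_matI) (auto simp: R_def conjugate_complex_def)
  define d' where "d' = case_nat (Re e) d"
  have D': "real_diag ?n d' = four_block_mat (e \<cdot>\<^sub>m 1\<^sub>m 1) (0\<^sub>m 1 n) (0\<^sub>m n 1) (real_diag n d)"
    using e by (intro eq_matI) (auto simp: real_diag_def d'_def split: nat.splits)
  have RR: "mat_adjoint R * R = 1\<^sub>m ?n"
    unfolding Radj using Q
    by (subst R_def, subst mult_four_block_mat[of _ 1 1 _ n _ n _ _ 1 _ n]) (auto simp: QQ)
  have "R * real_diag ?n d' * mat_adjoint R
      = four_block_mat (e \<cdot>\<^sub>m 1\<^sub>m 1) (0\<^sub>m 1 n) (0\<^sub>m n 1) (Q * real_diag n d * mat_adjoint Q)"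
    unfolding Radj D' unfolding R_def using Q
    by (subst mult_four_block_mat[of _ 1 1 _ n _ n _ _ 1 _ n], auto)
       (subst mult_four_block_mat[of _ 1 1 _ n _ n _ _ 1 _ n], auto)
  also have "\<dots> = B"
    using B B' rowB colB unfolding B'Q[symmetric]
    by (intro eq_matI) (auto simp: B'_def)
  finally have RB: "R * real_diag ?n d' * mat_adjoint R = B" .
  have Ra: "mat_adjoint R \<in> carrier_mat ?n ?n" using R by simp
  have "A = U * B * mat_adjoint U"
  proof -
    have "U * B * mat_adjoint U = (U * mat_adjoint U) * A * (U * mat_adjoint U)"
      unfolding B_def using U A Ua by (simp add: assoc_mult_mat[of _ ?n ?n _ ?n _ ?n] mult_carrier_mat[of _ ?n
          ?n _ ?n])
    then show ?thesis using A by (simp add: UU')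
  qed
  also have "\<dots> = (U * R) * real_diag ?n d' * mat_adjoint (U * R)"
    unfolding RB[symmetric] using U Ua R Ra
    by (simp add: mat_adjoint_mult[of _ ?n ?n _ ?n] assoc_mult_mat[of _ ?n ?n _ ?n _ ?n] mult_carrier_mat[of _
        ?n ?n _ ?n])
  finally have 1: "A = (U * R) * real_diag ?n d' * mat_adjoint (U * R)" .
  have "mat_adjoint (U * R) * (U * R) = mat_adjoint R * (mat_adjoint U * U) * R"
    using U Ua R Ra by (simp add: mat_adjoint_mult[of _ ?n ?n _ ?n] assoc_mult_mat[of _ ?n ?n _ ?n _ ?n]
        mult_carrier_mat[of _ ?n ?n _ ?n])
  also have "\<dots> = 1\<^sub>m ?n" using R Ra by (simp add: UU RR)
  finally show ?case using 1 U R by (intro bexI[of _ "U * R"] exI[of _ d']) auto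
qed


section \<open>Square roots of positive definite matrices\<close>

lemma scalar_prod_adjoint:
  fixes Q :: "complex mat"
  assumes Q: "Q \<in> carrier_mat m n" and x: "x \<in> carrier_vec n" and v: "v \<in> carrier_vec m"
  shows "(Q *\<^sub>v x) \<bullet>c v = x \<bullet>c (mat_adjoint Q *\<^sub>v v)"
proof -
  have "(Q *\<^sub>v x) \<bullet>c v = (\<Sum>i<m. \<Sum>j<n. Q $$ (i, j) * x $ j * cnj (v $ i))"
    using Q x v by (auto simp: scalar_prod_def lessThan_atLeast0 conjugate_complex_def sum_distrib_right)
  also have "\<dots> = (\<Sum>j<n. \<Sum>i<m. Q $$ (i, j) * x $ j * cnj (v $ i))"
    by (rule sum.swap)
  also have "\<dots> = x \<bullet>c (mat_adjoint Q *\<^sub>v v)"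
    using Q x v by (auto simp: scalar_prod_def lessThan_atLeast0 conjugate_complex_def
        sum_distrib_left cnj_sum mult_ac intro!: sum.cong)
  finally show ?thesis .
qed

lemma quadratic_form_diagonalized:
  assumes Q: "Q \<in> carrier_mat n n" and v: "v \<in> carrier_vec n"
  shows "((Q * real_diag n d * mat_adjoint Q) *\<^sub>v v) \<bullet>c v
    = complex_of_real (\<Sum>i<n. d i * (cmod ((mat_adjoint Q *\<^sub>v v) $ i))\<^sup>2)"
proof -
  define w where "w = mat_adjoint Q *\<^sub>v v"
  have w: "w \<in> carrier_vec n" unfolding w_def by (rule mult_mat_vec_carrier[OF mat_adjoint_carrier[OF Q] v])
  have Dw: "(real_diag n d *\<^sub>v w) $ i = complex_of_real (d i) * w $ i" if "i < n" for i
  proof -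
    have "(real_diag n d *\<^sub>v w) $ i = (\<Sum>j<n. (if i = j then complex_of_real (d i) else 0) * w $ j)"
      using that w by (simp add: real_diag_def scalar_prod_def lessThan_atLeast0)
    also have "\<dots> = (\<Sum>j<n. if j = i then complex_of_real (d i) * w $ i else 0)"
      by (rule sum.cong) auto
    finally show ?thesis using that by simp
  qed
  have Dwc: "real_diag n d *\<^sub>v w \<in> carrier_vec n"
    using mult_mat_vec_carrier[OF real_diag_carrier w] .
  have "(Q * real_diag n d * mat_adjoint Q) *\<^sub>v v = Q *\<^sub>v (real_diag n d *\<^sub>v w)"
    using assoc_mult_mat_vec[OF mult_carrier_mat[OF Q real_diag_carrier] mat_adjoint_carrier[OF Q] v]
      assoc_mult_mat_vec[OF Q real_diag_carrier w] by (simp add: w_def)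
  then have "((Q * real_diag n d * mat_adjoint Q) *\<^sub>v v) \<bullet>c v = (real_diag n d *\<^sub>v w) \<bullet>c w"
    using scalar_prod_adjoint[OF Q Dwc v] by (simp add: w_def)
  also have "\<dots> = (\<Sum>i<n. complex_of_real (d i) * w $ i * cnj (w $ i))"
    using w Dwc Dw by (auto simp: scalar_prod_def lessThan_atLeast0 conjugate_complex_def intro!: sum.cong)
  also have "\<dots> = complex_of_real (\<Sum>i<n. d i * (cmod (w $ i))\<^sup>2)"
    by (simp add: complex_norm_square mult.assoc del: of_real_power)
  finally show ?thesis by (simp add: w_def)
qed

text \<open>Turns positivity of the form of \<open>S\<close> into positivity of diagonal entries
  after a change of basis; both the existence and the uniqueness of square roots rest on it.\<close>

lemma conjugate_by_unitary_diag_entry: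
  fixes S :: "complex mat"
  assumes S: "S \<in> carrier_mat n n" and Q: "Q \<in> carrier_mat n n" and i: "i < n"
  shows "(mat_adjoint Q * S * Q) $$ (i, i) = (S *\<^sub>v col Q i) \<bullet>c col Q i"
proof -
  have "(mat_adjoint Q * S * Q) $$ (i, i) = (mat_adjoint Q * (S * Q)) $$ (i, i)"
    using S Q by (simp add: assoc_mult_mat[of _ n n _ n _ n])
  also have "\<dots> = row (mat_adjoint Q) i \<bullet> col (S * Q) i"
    using S Q i by simp
  also have "col (S * Q) i = S *\<^sub>v col Q i" by (rule col_mult2[OF S Q i])
  also have "row (mat_adjoint Q) i = conjugate (col Q i)"
    using Q i by (intro eq_vecI) auto
  also have "conjugate (col Q i) \<bullet> (S *\<^sub>v col Q i) = (S *\<^sub>v col Q i) \<bullet>c col Q i"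
    by (rule comm_scalar_prod[of _ n]; rule carrier_vecI, use S Q in simp)
  finally show ?thesis .
qed

lemma unitary_col_nonzero:
  fixes Q :: "complex mat"
  assumes Q: "Q \<in> carrier_mat n n" "mat_adjoint Q * Q = 1\<^sub>m n" and i: "i < n"
  shows "col Q i \<in> carrier_vec n" "col Q i \<noteq> 0\<^sub>v n"
proof -
  show c: "col Q i \<in> carrier_vec n" by (rule carrier_vecI) (use Q in simp)
  have "mat_adjoint Q *\<^sub>v col Q i = unit_vec n i"
    using col_mult2[OF mat_adjoint_carrier[OF Q(1)] Q(1) i] Q(2) i by simp
  moreover have "mat_adjoint Q *\<^sub>v 0\<^sub>v n = 0\<^sub>v n" using Q by auto
  ultimately show "col Q i \<noteq> 0\<^sub>v n" using i by (metis index_unit_vec(1) index_zero_vec(1) zero_neq_one)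
qed

lemma positive_definite_inv_sqrt_exists:
  assumes A: "A \<in> carrier_mat n n" and pd: "positive_definite A"
  shows "\<exists>S \<in> carrier_mat n n. positive_definite S \<and> S * S * A = 1\<^sub>m n"
proof -
  have dA: "dim_row A = n" using A by simp
  from pd have "mat_adjoint A = A" by (simp add: positive_definite_def)
  from hermitian_spectral_decomposition[OF A this] obtain Q d where
    Q: "Q \<in> carrier_mat n n" and QQ: "mat_adjoint Q * Q = 1\<^sub>m n" and
    AQ: "A = Q * real_diag n d * mat_adjoint Q" by auto
  note QQ' = unitary_right[OF Q QQ] and Qa = mat_adjoint_carrier[OF Q]
  have cancel: "mat_adjoint Q * (Q * X) = X" "Q * (mat_adjoint Q * X) = X"
    if "X \<in> carrier_mat n n" for X
    using that Q Qa assoc_mult_mat[OF Qa Q that] assoc_mult_mat[OF Q Qa that] by (simp_all add: QQ QQ')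
  have d: "d i > 0" if i: "i < n" for i
  proof -
    have "mat_adjoint Q * A * Q = real_diag n d"
      unfolding AQ using Q Qa by (simp add: assoc_mult_mat[of _ n n _ n _ n] mult_carrier_mat[of _ n n _ n]
          cancel QQ right_mult_one_mat[of _ n n])
    then have "(A *\<^sub>v col Q i) \<bullet>c col Q i = complex_of_real (d i)"
      using conjugate_by_unitary_diag_entry[OF A Q i] i by (simp add: real_diag_def)
    moreover have "0 < Re ((A *\<^sub>v col Q i) \<bullet>c col Q i)"
      using pd unitary_col_nonzero[OF Q QQ i] unfolding positive_definite_def dA by blast
    ultimately show ?thesis by simp
  qed
  define S where "S = Q * real_diag n (\<lambda>i. 1 / sqrt (d i)) * mat_adjoint Q"
  have S: "S \<in> carrier_mat n n" using Q Qa by (auto simp: S_def)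
  have "S * S * A = Q * (real_diag n (\<lambda>i. 1 / sqrt (d i)) * real_diag n (\<lambda>i. 1 / sqrt (d i)) * real_diag n d)
      * mat_adjoint Q"
    unfolding S_def AQ using Q Qa by (simp add: assoc_mult_mat[of _ n n _ n _ n] mult_carrier_mat[of _ n n _ n]
        cancel)
  also have "real_diag n (\<lambda>i. 1 / sqrt (d i)) * real_diag n (\<lambda>i. 1 / sqrt (d i)) * real_diag n d = 1\<^sub>m n"
  proof (rule eq_matI)
    fix i j assume "i < dim_row (1\<^sub>m n :: complex mat)" "j < dim_col (1\<^sub>m n :: complex mat)"
    then have "i < n" "j < n" by auto
    moreover from this have "1 / sqrt (d i) * (1 / sqrt (d i)) * d i = 1" using d[of i] by simp
    ultimately show "(real_diag n (\<lambda>i. 1 / sqrt (d i)) * real_diag n (\<lambda>i. 1 / sqrt (d i)) * real_diag n d) $$ (i, j)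
      = 1\<^sub>m n $$ (i, j)"
      unfolding real_diag_mult by (cases "i = j") (simp_all add: real_diag_def flip: of_real_mult)
  qed (auto simp: real_diag_def)
  finally have SSA: "S * S * A = 1\<^sub>m n" using Q by (simp add: QQ')
  have "mat_adjoint S = S"
    unfolding S_def using Q Qa
    by (simp add: mat_adjoint_mult[of _ n n _ n] assoc_mult_mat[of _ n n _ n _ n] mult_carrier_mat[of _ n n _ n])
  moreover have "0 < Re ((S *\<^sub>v v) \<bullet>c v)" if v: "v \<in> carrier_vec n" "v \<noteq> 0\<^sub>v n" for v
  proof -
    define w where "w = mat_adjoint Q *\<^sub>v v"
    have "Q *\<^sub>v w = v"
      unfolding w_def using v Q Qa by (simp add: assoc_mult_mat_vec[of _ n n _ n, symmetric] QQ')
    then have "w \<noteq> 0\<^sub>v n" using v Q by auto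
    moreover have "dim_vec w = n" using Q by (simp add: w_def)
    ultimately obtain i where i: "i < n" "w $ i \<noteq> 0"
      by (metis eq_vecI index_zero_vec)
    have "Re ((S *\<^sub>v v) \<bullet>c v) = (\<Sum>i<n. 1 / sqrt (d i) * (cmod (w $ i))\<^sup>2)"
      unfolding S_def quadratic_form_diagonalized[OF Q v(1)] w_def by simp
    also have "\<dots> > 0"
    proof (rule sum_pos2[of _ i])
      show "0 < 1 / sqrt (d i) * (cmod (w $ i))\<^sup>2" using i d by simp
      show "0 \<le> 1 / sqrt (d j) * (cmod (w $ j))\<^sup>2" if "j \<in> {..<n}" for j
        using that d[of j] by simp
    qed (use i in auto)
    finally show ?thesis .
  qed
  ultimately have "positive_definite S" using S by (auto simp: positive_definite_def square_mat.simps)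
  with S SSA show ?thesis by blast
qed

text \<open>With \<open>D = S - T\<close>, the hypothesis gives \<open>S * D + D * T = 0\<close>. In
  an eigenbasis of \<open>D\<close> the diagonal of this equation reads (s_i + t_i) d_i = 0, where
  s_i and t_i are values of positive definite forms, so every eigenvalue d_i of \<open>D\<close>
  vanishes. Only \<open>D\<close> is diagonalized, so commutation of \<open>S\<close> and
  \<open>T\<close> never comes up.\<close>

lemma positive_definite_sqrt_unique:
  assumes S: "S \<in> carrier_mat n n" "positive_definite S"
    and T: "T \<in> carrier_mat n n" "positive_definite T"
    and ST: "S * S = T * T"
  shows "S = T"
proof -
  define D where "D = S - T"
  have D: "D \<in> carrier_mat n n" using S T by (auto simp: D_def)
  have adj: "mat_adjoint S = S" "mat_adjoint T = T" and dims: "dim_row S = n" "dim_row T = n"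
    using S T by (auto simp: positive_definite_def)
  have "mat_adjoint D = D"
  proof (rule eq_matI)
    fix i j assume "i < dim_row D" "j < dim_col D"
    then have ij: "i < n" "j < n" using D by auto
    have "S $$ (i, j) = conjugate (S $$ (j, i))" "T $$ (i, j) = conjugate (T $$ (j, i))"
      using index_mat_adjoint[of i S j] index_mat_adjoint[of i T j] adj ij S T by auto
    then show "mat_adjoint D $$ (i, j) = D $$ (i, j)"
      using ij S T D by (simp add: D_def conjugate_complex_def)
  qed (use D in auto)
  from hermitian_spectral_decomposition[OF D this] obtain Q d where
    Q: "Q \<in> carrier_mat n n" and QQ: "mat_adjoint Q * Q = 1\<^sub>m n" and
    DQ: "D = Q * real_diag n d * mat_adjoint Q" by auto
  note QQ' = unitary_right[OF Q QQ] and Qa = mat_adjoint_carrier[OF Q]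
  have cancel: "mat_adjoint Q * (Q * X) = X" "Q * (mat_adjoint Q * X) = X"
    if "X \<in> carrier_mat n n" for X
    using that Q Qa assoc_mult_mat[OF Qa Q that] assoc_mult_mat[OF Q Qa that] by (simp_all add: QQ QQ')
  define S' where "S' = mat_adjoint Q * S * Q"
  define T' where "T' = mat_adjoint Q * T * Q"
  have S'T': "S' \<in> carrier_mat n n" "T' \<in> carrier_mat n n" using S T Q Qa by (auto simp: S'_def T'_def)
  have "S * D + D * T = 0\<^sub>m n n"
  proof -
    have "S * D = S * S - S * T" unfolding D_def using S T by (intro mult_minus_distrib_mat[of _ n n _ n]) auto
    moreover have "D * T = S * T - T * T" unfolding D_def using S T
        by (intro minus_mult_distrib_mat[of _ n n _ _ n]) auto
    ultimately show ?thesis using S T ST mult_carrier_mat[OF S(1) T(1)] mult_carrier_mat[OF T(1) T(1)]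
      by (intro eq_matI) auto
  qed
  then have "mat_adjoint Q * (S * D + D * T) * Q = 0\<^sub>m n n" using Q Qa by simp
  moreover have "mat_adjoint Q * (S * D + D * T) * Q = S' * real_diag n d + real_diag n d * T'"
    unfolding S'_def T'_def DQ using S T Q Qa
    by (simp add: assoc_mult_mat[of _ n n _ n _ n] mult_carrier_mat[of _ n n _ n] cancel QQ
        right_mult_one_mat[of _ n n] mult_add_distrib_mat[of _ n n _ n] add_mult_distrib_mat[of _ n n _ _ n]
        add_carrier_mat[of _ n n])
  ultimately have zero: "S' * real_diag n d + real_diag n d * T' = 0\<^sub>m n n" by simp
  have d: "d i = 0" if i: "i < n" for i
  proof -
    have "(S' * real_diag n d) $$ (i, i) = (\<Sum>l<n. S' $$ (i, l) * real_diag n d $$ (l, i))"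
      by (rule index_mult_mat_sum[OF S'T'(1) real_diag_carrier i i])
    also have "\<dots> = (\<Sum>l<n. if l = i then S' $$ (i, i) * complex_of_real (d i) else 0)"
      using i by (intro sum.cong) (auto simp: real_diag_def)
    finally have "(S' * real_diag n d) $$ (i, i) = S' $$ (i, i) * complex_of_real (d i)"
      using i by simp
    moreover have "(real_diag n d * T') $$ (i, i) = (\<Sum>l<n. real_diag n d $$ (i, l) * T' $$ (l, i))"
      by (rule index_mult_mat_sum[OF real_diag_carrier S'T'(2) i i])
    moreover have "\<dots> = (\<Sum>l<n. if l = i then T' $$ (i, i) * complex_of_real (d i) else 0)"
      using i by (intro sum.cong) (auto simp: real_diag_def)
    moreover have "(S' * real_diag n d) $$ (i, i) + (real_diag n d * T') $$ (i, i) = 0"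
      using arg_cong[OF zero, of "\<lambda>M. M $$ (i, i)"] i S'T' by (simp del: index_mult_mat(1))
    ultimately have "(S' $$ (i, i) + T' $$ (i, i)) * complex_of_real (d i) = 0"
      using i by (simp add: algebra_simps)
    moreover have "Re (S' $$ (i, i)) > 0" "Re (T' $$ (i, i)) > 0"
      unfolding S'_def T'_def conjugate_by_unitary_diag_entry[OF S(1) Q i] conjugate_by_unitary_diag_entry[OF
          T(1) Q i]
      using S T unitary_col_nonzero[OF Q QQ i] unfolding positive_definite_def dims by auto
    ultimately show "d i = 0" by (auto simp: complex_eq_iff)
  qed
  have "real_diag n d = 0\<^sub>m n n" using d by (intro eq_matI) (auto simp: real_diag_def)
  then have "D = 0\<^sub>m n n" unfolding DQ using Q Qa by simp
  show "S = T"
  proof (rule eq_matI)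
    fix i j assume "i < dim_row T" "j < dim_col T"
    then show "S $$ (i, j) = T $$ (i, j)"
      using arg_cong[OF \<open>D = 0\<^sub>m n n\<close>, of "\<lambda>M. M $$ (i, j)"] S T by (simp add: D_def)
  qed (use S T in auto)
qed

text \<open>Discharges the definite description: two candidates have the same square, namely the
  inverse of \<open>A\<close>, so uniqueness of positive definite square roots applies.\<close>

lemma inv_sqrt_mat:
  assumes A: "A \<in> carrier_mat n n" and pd: "positive_definite A"
  shows "inv_sqrt_mat A \<in> carrier_mat n n" "mat_adjoint (inv_sqrt_mat A) = inv_sqrt_mat A"
    "inv_sqrt_mat A * inv_sqrt_mat A * A = 1\<^sub>m n"
proof -
  let ?P = "\<lambda>S. S \<in> carrier_mat n n \<and> positive_definite S \<and> S * S * A = 1\<^sub>m n"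
  have dA: "dim_row A = n" using A by simp
  have "\<exists>!S. ?P S"
  proof (rule ex_ex1I)
    show "\<exists>S. ?P S" using positive_definite_inv_sqrt_exists[OF A pd] by blast
    fix S T assume ST: "?P S" "?P T"
    then have SS: "S * S \<in> carrier_mat n n" and TT: "T * T \<in> carrier_mat n n" by auto
    have "A * (T * T) = 1\<^sub>m n"
      using mat_mult_left_right_inverse[OF TT A] ST by auto
    then have "S * S = (S * S) * (A * (T * T))" using right_mult_one_mat[OF SS] by simp
    also have "\<dots> = (S * S * A) * (T * T)"
      using SS TT A by (simp add: assoc_mult_mat[of "S * S" n n A n "T * T" n])
    also have "\<dots> = T * T" using ST left_mult_one_mat[OF TT] by simp
    finally show "S = T" using positive_definite_sqrt_unique ST by blast
  qed
  from theI'[OF this] have "?P (inv_sqrt_mat A)" unfolding inv_sqrt_mat_def dA .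
  then show "inv_sqrt_mat A \<in> carrier_mat n n" "mat_adjoint (inv_sqrt_mat A) = inv_sqrt_mat A"
    "inv_sqrt_mat A * inv_sqrt_mat A * A = 1\<^sub>m n"
    by (auto simp: positive_definite_def)
qed

text \<open>Sylvester's determinant identity. The bordered matrix \<open>M\<close> is made block
  triangular once by a factor on the right and once by a factor on the left; the second factor has
  determinant X^k, which is the power on the left-hand side. With powers of X on both sides no case
  distinction on \<open>n\<close> and \<open>k\<close> arises.\<close>

lemma char_poly_commute:
  fixes V W :: "complex mat"
  assumes V: "V \<in> carrier_mat n k" and W: "W \<in> carrier_mat k n"
  shows "[:0, 1:] ^ k * char_poly (V * W) = [:0, 1:] ^ n * char_poly (W * V)"
proof -
  define X :: "complex poly" where "X = [:0, 1:]"
  define V' where "V' = map_mat (\<lambda>a. [:a:]) V"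
  define W' where "W' = map_mat (\<lambda>a. [:a:]) W"
  have V': "V' \<in> carrier_mat n k" and W': "W' \<in> carrier_mat k n" using V W by (auto simp: V'_def W'_def)
  have cp: "char_poly_matrix (P * Q) = X \<cdot>\<^sub>m 1\<^sub>m m - map_mat (\<lambda>a. [:a:]) P * map_mat (\<lambda>a. [:a:]) Q"
    if P: "P \<in> carrier_mat m l" and Q: "Q \<in> carrier_mat l m" for P Q :: "complex mat" and m l
  proof (rule eq_matI)
    fix i j assume "i < dim_row (X \<cdot>\<^sub>m 1\<^sub>m m - map_mat (\<lambda>a. [:a:]) P * map_mat (\<lambda>a. [:a:]) Q)"
      "j < dim_col (X \<cdot>\<^sub>m 1\<^sub>m m - map_mat (\<lambda>a. [:a:]) P * map_mat (\<lambda>a. [:a:]) Q)"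
    then have ij: "i < m" "j < m" using P Q by auto
    have s: "(\<Sum>l\<in>S. [:f l:]) = [:\<Sum>l\<in>S. f l:]" for S :: "nat set" and f :: "nat \<Rightarrow> complex"
      by (induction S rule: infinite_finite_induct) auto
    show "char_poly_matrix (P * Q) $$ (i, j)
      = (X \<cdot>\<^sub>m 1\<^sub>m m - map_mat (\<lambda>a. [:a:]) P * map_mat (\<lambda>a. [:a:]) Q) $$ (i, j)"
      using ij P Q by (auto simp: char_poly_matrix_def X_def scalar_prod_def s mult.commute)
  qed (use P Q in \<open>auto simp: char_poly_matrix_def\<close>)
  define M where "M = four_block_mat (X \<cdot>\<^sub>m 1\<^sub>m n) V' W' (1\<^sub>m k)"
  have M: "M \<in> carrier_mat (n + k) (n + k)" using V' W' by (auto simp: M_def)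
  define L where "L = four_block_mat (1\<^sub>m n) (0\<^sub>m n k) (- W') (1\<^sub>m k)"
  define R where "R = four_block_mat (1\<^sub>m n) (0\<^sub>m n k) (- W') (X \<cdot>\<^sub>m 1\<^sub>m k)"
  have LR: "L \<in> carrier_mat (n + k) (n + k)" "R \<in> carrier_mat (n + k) (n + k)"
    using W' by (auto simp: L_def R_def)
  have "M * L = four_block_mat (X \<cdot>\<^sub>m 1\<^sub>m n - V' * W') V' (0\<^sub>m k n) (1\<^sub>m k)"
    unfolding M_def L_def using V' W'
    by (subst mult_four_block_mat[of _ n n _ k _ k _ _ n _ k]) (auto intro!: cong_four_block_mat eq_matI)
  then have "det M * det L = det (X \<cdot>\<^sub>m 1\<^sub>m n - V' * W')"
    using det_four_block_mat_lower_left_zero[of "X \<cdot>\<^sub>m 1\<^sub>m n - V' * W'" n V' k "0\<^sub>m k n" "1\<^sub>m k"] V' W'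
    by (simp add: det_mult[OF M LR(1), symmetric] minus_carrier_mat)
  moreover have "det L = 1"
    unfolding L_def using W' by (subst det_four_block_mat_upper_right_zero[of _ n _ k]) auto
  ultimately have 1: "det M = det (X \<cdot>\<^sub>m 1\<^sub>m n - V' * W')" by simp
  have "R * M = four_block_mat (X \<cdot>\<^sub>m 1\<^sub>m n) V' (0\<^sub>m k n) (X \<cdot>\<^sub>m 1\<^sub>m k - W' * V')"
    unfolding M_def R_def using V' W'
    by (subst mult_four_block_mat[of _ n n _ k _ k _ _ n _ k]) (auto intro!: cong_four_block_mat eq_matI)
  then have "det R * det M = det (X \<cdot>\<^sub>m 1\<^sub>m n) * det (X \<cdot>\<^sub>m 1\<^sub>m k - W' * V')"
    using det_four_block_mat_lower_left_zero[of "X \<cdot>\<^sub>m 1\<^sub>m n" n V' k "0\<^sub>m k n" "X \<cdot>\<^sub>m 1\<^sub>m k - W' * V'"] V' W'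
    by (simp add: det_mult[OF LR(2) M, symmetric] minus_carrier_mat)
  moreover have "det R = X ^ k"
    unfolding R_def using W' by (subst det_four_block_mat_upper_right_zero[of _ n _ k]) auto
  ultimately show ?thesis
    unfolding char_poly_def cp[OF V W] cp[OF W V] 1 V'_def[symmetric] W'_def[symmetric] X_def[symmetric]
    using 1 by simp
qed

section \<open>Resolvents of sample covariance matrices\<close>

definition ip :: "nat \<Rightarrow> (nat \<Rightarrow> complex) \<Rightarrow> (nat \<Rightarrow> complex) \<Rightarrow> complex" where
  "ip N u v = (\<Sum>a<N. cnj (u a) * v a)"

definition nrm2 :: "nat \<Rightarrow> (nat \<Rightarrow> complex) \<Rightarrow> real" where
  "nrm2 N u = (\<Sum>a<N. (cmod (u a))\<^sup>2)"

lemma ip_self: "ip N u u = complex_of_real (nrm2 N u)"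
  by (simp add: ip_def nrm2_def complex_norm_square mult.commute del: of_real_power)

lemma cnj_ip: "cnj (ip N u v) = ip N v u"
  by (simp add: ip_def cnj_sum mult.commute)

lemma ip_diff_right: "ip N u (\<lambda>a. v a - w a) = ip N u v - ip N u w"
  by (simp add: ip_def algebra_simps sum_subtractf)

lemma ip_add_right: "ip N u (\<lambda>a. v a + w a) = ip N u v + ip N u w"
  by (simp add: ip_def algebra_simps sum.distrib)

lemma ip_scale_right: "ip N u (\<lambda>a. c * v a) = c * ip N u v"
  by (simp add: ip_def sum_distrib_left mult_ac)

lemma ip_scale_right': "ip N u (\<lambda>a. v a * c) = c * ip N u v"
  by (simp add: ip_def sum_distrib_left mult_ac)

lemma ip_sum_right: "ip N u (\<lambda>a. \<Sum>k\<in>J. v k a) = (\<Sum>k\<in>J. ip N u (v k))"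
  unfolding ip_def sum_distrib_left by (rule sum.swap)

lemma nrm2_nonneg [simp]: "nrm2 N u \<ge> 0"
  by (simp add: nrm2_def sum_nonneg)

definition unitv :: "nat \<Rightarrow> nat \<Rightarrow> complex" where
  "unitv b a = (if a = b then 1 else 0)"

lemma ip_unitv_left: "b < N \<Longrightarrow> ip N (unitv b) v = v b"
  by (simp add: ip_def unitv_def if_distrib[of cnj] if_distrib[of "\<lambda>x. x * _"] cong: if_cong)

lemma nrm2_unitv: "b < N \<Longrightarrow> nrm2 N (unitv b) = 1"
  by (simp add: nrm2_def unitv_def if_distrib[of cmod] if_distrib[of "\<lambda>x. x ^ 2"] cong: if_cong)

lemma ip_Cauchy_Schwarz: "(cmod (ip N u v))\<^sup>2 \<le> nrm2 N u * nrm2 N v"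
proof -
  have "cmod (ip N u v) \<le> (\<Sum>a<N. cmod (u a) * cmod (v a))"
    unfolding ip_def by (rule order_trans[OF norm_sum]) (simp add: norm_mult)
  then have "(cmod (ip N u v))\<^sup>2 \<le> (\<Sum>a<N. cmod (u a) * cmod (v a))\<^sup>2"
    by (rule power_mono) simp
  also have "\<dots> \<le> nrm2 N u * nrm2 N v"
    unfolding nrm2_def by (rule Cauchy_Schwarz_ineq_sum)
  finally show ?thesis .
qed

text \<open>The operator I + g sum_k x_k x_k^*. It acts on all coordinates, including those from
  \<open>N\<close> on, so that inversion can be expressed as an equality of functions.\<close>

definition gram_op ::
    "nat \<Rightarrow> real \<Rightarrow> (nat \<Rightarrow> nat \<Rightarrow> complex) \<Rightarrow> nat set \<Rightarrow> (nat \<Rightarrow> complex) \<Rightarrow> nat \<Rightarrow> complex" where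
  "gram_op N g x J w a = w a + complex_of_real g * (\<Sum>k\<in>J. ip N (x k) w * x k a)"

text \<open>If \<open>C\<close> inverts B, this inverts B + g h h^*. The form h^* C h is real and
  nonnegative, hence \<open>Re\<close> and a denominator that never vanishes.\<close>

definition rank1_update ::
    "nat \<Rightarrow> real \<Rightarrow> (nat \<Rightarrow> complex) \<Rightarrow> ((nat \<Rightarrow> complex) \<Rightarrow> nat \<Rightarrow> complex) \<Rightarrow> (nat \<Rightarrow> complex) \<Rightarrow> nat \<Rightarrow> complex" where
  "rank1_update N g h C v a
     = C v a - complex_of_real (g / (1 + g * Re (ip N h (C h)))) * ip N h (C v) * C h a"

text \<open>The inverse of \<open>I + g \<Sum>\<^sub>k x\<^sub>k x\<^sub>k\<^sup>*\<close> is built by Sherman-Morrison updates, one vector at a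
  time, so that its measurability in \<open>x\<close> is immediate; since inverses are unique, the order of
  the updates does not matter.\<close>

fun resolvent_list ::
    "nat \<Rightarrow> real \<Rightarrow> (nat \<Rightarrow> nat \<Rightarrow> complex) \<Rightarrow> nat list \<Rightarrow> (nat \<Rightarrow> complex) \<Rightarrow> nat \<Rightarrow> complex" where
  "resolvent_list N g x [] = (\<lambda>v. v)"
| "resolvent_list N g x (k # ks) = rank1_update N g (x k) (resolvent_list N g x ks)"

definition resolvent ::
    "nat \<Rightarrow> real \<Rightarrow> (nat \<Rightarrow> nat \<Rightarrow> complex) \<Rightarrow> nat set \<Rightarrow> (nat \<Rightarrow> complex) \<Rightarrow> nat \<Rightarrow> complex" where
  "resolvent N g x J = resolvent_list N g x (sorted_list_of_set J)"

lemma gram_op_ip: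
  "ip N w (gram_op N g x J w) = complex_of_real (nrm2 N w + g * (\<Sum>k\<in>J. (cmod (ip N (x k) w))\<^sup>2))"
proof -
  have "ip N w (gram_op N g x J w) = ip N w w + g * (\<Sum>k\<in>J. ip N (x k) w * ip N w (x k))"
    unfolding gram_op_def
    by (simp add: ip_add_right ip_scale_right ip_sum_right)
  also have "(\<Sum>k\<in>J. ip N (x k) w * ip N w (x k)) = (\<Sum>k\<in>J. complex_of_real ((cmod (ip N (x k) w))\<^sup>2))"
    by (intro sum.cong refl) (simp only: complex_norm_square cnj_ip)
  finally show ?thesis by (simp add: ip_self)
qed

lemma gram_op_linear:
  "gram_op N g x J (\<lambda>a. u a - c * v a) a = gram_op N g x J u a - c * gram_op N g x J v a"
  by (simp add: gram_op_def ip_diff_right ip_scale_right algebra_simps sum_subtractf sum_distrib_left)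

text \<open>Being a right inverse already determines \<open>C\<close>, by injectivity of
  \<open>gram_op\<close>. Self-adjointness is carried along through the updates, where it can be
  read off the formula.\<close>

definition inverts_gram ::
    "nat \<Rightarrow> real \<Rightarrow> (nat \<Rightarrow> nat \<Rightarrow> complex) \<Rightarrow> nat set \<Rightarrow> ((nat \<Rightarrow> complex) \<Rightarrow> nat \<Rightarrow> complex) \<Rightarrow> bool" where
  "inverts_gram N g x J C \<longleftrightarrow>
     (\<forall>v. gram_op N g x J (C v) = v) \<and> (\<forall>u v. ip N u (C v) = cnj (ip N v (C u)))"

text \<open>With w = C v one has v = (I + g X X^* ) w, so the form v^* C v equals w^* (I + g X X^* )
  w. Realness, nonnegativity and |C v|^2 \<le> v^* C v all follow; the last inequality is the source
  of the norm and trace bounds below.\<close>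

lemma inverts_gram_form:
  assumes C: "inverts_gram N g x J C" and g: "g \<ge> 0"
  shows "ip N v (C v) = complex_of_real (nrm2 N (C v) + g * (\<Sum>k\<in>J. (cmod (ip N (x k) (C v)))\<^sup>2))"
    (is "_ = complex_of_real ?r")
    and "nrm2 N (C v) \<le> Re (ip N v (C v))"
proof -
  have "ip N v (C v) = cnj (ip N (C v) v)" by (simp add: cnj_ip)
  also have "ip N (C v) v = ip N (C v) (gram_op N g x J (C v))"
    using C by (simp add: inverts_gram_def)
  also have "\<dots> = complex_of_real ?r" by (rule gram_op_ip)
  finally show 1: "ip N v (C v) = complex_of_real ?r" by simp
  show "nrm2 N (C v) \<le> Re (ip N v (C v))" unfolding 1 using g by (simp add: sum_nonneg)
qed

lemma inverts_gram_empty: "inverts_gram N g x {} (\<lambda>v. v)"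
  by (simp add: inverts_gram_def gram_op_def cnj_ip fun_eq_iff)

lemma inverts_gram_update:
  assumes C: "inverts_gram N g x J C" and g: "g \<ge> 0" and J: "finite J" "k \<notin> J"
  shows "inverts_gram N g x (insert k J) (rank1_update N g (x k) C)"
proof -
  let ?h = "x k"
  define q where "q = Re (ip N ?h (C ?h))"
  have q: "ip N ?h (C ?h) = complex_of_real q" "q \<ge> 0"
    using inverts_gram_form[OF C g, of ?h] nrm2_nonneg[of N "C ?h"] by (auto simp: q_def simp del: nrm2_nonneg)
  define t where "t = complex_of_real (g / (1 + g * q))"
  \<comment> \<open>The defining property of the Sherman-Morrison coefficient: with it the multiple
    of x_k left over after the update cancels.\<close>
  have t: "g - t * (1 + g * q) = (0::complex)"
  proof -
    have "1 + g * q > 0" using q g by (simp add: add_pos_nonneg)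
    then have "g - g / (1 + g * q) * (1 + g * q) = 0" by simp
    then have "complex_of_real (g - g / (1 + g * q) * (1 + g * q)) = 0" by (simp only: of_real_0)
    then show ?thesis unfolding t_def by (simp only: of_real_diff of_real_mult of_real_add of_real_1)
  qed
  have up: "rank1_update N g ?h C v = (\<lambda>a. C v a - (t * ip N ?h (C v)) * C ?h a)" for v
    by (simp add: rank1_update_def fun_eq_iff t_def q_def mult.assoc)
  have ins: "gram_op N g x (insert k J) w a = gram_op N g x J w a + g * ip N ?h w * ?h a" for w a
    using J by (simp add: gram_op_def algebra_simps)
  have inv: "gram_op N g x J (C v) a = v a" for v a
    using C by (simp add: inverts_gram_def)
  have "gram_op N g x (insert k J) (rank1_update N g ?h C v) a = v a" for v a
  proof -
    let ?s = "ip N ?h (C v)"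
    have "gram_op N g x (insert k J) (rank1_update N g ?h C v) a
        = v a - t * ?s * ?h a + g * (?s - t * ?s * q) * ?h a"
      unfolding ins unfolding up gram_op_linear inv ip_diff_right ip_scale_right q(1) by (simp add: algebra_simps)
    also have "\<dots> = v a + ?s * ?h a * (g - t * (1 + g * q))" by (simp add: algebra_simps)
    finally show ?thesis unfolding t by simp
  qed
  moreover have "ip N u (rank1_update N g ?h C v) = cnj (ip N v (rank1_update N g ?h C u))" for u v
  proof -
    have sa: "ip N u (C v) = cnj (ip N v (C u))" for u v
      using C unfolding inverts_gram_def by blast
    have "ip N u (rank1_update N g ?h C v) = ip N u (C v) - t * ip N ?h (C v) * ip N u (C ?h)" for u v
      unfolding up by (simp add: ip_diff_right ip_scale_right)
    moreover have "cnj t = t" by (simp add: t_def)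
    ultimately show ?thesis using sa[of u v] sa[of ?h v] sa[of u ?h] by simp
  qed
  ultimately show ?thesis unfolding inverts_gram_def by blast
qed

lemma inverts_gram_resolvent_list:
  assumes "g \<ge> 0" "distinct ks"
  shows "inverts_gram N g x (set ks) (resolvent_list N g x ks)"
  using assms(2)
proof (induction ks)
  case Nil
  then show ?case by (simp add: inverts_gram_empty)
next
  case (Cons k ks)
  then show ?case using inverts_gram_update[of N g x "set ks" _ k] assms(1) by simp
qed

lemma inverts_gram_resolvent:
  assumes "g \<ge> 0" "finite J"
  shows "inverts_gram N g x J (resolvent N g x J)"
  using inverts_gram_resolvent_list[OF assms(1), of "sorted_list_of_set J" N x] assms(2)
  by (simp add: resolvent_def)

text \<open>On the coordinates below \<open>N\<close> the difference vanishes by positivity of the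
  form. Its inner products with the x_k are then zero, so \<open>gram_op\<close> returns the
  difference unchanged on the remaining coordinates.\<close>

lemma gram_op_injective:
  assumes g: "g \<ge> 0" and J: "finite J" and eq: "gram_op N g x J u = gram_op N g x J w"
  shows "u = w"
proof -
  let ?d = "\<lambda>a. u a - 1 * w a"
  have B0: "gram_op N g x J ?d = (\<lambda>a. 0)"
    unfolding fun_eq_iff gram_op_linear eq by simp
  have "ip N ?d (gram_op N g x J ?d) = 0" unfolding B0 by (simp add: ip_def)
  then have "nrm2 N ?d + g * (\<Sum>k\<in>J. (cmod (ip N (x k) ?d))\<^sup>2) = 0"
    unfolding gram_op_ip of_real_eq_0_iff .
  moreover have "g * (\<Sum>k\<in>J. (cmod (ip N (x k) ?d))\<^sup>2) \<ge> 0" using g by (simp add: sum_nonneg)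
  ultimately have "nrm2 N ?d = 0" using nrm2_nonneg[of N ?d] by linarith
  then have d0: "?d a = 0" if "a < N" for a
    using that by (simp add: nrm2_def sum_nonneg_eq_0_iff)
  have "ip N (x k) ?d = 0" for k using d0 by (simp add: ip_def)
  then have "?d a = 0" for a using fun_cong[OF B0, of a] by (simp add: gram_op_def)
  then show "u = w" by auto
qed

lemma resolvent_unique:
  assumes "g \<ge> 0" "finite J" "inverts_gram N g x J C"
  shows "C = resolvent N g x J"
proof
  fix v
  show "C v = resolvent N g x J v"
    by (rule gram_op_injective[OF assms(1,2), where N = N and x = x])
       (use assms inverts_gram_resolvent[OF assms(1,2), of N x] in \<open>simp add: inverts_gram_def\<close>)
qed

lemma resolvent_insert:
  assumes "g \<ge> 0" "finite J" "k \<notin> J"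
  shows "resolvent N g x (insert k J) = rank1_update N g (x k) (resolvent N g x J)"
  using resolvent_unique[of g "insert k J" N x] inverts_gram_update[OF inverts_gram_resolvent] assms
  by (metis finite_insert)

lemma gram_op_resolvent:
  assumes "g \<ge> 0" "finite J"
  shows "gram_op N g x J (resolvent N g x J v) = v"
  using inverts_gram_resolvent[OF assms] by (simp add: inverts_gram_def)

lemma resolvent_selfadjoint:
  assumes "g \<ge> 0" "finite J"
  shows "ip N u (resolvent N g x J v) = cnj (ip N v (resolvent N g x J u))"
  using inverts_gram_resolvent[OF assms] unfolding inverts_gram_def by blast

lemma resolvent_entry_cnj:
  assumes "g \<ge> 0" "finite J" "a < N" "b < N"
  shows "resolvent N g x J (unitv b) a = cnj (resolvent N g x J (unitv a) b)"
  using resolvent_selfadjoint[OF assms(1,2), of N "unitv a" x "unitv b"] assms(3,4)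
  by (simp add: ip_unitv_left)

lemma resolvent_form_real:
  assumes "g \<ge> 0" "finite J"
  shows "ip N v (resolvent N g x J v) = complex_of_real (Re (ip N v (resolvent N g x J v)))"
  unfolding inverts_gram_form(1)[OF inverts_gram_resolvent[OF assms] assms(1)] by simp

lemma nrm2_resolvent_le_form:
  assumes "g \<ge> 0" "finite J"
  shows "nrm2 N (resolvent N g x J v) \<le> Re (ip N v (resolvent N g x J v))"
  using inverts_gram_form(2)[OF inverts_gram_resolvent[OF assms] assms(1)] .

text \<open>|C v|^2 \<le> v^* C v \<le> |v| |C v|, and one factor |C v| cancels.\<close>

lemma nrm2_resolvent_le:
  assumes "g \<ge> 0" "finite J"
  shows "nrm2 N (resolvent N g x J v) \<le> nrm2 N v"
proof -
  let ?w = "resolvent N g x J v"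
  have n: "nrm2 N ?w \<le> cmod (ip N v ?w)"
    using nrm2_resolvent_le_form[OF assms, of N x v] complex_Re_le_cmod order_trans by blast
  have "(nrm2 N ?w)\<^sup>2 \<le> (cmod (ip N v ?w))\<^sup>2"
    using n by (intro power_mono) auto
  also have "\<dots> \<le> nrm2 N v * nrm2 N ?w" by (rule ip_Cauchy_Schwarz)
  finally have "nrm2 N ?w * nrm2 N ?w \<le> nrm2 N v * nrm2 N ?w" by (simp add: power2_eq_square)
  then show ?thesis using nrm2_nonneg[of N ?w] nrm2_nonneg[of N v]
    by (metis mult_le_cancel_right order_le_less less_eq_real_def not_le)
qed

section \<open>Entries and trace of the resolvent under rank-one changes\<close>

definition res_entry :: "nat \<Rightarrow> real \<Rightarrow> (nat \<Rightarrow> nat \<Rightarrow> complex) \<Rightarrow> nat set \<Rightarrow> nat \<Rightarrow> nat \<Rightarrow> complex" where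
  "res_entry N g x J a b = resolvent N g x J (unitv b) a"

definition res_trace :: "nat \<Rightarrow> real \<Rightarrow> (nat \<Rightarrow> nat \<Rightarrow> complex) \<Rightarrow> nat set \<Rightarrow> real" where
  "res_trace N g x J = (\<Sum>b<N. Re (res_entry N g x J b b))"

lemma res_entry_cnj:
  assumes "g \<ge> 0" "finite J" "a < N" "b < N"
  shows "res_entry N g x J a b = cnj (res_entry N g x J b a)"
  unfolding res_entry_def by (rule resolvent_entry_cnj[OF assms])

lemma res_entry_diag:
  assumes "g \<ge> 0" "finite J" "b < N"
  shows "res_entry N g x J b b = complex_of_real (Re (res_entry N g x J b b))"
    "0 \<le> Re (res_entry N g x J b b)" "Re (res_entry N g x J b b) \<le> 1"
    "(\<Sum>a<N. (cmod (res_entry N g x J a b))\<^sup>2) \<le> 1"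
    "(\<Sum>a<N. (cmod (res_entry N g x J b a))\<^sup>2) \<le> 1"
proof -
  let ?w = "resolvent N g x J (unitv b)"
  have e: "ip N (unitv b) ?w = res_entry N g x J b b"
    using assms(3) by (simp add: ip_unitv_left res_entry_def)
  show "res_entry N g x J b b = complex_of_real (Re (res_entry N g x J b b))"
    using resolvent_form_real[OF assms(1,2), of N "unitv b" x] unfolding e .
  have n1: "nrm2 N ?w \<le> 1" using nrm2_resolvent_le[OF assms(1,2), of N x "unitv b"] nrm2_unitv[OF assms(3)] by simp
  have "nrm2 N ?w \<le> Re (res_entry N g x J b b)"
    using nrm2_resolvent_le_form[OF assms(1,2), of N x "unitv b"] unfolding e .
  then show "0 \<le> Re (res_entry N g x J b b)" using nrm2_nonneg[of N ?w] by linarith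
  have "(cmod (ip N (unitv b) ?w))\<^sup>2 \<le> 1"
    using ip_Cauchy_Schwarz[of N "unitv b" ?w] n1 nrm2_unitv[OF assms(3)] by simp
  then have "cmod (res_entry N g x J b b) \<le> 1" unfolding e by (simp add: power2_le_iff_abs_le abs_square_le_1)
  then show "Re (res_entry N g x J b b) \<le> 1" using complex_Re_le_cmod order_trans by blast
  show c: "(\<Sum>a<N. (cmod (res_entry N g x J a b))\<^sup>2) \<le> 1"
    using n1 by (simp add: nrm2_def res_entry_def)
  have "(\<Sum>a<N. (cmod (res_entry N g x J b a))\<^sup>2) = (\<Sum>a<N. (cmod (res_entry N g x J a b))\<^sup>2)"
    by (intro sum.cong refl) (metis res_entry_cnj[OF assms(1,2)] assms(3) complex_mod_cnj lessThan_iff)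
  then show "(\<Sum>a<N. (cmod (res_entry N g x J b a))\<^sup>2) \<le> 1" using c by simp
qed

lemma resolvent_apply:
  assumes "g \<ge> 0" "finite J" "a < N"
  shows "resolvent N g x J v a = (\<Sum>b<N. res_entry N g x J a b * v b)"
proof -
  have "resolvent N g x J v a = ip N (unitv a) (resolvent N g x J v)"
    using assms(3) by (simp add: ip_unitv_left)
  also have "\<dots> = cnj (ip N v (resolvent N g x J (unitv a)))"
    by (rule resolvent_selfadjoint[OF assms(1,2)])
  also have "\<dots> = (\<Sum>b<N. v b * cnj (res_entry N g x J b a))"
    by (simp add: ip_def cnj_sum res_entry_def)
  also have "\<dots> = (\<Sum>b<N. res_entry N g x J a b * v b)"
    using res_entry_cnj[OF assms(1,2,3), symmetric] by (intro sum.cong) auto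
  finally show ?thesis .
qed

lemma form_update:
  assumes g: "g \<ge> 0" and J: "finite J" "k \<notin> J"
  shows "ip N u (resolvent N g x (insert k J) v) = ip N u (resolvent N g x J v)
    - complex_of_real (g / (1 + g * Re (ip N (x k) (resolvent N g x J (x k)))))
      * ip N (x k) (resolvent N g x J v) * ip N u (resolvent N g x J (x k))"
  unfolding resolvent_insert[OF g J] rank1_update_def
  by (simp only: ip_diff_right ip_scale_right mult.assoc)

text \<open>q - g q^2 / (1 + g q) = q / (1 + g q). This expresses the form with the column included
  through the form with the column left out, in which column and resolvent will be
  independent.\<close>

lemma form_update_self:
  fixes x :: "nat \<Rightarrow> nat \<Rightarrow> complex" and N :: nat
  assumes g: "g \<ge> 0" and J: "finite J" "k \<notin> J"
  defines "q \<equiv> Re (ip N (x k) (resolvent N g x J (x k)))"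
  shows "ip N (x k) (resolvent N g x (insert k J) (x k)) = complex_of_real (q / (1 + g * q))"
proof -
  have q: "ip N (x k) (resolvent N g x J (x k)) = complex_of_real q"
    unfolding q_def by (rule resolvent_form_real[OF g J(1)])
  have "q \<ge> 0" unfolding q_def using nrm2_resolvent_le_form[OF g J(1), of N x "x k"] nrm2_nonneg order_trans by blast
  then have "1 + g * q > 0" using g by (simp add: add_pos_nonneg)
  then have e: "q / (1 + g * q) = q - g / (1 + g * q) * q * q" by (simp add: field_simps)
  show ?thesis
    unfolding form_update[OF g J] q e by (simp only: of_real_diff of_real_mult Re_complex_of_real)
qed

lemma res_trace_update:
  assumes g: "g \<ge> 0" and J: "finite J" "k \<notin> J"
  shows "res_trace N g x (insert k J) = res_trace N g x J
     - g / (1 + g * Re (ip N (x k) (resolvent N g x J (x k)))) * nrm2 N (resolvent N g x J (x k))"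
proof -
  let ?C = "resolvent N g x J" and ?h = "x k"
  let ?t = "g / (1 + g * Re (ip N ?h (?C ?h)))"
  have "Re (res_entry N g x (insert k J) b b) = Re (res_entry N g x J b b) - ?t * (cmod (?C ?h b))\<^sup>2"
    if b: "b < N" for b
  proof -
    have s: "ip N ?h (?C (unitv b)) = cnj (?C ?h b)"
      using resolvent_selfadjoint[OF g J(1), of N ?h x "unitv b"] b by (simp add: ip_unitv_left)
    have "res_entry N g x (insert k J) b b = res_entry N g x J b b - complex_of_real ?t
        * ip N ?h (?C (unitv b)) * ?C ?h b"
      by (simp add: res_entry_def resolvent_insert[OF g J] rank1_update_def)
    also have "\<dots> = res_entry N g x J b b - complex_of_real ?t * (?C ?h b * cnj (?C ?h b))"
      unfolding s by simp
    also have "\<dots> = res_entry N g x J b b - complex_of_real (?t * (cmod (?C ?h b))\<^sup>2)"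
      by (simp only: complex_norm_square[symmetric] of_real_mult of_real_power)
    finally show ?thesis by simp
  qed
  then show ?thesis
    by (simp add: res_trace_def nrm2_def sum_subtractf sum_distrib_left)
qed

text \<open>The change is g |C h|^2 / (1 + g q) and |C h|^2 \<le> q, so it stays below 1 whatever
  the length of the new column. After normalization, leaving out a column costs at most 1/N.\<close>

lemma res_trace_update_bound:
  assumes g: "g \<ge> 0" and J: "finite J" "k \<notin> J"
  shows "\<bar>res_trace N g x (insert k J) - res_trace N g x J\<bar> \<le> 1"
proof -
  let ?C = "resolvent N g x J" and ?h = "x k"
  define q where "q = Re (ip N ?h (?C ?h))"
  have n: "nrm2 N (?C ?h) \<le> q" unfolding q_def by (rule nrm2_resolvent_le_form[OF g J(1)])
  have q: "q \<ge> 0" using n nrm2_nonneg[of N "?C ?h"] by linarith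
  then have p: "1 + g * q > 0" using g by (simp add: add_pos_nonneg)
  have "g / (1 + g * q) * nrm2 N (?C ?h) \<le> g / (1 + g * q) * q"
    using n g p by (intro mult_left_mono) auto
  also have "\<dots> \<le> 1" using p by (simp add: field_simps)
  finally have "g / (1 + g * q) * nrm2 N (?C ?h) \<le> 1" .
  moreover have "g / (1 + g * q) * nrm2 N (?C ?h) \<ge> 0" using g p by simp
  ultimately show ?thesis unfolding res_trace_update[OF g J] q_def[symmetric] by linarith
qed

lemma res_trace_identity:
  assumes g: "g \<ge> 0" and J: "finite J"
  shows "real N = res_trace N g x J
    + (\<Sum>k\<in>J. g * Re (ip N (x k) (resolvent N g x (J - {k}) (x k)))
          / (1 + g * Re (ip N (x k) (resolvent N g x (J - {k}) (x k)))))"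
proof -
  let ?C = "resolvent N g x J"
  have "1 = res_entry N g x J b b + g * (\<Sum>k\<in>J. cnj (?C (x k) b) * x k b)" if b: "b < N" for b
  proof -
    have "unitv b b = gram_op N g x J (?C (unitv b)) b" using gram_op_resolvent[OF g J] by simp
    also have "\<dots> = res_entry N g x J b b + g * (\<Sum>k\<in>J. ip N (x k) (?C (unitv b)) * x k b)"
      by (simp add: gram_op_def res_entry_def)
    also have "(\<Sum>k\<in>J. ip N (x k) (?C (unitv b)) * x k b) = (\<Sum>k\<in>J. cnj (?C (x k) b) * x k b)"
      using resolvent_selfadjoint[OF g J, of N _ x "unitv b"] b by (simp add: ip_unitv_left)
    finally show ?thesis by (simp add: unitv_def)
  qed
  then have "(\<Sum>b<N. 1) = (\<Sum>b<N. res_entry N g x J b b + g * (\<Sum>k\<in>J. cnj (?C (x k) b) * x k b))"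
    by (intro sum.cong) auto
  also have "\<dots> = (\<Sum>b<N. res_entry N g x J b b) + g * (\<Sum>k\<in>J. ip N (?C (x k)) (x k))"
    unfolding ip_def sum.distrib sum_distrib_left by (simp add: sum.swap[of _ J])
  finally have E: "(\<Sum>b<N. 1) = (\<Sum>b<N. res_entry N g x J b b) + g * (\<Sum>k\<in>J. ip N (?C (x k)) (x k))" .
  have "real N = Re (\<Sum>b<N. 1)" by simp
  also have "\<dots> = Re ((\<Sum>b<N. res_entry N g x J b b) + g * (\<Sum>k\<in>J. ip N (?C (x k)) (x k)))"
    unfolding E ..
  also have "\<dots> = res_trace N g x J + (\<Sum>k\<in>J. g * Re (ip N (?C (x k)) (x k)))"
    by (simp add: res_trace_def sum_distrib_left)
  also have "(\<Sum>k\<in>J. g * Re (ip N (?C (x k)) (x k))) = (\<Sum>k\<in>J. g * Re (ip N (x k) (resolvent N g x (J - {k}) (x k)))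
          / (1 + g * Re (ip N (x k) (resolvent N g x (J - {k}) (x k)))))"
  proof (intro sum.cong refl)
    fix k assume k: "k \<in> J"
    have "Re (ip N (?C (x k)) (x k)) = Re (ip N (x k) (?C (x k)))"
      by (metis cnj_ip cnj.sel(1))
    also have "\<dots> = Re (ip N (x k) (resolvent N g x (J - {k}) (x k)))
          / (1 + g * Re (ip N (x k) (resolvent N g x (J - {k}) (x k))))"
      using form_update_self[OF g, of "J - {k}" k N x] J k by (simp add: insert_absorb)
    finally show "g * Re (ip N (?C (x k)) (x k)) = g * Re (ip N (x k) (resolvent N g x (J - {k}) (x k)))
          / (1 + g * Re (ip N (x k) (resolvent N g x (J - {k}) (x k))))" by simp
  qed
  finally show ?thesis .
qed

text \<open>The denominator of the update is at least 1 and is dropped, which leaves the square of a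
  cross term. This allows a form with two columns removed from the resolvent to be compared with one
  where a single column is removed.\<close>

lemma form_update_diff:
  assumes g: "g \<ge> 0" and J: "finite J" "k \<notin> J"
  shows "\<bar>Re (ip N u (resolvent N g x (insert k J) u)) - Re (ip N u (resolvent N g x J u))\<bar>
     \<le> g * (cmod (ip N u (resolvent N g x J (x k))))\<^sup>2"
proof -
  let ?C = "resolvent N g x J"
  define q where "q = Re (ip N (x k) (?C (x k)))"
  have q: "q \<ge> 0" unfolding q_def using nrm2_resolvent_le_form[OF g J(1), of N x "x k"] nrm2_nonneg order_trans
      by blast
  then have p: "1 + g * q \<ge> 1" using g by simp
  have s: "ip N (x k) (?C u) = cnj (ip N u (?C (x k)))"
    by (rule resolvent_selfadjoint[OF g J(1)])
  have "ip N u (resolvent N g x (insert k J) u) = ip N u (?C u)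
      - complex_of_real (g / (1 + g * q)) * (ip N u (?C (x k)) * cnj (ip N u (?C (x k))))"
    unfolding form_update[OF g J] q_def[symmetric] s by simp
  also have "\<dots> = ip N u (?C u) - complex_of_real (g / (1 + g * q) * (cmod (ip N u (?C (x k))))\<^sup>2)"
    by (simp only: complex_norm_square[symmetric] of_real_mult of_real_power)
  finally have "\<bar>Re (ip N u (resolvent N g x (insert k J) u)) - Re (ip N u (?C u))\<bar>
      = g / (1 + g * q) * (cmod (ip N u (?C (x k))))\<^sup>2" using g p by simp
  also have "\<dots> \<le> g / 1 * (cmod (ip N u (?C (x k))))\<^sup>2"
    using g p by (intro mult_right_mono divide_left_mono) auto
  finally show ?thesis by simp
qed

lemma resolvent_list_cong:
  "(\<And>k. k \<in> set ks \<Longrightarrow> x k = y k) \<Longrightarrow> resolvent_list N g x ks = resolvent_list N g y ks"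
  by (induction ks) auto

lemma resolvent_cong:
  assumes "finite J" "\<And>k. k \<in> J \<Longrightarrow> x k = y k"
  shows "resolvent N g x J = resolvent N g y J"
  unfolding resolvent_def using assms by (intro resolvent_list_cong) auto

section \<open>Nonzero eigenvalues of a pair\<close>

text \<open>The resolvent form is positive semidefinite. Its value at D u - cnj \<beta> v, a
  multiple of the part of u orthogonal to v in this form, is D (D A - |\<beta>|^2). The inequality
  guarantees that the 2 x 2 matrix of a pair has nonnegative determinant.\<close>

lemma resolvent_form_Cauchy_Schwarz:
  assumes g: "g \<ge> 0" and J: "finite J"
  shows "(cmod (ip N u (resolvent N g x J v)))\<^sup>2
    \<le> Re (ip N u (resolvent N g x J u)) * Re (ip N v (resolvent N g x J v))"
proof -
  let ?C = "resolvent N g x J"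
  define \<beta> where "\<beta> = ip N u (?C v)"
  define A where "A = Re (ip N u (?C u))"
  define D where "D = Re (ip N v (?C v))"
  have A: "ip N u (?C u) = complex_of_real A" and D: "ip N v (?C v) = complex_of_real D"
    unfolding A_def D_def by (rule resolvent_form_real[OF g J])+
  have \<beta>': "ip N v (?C u) = cnj \<beta>" unfolding \<beta>_def by (rule resolvent_selfadjoint[OF g J])
  have nonneg: "Re (ip N w (?C w)) \<ge> 0" for w
    using nrm2_resolvent_le_form[OF g J, of N x w] nrm2_nonneg order_trans by blast
  show ?thesis
  proof (cases "D = 0")
    case True
    then have "nrm2 N (?C v) \<le> 0"
      using nrm2_resolvent_le_form[OF g J, of N x v] by (simp add: D_def)
    then have "nrm2 N (?C v) = 0" using nrm2_nonneg[of N "?C v"] by linarith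
    then have "(cmod \<beta>)\<^sup>2 \<le> 0" unfolding \<beta>_def using ip_Cauchy_Schwarz[of N u "?C v"] by simp
    then show ?thesis using True by (simp add: \<beta>_def D_def[symmetric])
  next
    case False
    then have Dpos: "D > 0" using nonneg[of v] by (simp add: D_def)
    define w where "w = (\<lambda>a. complex_of_real D * u a - cnj \<beta> * v a)"
    have Cw: "ip N z (?C w) = D * cnj (ip N u (?C z)) - cnj \<beta> * cnj (ip N v (?C z))" for z
    proof -
      have "ip N z (?C w) = cnj (ip N w (?C z))" by (rule resolvent_selfadjoint[OF g J])
      also have "\<dots> = ip N (?C z) w" by (rule cnj_ip)
      also have "\<dots> = D * ip N (?C z) u - cnj \<beta> * ip N (?C z) v"
        unfolding w_def by (simp add: ip_diff_right ip_scale_right)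
      finally show ?thesis by (simp add: cnj_ip)
    qed
    have "ip N w (?C w) = cnj (ip N (?C w) w)" by (simp add: cnj_ip)
    also have "ip N (?C w) w = D * cnj (ip N u (?C w)) - cnj \<beta> * cnj (ip N v (?C w))"
      unfolding cnj_ip by (subst (2) w_def) (simp add: ip_diff_right ip_scale_right)
    also have "cnj \<dots> = D * (D * A - cnj \<beta> * \<beta>)"
      unfolding Cw A D \<beta>' by (simp add: \<beta>_def[symmetric] algebra_simps)
    also have "\<dots> = complex_of_real (D * (D * A - (cmod \<beta>)\<^sup>2))"
      by (simp add: complex_norm_square mult.commute del: of_real_power)
    finally have "D * (D * A - (cmod \<beta>)\<^sup>2) \<ge> 0" using nonneg[of w] by simp
    then have "D * A - (cmod \<beta>)\<^sup>2 \<ge> 0" using Dpos by (simp add: zero_le_mult_iff)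
    then show ?thesis by (simp add: \<beta>_def A_def D_def mult.commute)
  qed
qed

text \<open>\<open>pick I\<close> lists the elements of \<open>I\<close> in increasing order. The
  indices are counted below \<open>n\<close> because \<open>I\<close> may be the complement of a
  pair, an infinite set whose \<open>card\<close> is 0.\<close>

lemma sum_pick:
  "(\<Sum>l<card {j. j < n \<and> j \<in> I}. f (pick I l)) = (\<Sum>j | j < n \<and> j \<in> I. f j)"
  and inj_on_pick: "inj_on (pick I) {..<card {j. j < n \<and> j \<in> I}}"
proof -
  let ?S = "{j. j < n \<and> j \<in> I}"
  have lt: "l < card I \<or> infinite I" if "l < card ?S" for l
  proof (cases "finite I")
    case True
    then have "card ?S \<le> card I" by (intro card_mono) auto
    then show ?thesis using that by simp
  qed simp
  show inj: "inj_on (pick I) {..<card ?S}"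
    using card_pick[OF lt] by (intro inj_onI) (metis lessThan_iff)
  have "pick I ` {..<card ?S} = ?S"
  proof
    show "pick I ` {..<card ?S} \<subseteq> ?S" 
    proof (rule image_subsetI)
      fix l assume "l \<in> {..<card ?S}"
      then have l: "l < card ?S" by simp
      show "pick I l \<in> ?S" using pick_in_set[OF lt[OF l]] pick_le[OF l] by simp
    qed
    show "?S \<subseteq> pick I ` {..<card ?S}"
    proof
      fix j assume j: "j \<in> ?S"
      have "{a \<in> I. a < j} \<subset> ?S" using j by auto
      then have "card {a \<in> I. a < j} < card ?S" by (intro psubset_card_mono) auto
      then show "j \<in> pick I ` {..<card ?S}"
        using pick_card_in_set[of j I] j by (intro image_eqI[of _ _ "card {a \<in> I. a < j}"]) auto
    qed
  qed
  with inj have "bij_betw (pick I) {..<card ?S} ?S" by (simp add: bij_betw_def)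
  then show "(\<Sum>l<card ?S. f (pick I l)) = (\<Sum>j\<in>?S. f j)"
    by (rule sum.reindex_bij_betw)
qed

lemma submatrix_gram:
  fixes H :: "complex mat"
  assumes H: "H \<in> carrier_mat N K"
  shows "submatrix H UNIV I * submatrix (c \<cdot>\<^sub>m 1\<^sub>m K) I I * mat_adjoint (submatrix H UNIV I)
    = mat N N (\<lambda>(a, b). c * (\<Sum>k | k < K \<and> k \<in> I. H $$ (a, k) * cnj (H $$ (b, k))))"
proof -
  let ?S = "{j. j < K \<and> j \<in> I}"
  have dims: "dim_row H = N" "dim_col H = K" using H by auto
  define X where "X = submatrix H UNIV I"
  have X: "X \<in> carrier_mat N (card ?S)"
    by (rule carrier_matI) (simp_all add: X_def dim_submatrix dims)
  have Xe: "X $$ (a, l) = H $$ (a, pick I l)" if "a < N" "l < card ?S" for a l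
    using that by (simp add: X_def submatrix_index dims pick_UNIV)
  have P: "submatrix (c \<cdot>\<^sub>m 1\<^sub>m K) I I = c \<cdot>\<^sub>m 1\<^sub>m (card ?S)"
  proof (rule eq_matI)
    fix i j assume "i < dim_row (c \<cdot>\<^sub>m 1\<^sub>m (card ?S))" "j < dim_col (c \<cdot>\<^sub>m 1\<^sub>m (card ?S))"
    then have ij: "i < card ?S" "j < card ?S" by auto
    have "pick I i < K" "pick I j < K" using ij pick_le by auto
    moreover have "pick I i = pick I j \<longleftrightarrow> i = j"
      using inj_on_pick[of I K] ij by (auto dest: inj_onD)
    ultimately show "submatrix (c \<cdot>\<^sub>m 1\<^sub>m K) I I $$ (i, j) = (c \<cdot>\<^sub>m 1\<^sub>m (card ?S)) $$ (i, j)"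
      using ij by (simp add: submatrix_index)
  qed (simp_all add: dim_submatrix)
  have "X * (c \<cdot>\<^sub>m 1\<^sub>m (card ?S)) = c \<cdot>\<^sub>m X"
    using X mult_smult_distrib[OF X one_carrier_mat, of c] by simp
  then have "X * (c \<cdot>\<^sub>m 1\<^sub>m (card ?S)) * mat_adjoint X = (c \<cdot>\<^sub>m X) * mat_adjoint X" by simp
  also have "\<dots> = mat N N (\<lambda>(a, b). c * (\<Sum>k\<in>?S. H $$ (a, k) * cnj (H $$ (b, k))))"
  proof (rule eq_matI)
    fix a b
    assume "a < dim_row (mat N N (\<lambda>(a, b). c * (\<Sum>k\<in>?S. H $$ (a, k) * cnj (H $$ (b, k)))))"
      "b < dim_col (mat N N (\<lambda>(a, b). c * (\<Sum>k\<in>?S. H $$ (a, k) * cnj (H $$ (b, k)))))"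
    then have ab: "a < N" "b < N" by auto
    have "((c \<cdot>\<^sub>m X) * mat_adjoint X) $$ (a, b) = (\<Sum>l<card ?S. (c \<cdot>\<^sub>m X) $$ (a, l) * mat_adjoint X $$ (l, b))"
      by (rule index_mult_mat_sum[of _ N _ _ N]) (use X ab in auto)
    also have "\<dots> = (\<Sum>l<card ?S. c * (H $$ (a, pick I l) * cnj (H $$ (b, pick I l))))"
      using X ab Xe by (intro sum.cong) (auto simp: conjugate_complex_def)
    also have "\<dots> = (\<Sum>k\<in>?S. c * (H $$ (a, k) * cnj (H $$ (b, k))))"
      by (rule sum_pick[where f = "\<lambda>k. c * (H $$ (a, k) * cnj (H $$ (b, k)))"])
    finally show "((c \<cdot>\<^sub>m X) * mat_adjoint X) $$ (a, b)
        = mat N N (\<lambda>(a, b). c * (\<Sum>k\<in>?S. H $$ (a, k) * cnj (H $$ (b, k)))) $$ (a, b)"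
      using ab by (simp add: sum_distrib_left)
  qed (use X in auto)
  finally show ?thesis unfolding X_def[symmetric] P .
qed

section \<open>Eigenvalues of two-by-two Hermitian matrices\<close>

lemma det_2x2:
  fixes M :: "'a :: comm_ring_1 mat"
  assumes M: "M \<in> carrier_mat 2 2"
  shows "det M = M $$ (0, 0) * M $$ (1, 1) - M $$ (0, 1) * M $$ (1, 0)"
proof -
  have d1: "det A = A $$ (0, 0)" if "A \<in> carrier_mat 1 1" for A :: "'a mat"
    using det_single[OF that] .
  have md: "mat_delete M i j \<in> carrier_mat 1 1" if "i < 2" "j < 2" for i j
    using mat_delete_carrier[OF M] by simp
  have "det M = (\<Sum>j<2. M $$ (0, j) * cofactor M 0 j)"
    by (rule laplace_expansion_row[OF M]) simp
  also have "\<dots> = M $$ (0, 0) * det (mat_delete M 0 0) - M $$ (0, 1) * det (mat_delete M 0 1)"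
    by (simp add: lessThan_Suc numeral_2_eq_2 cofactor_def)
  also have "det (mat_delete M 0 0) = M $$ (1, 1)"
    using d1[OF md[of 0 0]] M by (simp add: mat_delete_def)
  also have "det (mat_delete M 0 1) = M $$ (1, 0)"
    using d1[OF md[of 0 1]] M by (simp add: mat_delete_def)
  finally show ?thesis .
qed

lemma char_poly_2x2:
  fixes G :: "complex mat"
  assumes G: "G \<in> carrier_mat 2 2"
  shows "char_poly G = [:G $$ (0, 0) * G $$ (1, 1) - G $$ (0, 1) * G $$ (1, 0), - (G $$ (0, 0) + G $$ (1, 1)), 1:]"
proof -
  have "char_poly_matrix G $$ (i, i) = [:- G $$ (i, i), 1:]" if "i < 2" for i
    using that G by (simp add: char_poly_matrix_def)
  moreover have "char_poly_matrix G $$ (i, j) = [:- G $$ (i, j):]" if "i < 2" "j < 2" "i \<noteq> j" for i j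
    using that G by (simp add: char_poly_matrix_def)
  ultimately have e: "char_poly_matrix G $$ (0, 0) = [:- G $$ (0, 0), 1:]"
    "char_poly_matrix G $$ (1, 1) = [:- G $$ (1, 1), 1:]"
    "char_poly_matrix G $$ (0, 1) = [:- G $$ (0, 1):]" "char_poly_matrix G $$ (1, 0) = [:- G $$ (1, 0):]"
    by auto
  show ?thesis
    unfolding char_poly_def det_2x2[OF char_poly_matrix_closed[OF G]] e by simp
qed

text \<open>Powers of X contribute only the root 0, which \<open>nonzero_eigenvalues\<close> filters
  out. A vanishing \<open>l1\<close> or \<open>l2\<close> drops out of the list, and the default
  value 0 then returns it correctly.\<close>

lemma nonzero_eigenvalue_of_char_poly:
  fixes l1 l2 :: real
  assumes cp: "[:0, 1:] ^ k * char_poly A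
      = [:0, 1:] ^ n * ([:- complex_of_real l1, 1:] * [:- complex_of_real l2, 1:])"
    and l: "0 \<le> l2" "l2 \<le> l1"
  shows "nonzero_eigenvalue 1 A = l1" "nonzero_eigenvalue 2 A = l2"
proof -
  have nz: "char_poly A \<noteq> 0"
    using cp by (metis mult_eq_0_iff mult_zero_right pCons_eq_0_iff power_not_zero zero_neq_one)
  have "proots ([:0, 1:] ^ k * char_poly A)
      = proots ([:0, 1:] ^ n * ([:- complex_of_real l1, 1:] * [:- complex_of_real l2, 1:]))"
    using cp by simp
  also have "proots ([:0, 1:] ^ k * char_poly A) = replicate_mset k 0 + proots (char_poly A)"
    using nz by (subst proots_mult) (auto simp: proots_power)
  also have "proots ([:0, 1:] ^ n * ([:- complex_of_real l1, 1:] * [:- complex_of_real l2, 1:]))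
      = replicate_mset n 0 + {#complex_of_real l1, complex_of_real l2#}"
    by (subst proots_mult, simp, simp, subst proots_mult) (auto simp: proots_power)
  finally have "filter_mset (\<lambda>z. z \<noteq> 0) (replicate_mset k 0 + proots (char_poly A))
      = filter_mset (\<lambda>z. z \<noteq> 0) (replicate_mset n 0 + {#complex_of_real l1, complex_of_real l2#})"
    by simp
  moreover have "filter_mset (\<lambda>z. z \<noteq> 0) (replicate_mset m (0::complex)) = {#}" for m
    by (induction m) auto
  ultimately have "filter_mset (\<lambda>z. z \<noteq> 0) (proots (char_poly A))
      = filter_mset (\<lambda>z. z \<noteq> 0) {#complex_of_real l1, complex_of_real l2#}"
    by (simp only: filter_union_mset add_0)
  then have "nonzero_eigenvalues A = (if l1 = 0 then [] else if l2 = 0 then [l1] else [l1, l2])"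
    using l by (auto simp: nonzero_eigenvalues_def sorted_list_of_multiset_insert)
  then show "nonzero_eigenvalue 1 A = l1" "nonzero_eigenvalue 2 A = l2"
    using l by (auto simp: nonzero_eigenvalue_def)
qed

text \<open>The eigenvalues of the Hermitian matrix with diagonal \<open>a\<close>, \<open>d\<close>
  and off-diagonal modulus \<open>r\<close>: \<open>s = 1\<close> gives the larger,
  \<open>s = -1\<close> the smaller.\<close>

definition eig_2x2 :: "real \<Rightarrow> real \<Rightarrow> real \<Rightarrow> real \<Rightarrow> real" where
  "eig_2x2 s a d r = (a + d) / 2 + s * sqrt (((a - d) / 2)\<^sup>2 + r\<^sup>2)"

text \<open>Nonnegative diagonal and determinant make both roots nonnegative, so that in decreasing
  order a vanishing root comes last and the default value falls in the right place.\<close>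

lemma nonzero_eigenvalue_hermitian_2x2:
  fixes G :: "complex mat"
  assumes G: "G \<in> carrier_mat 2 2"
    and e: "G $$ (0, 0) = complex_of_real a" "G $$ (1, 1) = complex_of_real d"
      "G $$ (1, 0) = cnj (G $$ (0, 1))"
    and nn: "a \<ge> 0" "d \<ge> 0" "(cmod (G $$ (0, 1)))\<^sup>2 \<le> a * d"
    and cp: "[:0, 1:] ^ k * char_poly A = [:0, 1:] ^ n * char_poly G"
  shows "nonzero_eigenvalue 1 A = eig_2x2 1 a d (cmod (G $$ (0, 1)))"
    "nonzero_eigenvalue 2 A = eig_2x2 (- 1) a d (cmod (G $$ (0, 1)))"
proof -
  let ?b = "G $$ (0, 1)"
  define r where "r = sqrt (((a - d) / 2)\<^sup>2 + (cmod ?b)\<^sup>2)"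
  define l1 where "l1 = (a + d) / 2 + r"
  define l2 where "l2 = (a + d) / 2 - r"
  have rr: "r\<^sup>2 = ((a - d) / 2)\<^sup>2 + (cmod ?b)\<^sup>2" and r0: "r \<ge> 0" by (auto simp: r_def)
  have "r\<^sup>2 \<le> ((a + d) / 2)\<^sup>2" unfolding rr using nn(3) by (simp add: power2_eq_square field_simps)
  then have "r \<le> (a + d) / 2" by (rule power2_le_imp_le) (use nn in simp)
  then have l: "0 \<le> l2" "l2 \<le> l1" using r0 by (auto simp: l1_def l2_def)
  have s: "l1 + l2 = a + d" by (simp add: l1_def l2_def)
  have "l1 * l2 = ((a + d) / 2)\<^sup>2 - r\<^sup>2" by (simp add: l1_def l2_def power2_eq_square algebra_simps)
  also have "\<dots> = a * d - (cmod ?b)\<^sup>2" unfolding rr by (simp add: power2_eq_square field_simps)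
  finally have p: "l1 * l2 = a * d - (cmod ?b)\<^sup>2" .
  have "char_poly G = [:complex_of_real (a * d - (cmod ?b)\<^sup>2), - complex_of_real (a + d), 1:]"
    unfolding char_poly_2x2[OF G] e by (simp add: complex_norm_square del: of_real_power)
  also have "\<dots> = [:- complex_of_real l1, 1:] * [:- complex_of_real l2, 1:]"
    unfolding s[symmetric] p[symmetric] by simp
  finally have "[:0, 1:] ^ k * char_poly A = [:0, 1:] ^ n * ([:- complex_of_real l1, 1:]
      * [:- complex_of_real l2, 1:])"
    using cp by simp
  from nonzero_eigenvalue_of_char_poly[OF this l]
  show "nonzero_eigenvalue 1 A = eig_2x2 1 a d (cmod ?b)"
    "nonzero_eigenvalue 2 A = eig_2x2 (- 1) a d (cmod ?b)"
    by (auto simp: eig_2x2_def l1_def l2_def r_def)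
qed

text \<open>The factor sqrt N gives the entries the fixed law \<open>mu\<close>; the Gram operator
  compensates for it by the coefficient \<gamma> / N.\<close>

definition scaled_col :: "nat \<Rightarrow> complex mat \<Rightarrow> nat \<Rightarrow> nat \<Rightarrow> complex" where
  "scaled_col N H k a = complex_of_real (sqrt (real N)) * H $$ (a, k)"

text \<open>Write Omega = V W with V = S U and W = \<gamma> s U^* S, where U holds the two columns
  of the pair and S is the inverse square root. The product in the other order is G = \<gamma> s U^*
  S^2 U, a 2 x 2 matrix in which only S^2 = A^(-1) occurs, and A is s times the Gram operator. Hence
  the square root disappears and the noise variance cancels.\<close>

lemma Omega_eigenvalues:
  fixes H :: "complex mat"
  assumes H: "H \<in> carrier_mat N K" and N: "N > 0" and s: "s > 0" and \<gamma>: "\<gamma> > 0"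
    and ij: "i < K" "j < K" "i \<noteq> j"
  defines "x \<equiv> scaled_col N H"
  defines "C \<equiv> resolvent N (\<gamma> / real N) x ({..<K} - {i, j})"
  defines "a \<equiv> \<gamma> / real N * Re (ip N (x i) (C (x i)))"
  defines "d \<equiv> \<gamma> / real N * Re (ip N (x j) (C (x j)))"
  defines "r \<equiv> \<gamma> / real N * cmod (ip N (x i) (C (x j)))"
  defines "\<Omega> \<equiv> Omega_mat H (complex_of_real (\<gamma> * s) \<cdot>\<^sub>m 1\<^sub>m K) s {i, j}"
  shows "nonzero_eigenvalue 1 \<Omega> = eig_2x2 1 a d r" "nonzero_eigenvalue 2 \<Omega> = eig_2x2 (- 1) a d r"
proof -
  let ?g = "\<gamma> / real N" and ?J = "{..<K} - {i, j}" and ?Phi = "complex_of_real (\<gamma> * s) \<cdot>\<^sub>m 1\<^sub>m K"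
  have g: "?g \<ge> 0" using \<gamma> N by simp
  have fJ: "finite ?J" by simp
  have dH: "dim_row H = N" using H by simp
  have HH: "complex_of_real \<gamma> * (H $$ (p, k) * cnj (H $$ (q, k))) = complex_of_real ?g * (x k p * cnj (x k q))"
      for p q k
  proof -
    have "complex_of_real (sqrt (real N)) * complex_of_real (sqrt (real N)) = complex_of_real (real N)"
      by (simp only: of_real_mult[symmetric]) simp
    then have "x k p * cnj (x k q) = complex_of_real (real N) * (H $$ (p, k) * cnj (H $$ (q, k)))"
      by (simp add: x_def scaled_col_def mult_ac)
    then show ?thesis using N by simp
  qed
  define A where "A = interference_plus_noise H ?Phi s {i, j}"
  have Aeq: "A = mat N N (\<lambda>(p, q). complex_of_real s * ((if p = q then 1 else 0) + complex_of_real ?g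
      * (\<Sum>k\<in>?J. x k p * cnj (x k q))))"
    (is "_ = ?A")
  proof (rule eq_matI)
    fix p q assume "p < dim_row ?A" "q < dim_col ?A"
    then have pq: "p < N" "q < N" by auto
    have "{k. k < K \<and> k \<in> - {i, j}} = ?J" by auto
    then have "A $$ (p, q) = complex_of_real (\<gamma> * s) * (\<Sum>k\<in>?J. H $$ (p, k) * cnj (H $$ (q, k)))
        + complex_of_real s * (if p = q then 1 else 0)"
      unfolding A_def interference_plus_noise_def submatrix_gram[OF H] using pq dH by simp
    also have "complex_of_real (\<gamma> * s) * (\<Sum>k\<in>?J. H $$ (p, k) * cnj (H $$ (q, k)))
        = complex_of_real s * (\<Sum>k\<in>?J. complex_of_real \<gamma> * (H $$ (p, k) * cnj (H $$ (q, k))))"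
      by (simp add: sum_distrib_left mult_ac)
    finally show "A $$ (p, q) = ?A $$ (p, q)"
      using pq unfolding HH by (simp add: sum_distrib_left algebra_simps)
  qed (auto simp: A_def interference_plus_noise_def submatrix_gram[OF H] dH)
  then have A: "A \<in> carrier_mat N N" by simp
  have Av: "(A *\<^sub>v vec N w) $ p = complex_of_real s * gram_op N ?g x ?J w p" if p: "p < N" for w p
  proof -
    have "(A *\<^sub>v vec N w) $ p = (\<Sum>q<N. complex_of_real s * ((if q = p then w p else 0) + complex_of_real ?g
        * (\<Sum>k\<in>?J. x k p * cnj (x k q) * w q)))"
      using p unfolding Aeq
      by (auto simp: scalar_prod_def lessThan_atLeast0 algebra_simps sum_distrib_left intro!: sum.cong)
    also have "\<dots> = complex_of_real s * (w p + complex_of_real ?g * (\<Sum>q<N. \<Sum>k\<in>?J. x k p * cnj (x k q) * w q))"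
      using p by (simp only: sum_distrib_left[symmetric] sum.distrib) simp
    also have "(\<Sum>q<N. \<Sum>k\<in>?J. x k p * cnj (x k q) * w q) = (\<Sum>k\<in>?J. ip N (x k) w * x k p)"
      unfolding ip_def by (subst sum.swap) (simp add: sum_distrib_left sum_distrib_right mult_ac)
    finally show ?thesis by (simp add: gram_op_def)
  qed
  have vec_eta: "vec N (\<lambda>p. v $ p) = v" if "v \<in> carrier_vec N" for v :: "complex vec"
    using that by (intro eq_vecI) auto
  have "positive_definite A"
    unfolding positive_definite_def
  proof (intro conjI ballI impI)
    show "square_mat A" using A by (simp add: square_mat.simps)
    show "mat_adjoint A = A"
      unfolding Aeq by (rule eq_matI) (auto simp: conjugate_complex_def cnj_sum mult.commute)
    fix v :: "complex vec" assume v: "v \<in> carrier_vec (dim_row A)" "v \<noteq> 0\<^sub>v (dim_row A)"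
    then have vN: "v \<in> carrier_vec N" using A by simp
    let ?w = "\<lambda>p. v $ p"
    have "(A *\<^sub>v v) \<bullet>c v = (\<Sum>p<N. complex_of_real s * gram_op N ?g x ?J ?w p * cnj (?w p))"
      using vN Av[of _ ?w] A by (auto simp: scalar_prod_def lessThan_atLeast0 conjugate_complex_def vec_eta
          intro!: sum.cong)
    also have "\<dots> = complex_of_real s * ip N ?w (gram_op N ?g x ?J ?w)"
      by (simp add: ip_def sum_distrib_left mult_ac)
    finally have "Re ((A *\<^sub>v v) \<bullet>c v) = s * (nrm2 N ?w + ?g * (\<Sum>k\<in>?J. (cmod (ip N (x k) ?w))\<^sup>2))"
      unfolding gram_op_ip by simp
    moreover have "nrm2 N ?w > 0"
    proof -
      from v vN A obtain p where "p < N" "v $ p \<noteq> 0" by (metis carrier_matD(1) carrier_vecD eq_vecI index_zero_vec)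
      then show ?thesis unfolding nrm2_def by (intro sum_pos2[of _ p]) auto
    qed
    moreover have "?g * (\<Sum>k\<in>?J. (cmod (ip N (x k) ?w))\<^sup>2) \<ge> 0" using g by (intro mult_nonneg_nonneg sum_nonneg) auto
    ultimately show "0 < Re ((A *\<^sub>v v) \<bullet>c v)" using s by simp
  qed
  note S = inv_sqrt_mat[OF A this]
  define S where "S = inv_sqrt_mat A"
  have Sc: "S \<in> carrier_mat N N" and Sa: "mat_adjoint S = S" and SSA: "S * S * A = 1\<^sub>m N"
    using S by (simp_all add: S_def)
  define u where "u c = (if c = (0::nat) then i else j)" for c
  define U where "U = mat N 2 (\<lambda>(p, c). H $$ (p, u c))"
  have U: "U \<in> carrier_mat N 2" by (simp add: U_def)
  have Ua: "mat_adjoint U \<in> carrier_mat 2 N" using U by simp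
  have sN: "complex_of_real (sqrt (real N)) \<noteq> 0" using N by simp
  \<comment> \<open>The candidate for s A^(-1) U, given column by column by the resolvent; the
    factor 1 / sqrt N turns the rescaled columns back into columns of \<open>H\<close>.\<close>
  define Y where "Y = mat N 2 (\<lambda>(p, c). C (x (u c)) p / complex_of_real (sqrt (real N)))"
  have Y: "Y \<in> carrier_mat N 2" by (simp add: Y_def)
  have AY: "A * Y = complex_of_real s \<cdot>\<^sub>m U"
  proof (rule eq_matI)
    fix p c assume "p < dim_row (complex_of_real s \<cdot>\<^sub>m U)" "c < dim_col (complex_of_real s \<cdot>\<^sub>m U)"
    then have pc: "p < N" "c < 2" using U by auto
    have colY: "col Y c = vec N (\<lambda>p. inverse (complex_of_real (sqrt (real N))) * C (x (u c)) p)"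
      using pc by (intro eq_vecI) (auto simp: Y_def divide_inverse mult.commute)
    have "(A * Y) $$ (p, c) = (A *\<^sub>v col Y c) $ p" using A Y pc by simp
    also have "\<dots> = complex_of_real s * gram_op N ?g x ?J (\<lambda>p. inverse (complex_of_real (sqrt (real N)))
        * C (x (u c)) p) p"
      unfolding colY by (rule Av[OF pc(1)])
    also have "gram_op N ?g x ?J (\<lambda>p. inverse (complex_of_real (sqrt (real N))) * C (x (u c)) p) p
        = inverse (complex_of_real (sqrt (real N))) * gram_op N ?g x ?J (C (x (u c))) p"
      by (simp add: gram_op_def ip_scale_right ip_scale_right' sum_distrib_left algebra_simps)
    also have "gram_op N ?g x ?J (C (x (u c))) = x (u c)"
      unfolding C_def by (rule gram_op_resolvent[OF g fJ])
    finally show "(A * Y) $$ (p, c) = (complex_of_real s \<cdot>\<^sub>m U) $$ (p, c)"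
      using pc sN by (simp add: U_def x_def scaled_col_def)
  qed (use A Y U in auto)
  have "pair_signal H ?Phi {i, j} = complex_of_real (\<gamma> * s) \<cdot>\<^sub>m (U * mat_adjoint U)"
  proof (rule eq_matI)
    fix p q assume "p < dim_row (complex_of_real (\<gamma> * s) \<cdot>\<^sub>m (U * mat_adjoint U))"
      "q < dim_col (complex_of_real (\<gamma> * s) \<cdot>\<^sub>m (U * mat_adjoint U))"
    then have pq: "p < N" "q < N" using U by auto
    have "{k. k < K \<and> k \<in> {i, j}} = {i, j}" using ij by auto
    moreover have "(U * mat_adjoint U) $$ (p, q) = (\<Sum>l<2. U $$ (p, l) * mat_adjoint U $$ (l, q))"
      by (rule index_mult_mat_sum[OF U Ua pq])
    ultimately show "pair_signal H ?Phi {i, j} $$ (p, q) = (complex_of_real (\<gamma> * s) \<cdot>\<^sub>m (U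
        * mat_adjoint U)) $$ (p, q)"
      unfolding pair_signal_def submatrix_gram[OF H] using pq U ij
      by (simp add: U_def numeral_2_eq_2 lessThan_Suc u_def conjugate_complex_def)
  qed (use U in \<open>auto simp: pair_signal_def submatrix_gram[OF H]\<close>)
  then have \<Omega>: "\<Omega> = S * (complex_of_real (\<gamma> * s) \<cdot>\<^sub>m (U * mat_adjoint U)) * S"
    unfolding \<Omega>_def Omega_mat_def A_def[symmetric] S_def by simp
  define V where "V = S * U"
  define W where "W = complex_of_real (\<gamma> * s) \<cdot>\<^sub>m (mat_adjoint U * S)"
  have V: "V \<in> carrier_mat N 2" and W: "W \<in> carrier_mat 2 N" using Sc U Ua by (auto simp: V_def W_def)
  have UUa: "U * mat_adjoint U \<in> carrier_mat N N" using U Ua by (rule mult_carrier_mat)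
  have UaS: "mat_adjoint U * S \<in> carrier_mat 2 N" using Ua Sc by (rule mult_carrier_mat)
  have VW: "V * W = \<Omega>"
  proof -
    have "V * W = complex_of_real (\<gamma> * s) \<cdot>\<^sub>m (S * U * (mat_adjoint U * S))"
      unfolding W_def by (subst mult_smult_distrib[OF V UaS]) (simp add: V_def)
    also have "S * U * (mat_adjoint U * S) = S * (U * mat_adjoint U) * S"
      using assoc_mult_mat[OF Sc U UaS] assoc_mult_mat[OF U Ua Sc] assoc_mult_mat[OF Sc UUa Sc] by simp
    also have "complex_of_real (\<gamma> * s) \<cdot>\<^sub>m (S * (U * mat_adjoint U) * S)
        = S * (complex_of_real (\<gamma> * s) \<cdot>\<^sub>m (U * mat_adjoint U)) * S"
      using mult_smult_distrib[OF Sc UUa] mult_smult_assoc_mat[OF mult_carrier_mat[OF Sc UUa] Sc] by simp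
    finally show ?thesis unfolding \<Omega> .
  qed
  have SS: "S * S \<in> carrier_mat N N" using Sc by simp
  have SSU: "complex_of_real s \<cdot>\<^sub>m (S * S * U) = Y"
  proof -
    have "complex_of_real s \<cdot>\<^sub>m (S * S * U) = S * S * (A * Y)"
      unfolding AY using mult_smult_distrib[OF SS U] by simp
    also have "\<dots> = Y" using assoc_mult_mat[OF SS A Y] SSA Y by simp
    finally show ?thesis .
  qed
  define G where "G = W * V"
  have G: "G \<in> carrier_mat 2 2" using V W by (simp add: G_def)
  have "G = complex_of_real (\<gamma> * s) \<cdot>\<^sub>m (mat_adjoint U * (S * S * U))"
    unfolding G_def W_def V_def
    using mult_smult_assoc_mat[OF UaS V[unfolded V_def]] assoc_mult_mat[OF Ua Sc V[unfolded V_def]]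
      assoc_mult_mat[OF Sc Sc U] by simp
  moreover have "complex_of_real \<gamma> \<cdot>\<^sub>m (complex_of_real s \<cdot>\<^sub>m X) = complex_of_real (\<gamma> * s) \<cdot>\<^sub>m X"
      for X :: "complex mat"
    by (rule eq_matI) auto
  ultimately have "G = complex_of_real \<gamma> \<cdot>\<^sub>m (mat_adjoint U * (complex_of_real s \<cdot>\<^sub>m (S * S * U)))"
    using mult_smult_distrib[OF Ua mult_carrier_mat[OF SS U]] by simp
  then have GY: "G = complex_of_real \<gamma> \<cdot>\<^sub>m (mat_adjoint U * Y)" unfolding SSU .
  have Ge: "G $$ (c, c') = complex_of_real ?g * ip N (x (u c)) (C (x (u c')))" if c: "c < 2" "c' < 2" for c c'
  proof -
    have sq: "complex_of_real (sqrt (real N)) * complex_of_real (sqrt (real N)) = complex_of_real (real N)"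
      by (simp only: of_real_mult[symmetric]) simp
    have "(mat_adjoint U * Y) $$ (c, c') = (\<Sum>p<N. mat_adjoint U $$ (c, p) * Y $$ (p, c'))"
      by (rule index_mult_mat_sum[OF Ua Y c])
    also have "\<dots> = (\<Sum>p<N. cnj (x (u c) p) * C (x (u c')) p / complex_of_real (real N))"
    proof (intro sum.cong refl)
      fix p assume "p \<in> {..<N}"
      then have "mat_adjoint U $$ (c, p) * Y $$ (p, c')
          = cnj (H $$ (p, u c)) * C (x (u c')) p / complex_of_real (sqrt (real N))"
        using c U by (simp add: U_def Y_def conjugate_complex_def)
      also have "\<dots> = cnj (x (u c) p) * C (x (u c')) p / (complex_of_real (sqrt (real N))
          * complex_of_real (sqrt (real N)))"
        using sN by (simp add: x_def scaled_col_def)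
      finally show "mat_adjoint U $$ (c, p) * Y $$ (p, c') = cnj (x (u c) p) * C (x (u c')) p
          / complex_of_real (real N)"
        unfolding sq .
    qed
    also have "\<dots> = ip N (x (u c)) (C (x (u c'))) / complex_of_real (real N)"
      by (simp add: ip_def sum_divide_distrib)
    finally have e: "(mat_adjoint U * Y) $$ (c, c') = ip N (x (u c)) (C (x (u c'))) / complex_of_real (real N)" .
    have "G $$ (c, c') = complex_of_real \<gamma> * (mat_adjoint U * Y) $$ (c, c')"
      unfolding GY by (rule index_smult_mat(1)) (use c U Y in auto)
    then show ?thesis unfolding e by simp
  qed
  have fr: "ip N v (C v) = complex_of_real (Re (ip N v (C v)))" for v
    unfolding C_def by (rule resolvent_form_real[OF g fJ])
  have G00: "G $$ (0, 0) = complex_of_real a"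
    using Ge[of 0 0] fr[of "x i"] by (simp add: u_def a_def)
  have G11: "G $$ (1, 1) = complex_of_real d"
    using Ge[of 1 1] fr[of "x j"] by (simp add: u_def d_def)
  have G10: "G $$ (1, 0) = cnj (G $$ (0, 1))"
    using Ge[of 1 0] Ge[of 0 1] resolvent_selfadjoint[OF g fJ, of N "x j" x "x i"] by (simp add: u_def C_def)
  have G01: "cmod (G $$ (0, 1)) = r"
    using Ge[of 0 1] \<gamma> N by (simp add: u_def r_def norm_mult norm_divide)
  have fn: "Re (ip N v (C v)) \<ge> 0" for v
    unfolding C_def using nrm2_resolvent_le_form[OF g fJ] nrm2_nonneg order_trans by blast
  have "r\<^sup>2 \<le> a * d"
  proof -
    have "(cmod (ip N (x i) (C (x j))))\<^sup>2 \<le> Re (ip N (x i) (C (x i))) * Re (ip N (x j) (C (x j)))"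
      unfolding C_def by (rule resolvent_form_Cauchy_Schwarz[OF g fJ])
    then have "?g\<^sup>2 * (cmod (ip N (x i) (C (x j))))\<^sup>2 \<le> ?g\<^sup>2 * (Re (ip N (x i) (C (x i)))
        * Re (ip N (x j) (C (x j))))"
      by (rule mult_left_mono) simp
    then show ?thesis by (simp add: r_def a_def d_def power_mult_distrib power2_eq_square mult_ac)
  qed
  moreover have "a \<ge> 0" "d \<ge> 0" unfolding a_def d_def by (rule mult_nonneg_nonneg[OF g fn])+
  moreover have "[:0, 1:] ^ 2 * char_poly \<Omega> = [:0, 1:] ^ N * char_poly G"
    using char_poly_commute[OF V W] unfolding VW G_def .
  ultimately show "nonzero_eigenvalue 1 \<Omega> = eig_2x2 1 a d r" "nonzero_eigenvalue 2 \<Omega> = eig_2x2 (- 1) a d r"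
    using nonzero_eigenvalue_hermitian_2x2[OF G G00 G11 G10, of 2 \<Omega> N] G01 by simp_all
qed

text \<open>sqrt (p^2 + r^2) \<le> |p| + |r|, and both (a + d)/2 - c and (a - d)/2 are bounded by
  half of |a - c| + |d - c|.\<close>

lemma eig_2x2_dist:
  assumes "\<bar>s\<bar> \<le> 1"
  shows "\<bar>eig_2x2 s a d r - c\<bar> \<le> \<bar>a - c\<bar> + \<bar>d - c\<bar> + \<bar>r\<bar>"
proof -
  let ?q = "sqrt (((a - d) / 2)\<^sup>2 + r\<^sup>2)"
  have q: "0 \<le> ?q" "?q \<le> \<bar>(a - d) / 2\<bar> + \<bar>r\<bar>"
    using sqrt_sum_squares_le_sum_abs[of "(a - d) / 2" r] by auto
  have "\<bar>s * ?q\<bar> \<le> 1 * ?q" unfolding abs_mult using assms q by (intro mult_mono) auto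
  then have "\<bar>s * ?q\<bar> \<le> \<bar>(a - d) / 2\<bar> + \<bar>r\<bar>" using q by linarith
  then show ?thesis unfolding eig_2x2_def by (auto simp: abs_if field_simps split: if_splits)
qed

section \<open>Moments and deviations of forms in independent variables\<close>

lemma cmod_add_power2: "(cmod (T + D))\<^sup>2 = (cmod T)\<^sup>2 + 2 * Re (cnj T * D) + (cmod D)\<^sup>2"
  unfolding cmod_power2 by (simp add: power2_eq_square algebra_simps)

text \<open>The term linear in \<open>D\<close> is kept exactly, since it vanishes on averaging over
  a centred \<open>D\<close>. The cubic term is split by 2 t d^3 \<le> t^2 d^2 + d^4, which leads to
  8 = 4 + 2 + 2 and 3 = 2 + 1.\<close>

lemma cmod_add_power4_le:
  "cmod (T + D) ^ 4 \<le> cmod T ^ 4 + 4 * (cmod T)\<^sup>2 * Re (cnj T * D) + 8 * (cmod T)\<^sup>2 * (cmod D)\<^sup>2 + 3 * cmod D ^ 4"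
proof -
  define t d r where "t = cmod T" and "d = cmod D" and "r = Re (cnj T * D)"
  have nn: "t \<ge> 0" "d \<ge> 0" by (auto simp: t_def d_def)
  have r: "\<bar>r\<bar> \<le> t * d" unfolding r_def t_def d_def using abs_Re_le_cmod[of "cnj T * D"] by (simp add: norm_mult)
  have "r\<^sup>2 \<le> (t * d)\<^sup>2" using r by (metis abs_ge_zero power2_abs power_mono)
  then have 1: "4 * r\<^sup>2 \<le> 4 * (t\<^sup>2 * d\<^sup>2)" by (simp add: power_mult_distrib)
  have "r * d\<^sup>2 \<le> t * d * d\<^sup>2" using r by (intro mult_right_mono) auto
  moreover have "2 * (t * d * d\<^sup>2) \<le> t\<^sup>2 * d\<^sup>2 + d\<^sup>2 * d\<^sup>2"
  proof -
    have "0 \<le> (t * d - d\<^sup>2)\<^sup>2" by simp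
    then show ?thesis by (simp add: power2_eq_square algebra_simps)
  qed
  ultimately have 2: "4 * (r * d\<^sup>2) \<le> 2 * (t\<^sup>2 * d\<^sup>2) + 2 * d ^ 4"
    by (simp add: power4_eq_xxxx power2_eq_square mult.assoc)
  have "cmod (T + D) ^ 4 = ((cmod (T + D))\<^sup>2)\<^sup>2" by simp
  also have "\<dots> = (t\<^sup>2 + 2 * r + d\<^sup>2)\<^sup>2" unfolding cmod_add_power2 t_def d_def r_def ..
  also have "\<dots> = t ^ 4 + 4 * t\<^sup>2 * r + 4 * r\<^sup>2 + 2 * (t\<^sup>2 * d\<^sup>2) + 4 * (r * d\<^sup>2) + d ^ 4"
    by (simp add: power2_eq_square power4_eq_xxxx algebra_simps)
  also have "\<dots> \<le> t ^ 4 + 4 * t\<^sup>2 * r + 8 * t\<^sup>2 * d\<^sup>2 + 3 * d ^ 4" using 1 2 by linarith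
  finally show ?thesis by (simp add: t_def d_def r_def)
qed

text \<open>exp z \<le> 1 + z exp z holds for every real z. Inserting it into itself, or exp z \<ge>
  1 + z when z is negative, leaves a remainder quadratic in z.\<close>

lemma exp_le_quadratic:
  fixes z :: real
  assumes "\<bar>z\<bar> \<le> c"
  shows "exp z \<le> 1 + z + z\<^sup>2 * exp c"
proof -
  have A: "exp z \<le> 1 + z * exp z"
  proof -
    have "exp z * (1 - z) \<le> exp z * exp (- z)"
      using exp_ge_add_one_self[of "- z"] by (intro mult_left_mono) auto
    then show ?thesis by (simp add: exp_minus algebra_simps)
  qed
  show ?thesis
  proof (cases "z \<ge> 0")
    case True
    then have "z * exp z \<le> z * (1 + z * exp z)" using A by (intro mult_left_mono) auto
    moreover have "z * (z * exp z) \<le> z * (z * exp c)" using True assms by (intro mult_left_mono) auto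
    ultimately show ?thesis using A by (simp add: power2_eq_square algebra_simps)
  next
    case False
    then have "z * exp z \<le> z * (1 + z)"
      using exp_ge_add_one_self[of z] by (intro mult_left_mono_neg) auto
    moreover have "z\<^sup>2 * 1 \<le> z\<^sup>2 * exp c" using assms by (intro mult_left_mono) auto
    ultimately show ?thesis using A by (simp add: power2_eq_square algebra_simps)
  qed
qed

section \<open>Moments of sums of independent variables\<close>

context prob_space
begin

lemma complex_square_integrable_imp_integrable:
  fixes D :: "'a \<Rightarrow> complex"
  assumes [measurable]: "D \<in> borel_measurable M" and "integrable M (\<lambda>y. (cmod (D y))\<^sup>2)"
  shows "integrable M D"
  using square_integrable_imp_integrable[of "\<lambda>y. cmod (D y)"] assms by (simp add: integrable_norm_iff)

text \<open>\<open>T\<close> stands for the part built from earlier variables, a constant for the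
  integral over the new one. With nonnegative integrals the recursion over the variables carries no
  integrability conditions on partial sums.\<close>

lemma nn_integral_shift_power2_le:
  fixes D :: "'a \<Rightarrow> complex"
  assumes D[measurable]: "D \<in> borel_measurable M"
    and i2: "integrable M (\<lambda>y. (cmod (D y))\<^sup>2)" and mean: "(\<integral>y. D y \<partial>M) = 0"
    and s: "(\<integral>y. (cmod (D y))\<^sup>2 \<partial>M) \<le> s"
  shows "(\<integral>\<^sup>+y. ennreal ((cmod (T + D y))\<^sup>2) \<partial>M) \<le> ennreal ((cmod T)\<^sup>2 + s)"
proof -
  have i1: "integrable M D" by (rule complex_square_integrable_imp_integrable[OF D i2])
  have iR: "integrable M (\<lambda>y. 2 * Re (cnj T * D y))" using i1 by simp
  have "(\<integral>\<^sup>+y. ennreal ((cmod (T + D y))\<^sup>2) \<partial>M) = ennreal (\<integral>y. (cmod T)\<^sup>2 + 2 * Re (cnj T * D y) + (cmod (D y))\<^sup>2 \<partial>M)"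
    unfolding cmod_add_power2[symmetric]
  proof (rule nn_integral_eq_integral)
    show "integrable M (\<lambda>y. (cmod (T + D y))\<^sup>2)"
      unfolding cmod_add_power2 using i2 iR by (intro Bochner_Integration.integrable_add) auto
  qed simp
  also have "(\<integral>y. (cmod T)\<^sup>2 + 2 * Re (cnj T * D y) + (cmod (D y))\<^sup>2 \<partial>M)
      = (cmod T)\<^sup>2 + 2 * Re (cnj T * (\<integral>y. D y \<partial>M)) + (\<integral>y. (cmod (D y))\<^sup>2 \<partial>M)"
  proof -
    have "(\<integral>y. 2 * Re (cnj T * D y) \<partial>M) = 2 * Re (\<integral>y. cnj T * D y \<partial>M)"
      using i1 by (simp add: integral_Re)
    then show ?thesis using i2 iR by (simp add: prob_space)
  qed
  finally show ?thesis using s mean by (simp add: ennreal_leI del: ennreal_plus)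
qed

lemma nn_integral_shift_power4_le:
  fixes D :: "'a \<Rightarrow> complex"
  assumes D[measurable]: "D \<in> borel_measurable M"
    and i2: "integrable M (\<lambda>y. (cmod (D y))\<^sup>2)" and mean: "(\<integral>y. D y \<partial>M) = 0"
    and i4: "integrable M (\<lambda>y. cmod (D y) ^ 4)"
    and s: "(\<integral>y. (cmod (D y))\<^sup>2 \<partial>M) \<le> s" and q: "(\<integral>y. cmod (D y) ^ 4 \<partial>M) \<le> q"
  shows "(\<integral>\<^sup>+y. ennreal (cmod (T + D y) ^ 4) \<partial>M) \<le> ennreal (cmod T ^ 4 + 8 * (cmod T)\<^sup>2 * s + 3 * q)"
proof -
  have i1: "integrable M D" by (rule complex_square_integrable_imp_integrable[OF D i2])
  let ?f = "\<lambda>y. cmod T ^ 4 + 4 * (cmod T)\<^sup>2 * Re (cnj T * D y) + 8 * (cmod T)\<^sup>2 * (cmod (D y))\<^sup>2 + 3 * cmod (D y) ^ 4"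
  have iR: "integrable M (\<lambda>y. Re (cnj T * D y))" using i1 by simp
  have nn: "?f y \<ge> 0" for y by (rule order_trans[OF _ cmod_add_power4_le]) simp
  have "(\<integral>\<^sup>+y. ennreal (cmod (T + D y) ^ 4) \<partial>M) \<le> (\<integral>\<^sup>+y. ennreal (?f y) \<partial>M)"
    by (intro nn_integral_mono ennreal_leI cmod_add_power4_le)
  also have "\<dots> = ennreal (\<integral>y. ?f y \<partial>M)"
    using i2 i4 iR nn by (intro nn_integral_eq_integral) auto
  also have "(\<integral>y. ?f y \<partial>M) = cmod T ^ 4 + 4 * (cmod T)\<^sup>2 * Re (cnj T * (\<integral>y. D y \<partial>M))
      + 8 * (cmod T)\<^sup>2 * (\<integral>y. (cmod (D y))\<^sup>2 \<partial>M) + 3 * (\<integral>y. cmod (D y) ^ 4 \<partial>M)"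
  proof -
    have "(\<integral>y. Re (cnj T * D y) \<partial>M) = Re (\<integral>y. cnj T * D y \<partial>M)"
      using i1 by (simp add: integral_Re)
    then show ?thesis using i2 i4 iR by (simp add: prob_space)
  qed
  also have "\<dots> \<le> cmod T ^ 4 + 8 * (cmod T)\<^sup>2 * s + 3 * q"
    unfolding mean using s q by (auto intro!: add_mono mult_left_mono)
  finally show ?thesis by (simp add: ennreal_leI)
qed

lemma product_prob_space_const: "product_prob_space (\<lambda>_. M)"
  by (intro product_prob_spaceI) (rule prob_space_axioms)

lemma PiM_const_insert:
  fixes A :: "'i set"
  assumes "finite A" "k \<notin> A" and f: "f \<in> borel_measurable (PiM (insert k A) (\<lambda>_. M))"
  shows "(\<integral>\<^sup>+x. f x \<partial>PiM (insert k A) (\<lambda>_. M))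
    = (\<integral>\<^sup>+x. (\<integral>\<^sup>+y. f (x(k := y)) \<partial>M) \<partial>PiM A (\<lambda>_. M))"
proof -
  interpret P: product_prob_space "\<lambda>_::'i. M" by (rule product_prob_space_const)
  show ?thesis by (rule P.product_nn_integral_insert[OF assms])
qed

lemma prob_space_PiM_const: "prob_space (PiM A (\<lambda>_. M))"
  by (rule prob_space_PiM) (rule prob_space_axioms)

lemma nn_integral_sum_power2_le:
  fixes A :: "'i set" and f :: "'i \<Rightarrow> 'a \<Rightarrow> complex"
  assumes A: "finite A"
    and f[measurable]: "\<And>b. b \<in> A \<Longrightarrow> f b \<in> borel_measurable M"
    and i2: "\<And>b. b \<in> A \<Longrightarrow> integrable M (\<lambda>y. (cmod (f b y))\<^sup>2)"
    and mean: "\<And>b. b \<in> A \<Longrightarrow> (\<integral>y. f b y \<partial>M) = 0"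
    and s: "\<And>b. b \<in> A \<Longrightarrow> (\<integral>y. (cmod (f b y))\<^sup>2 \<partial>M) \<le> s b"
  shows "(\<integral>\<^sup>+x. ennreal ((cmod (\<Sum>b\<in>A. f b (x b)))\<^sup>2) \<partial>PiM A (\<lambda>_. M)) \<le> ennreal (\<Sum>b\<in>A. s b)"
  using assms
proof (induction A)
  case empty
  then show ?case by simp
next
  case (insert k A)
  interpret P: prob_space "PiM A (\<lambda>_. M)" by (rule prob_space_PiM_const)
  note [measurable] = insert.prems(1)
  have s0: "s b \<ge> 0" if "b \<in> insert k A" for b
    by (rule order_trans[OF _ insert.prems(4)[OF that]]) simp
  have "(\<integral>\<^sup>+x. ennreal ((cmod (\<Sum>b\<in>insert k A. f b (x b)))\<^sup>2) \<partial>PiM (insert k A) (\<lambda>_. M))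
      = (\<integral>\<^sup>+x. (\<integral>\<^sup>+y. ennreal ((cmod (\<Sum>b\<in>insert k A. f b ((x(k := y)) b)))\<^sup>2) \<partial>M) \<partial>PiM A (\<lambda>_. M))"
    by (rule PiM_const_insert[OF insert.hyps]) measurable
  also have "\<dots> = (\<integral>\<^sup>+x. (\<integral>\<^sup>+y. ennreal ((cmod ((\<Sum>b\<in>A. f b (x b)) + f k y))\<^sup>2) \<partial>M) \<partial>PiM A (\<lambda>_. M))"
  proof -
    have "(\<Sum>b\<in>insert k A. f b ((x(k := y)) b)) = (\<Sum>b\<in>A. f b (x b)) + f k y" for x y
    proof -
      have "(\<Sum>b\<in>A. f b ((x(k := y)) b)) = (\<Sum>b\<in>A. f b (x b))"
        using insert.hyps by (intro sum.cong) auto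
      then show ?thesis using insert.hyps by (simp add: add.commute)
    qed
    then show ?thesis by simp
  qed
  also have "\<dots> \<le> (\<integral>\<^sup>+x. ennreal ((cmod (\<Sum>b\<in>A. f b (x b)))\<^sup>2 + s k) \<partial>PiM A (\<lambda>_. M))"
    by (intro nn_integral_mono nn_integral_shift_power2_le) (use insert.prems in auto)
  also have "\<dots> = (\<integral>\<^sup>+x. ennreal ((cmod (\<Sum>b\<in>A. f b (x b)))\<^sup>2) + ennreal (s k) \<partial>PiM A (\<lambda>_. M))"
    using s0 by (intro nn_integral_cong) simp
  also have "\<dots> = (\<integral>\<^sup>+x. ennreal ((cmod (\<Sum>b\<in>A. f b (x b)))\<^sup>2) \<partial>PiM A (\<lambda>_. M)) + ennreal (s k)"
    by (subst nn_integral_add) (auto simp: P.emeasure_space_1)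
  also have "\<dots> \<le> ennreal (\<Sum>b\<in>A. s b) + ennreal (s k)"
    using insert by (intro add_right_mono insert.IH) auto
  also have "\<dots> = ennreal (\<Sum>b\<in>insert k A. s b)"
    using s0 insert.hyps by (subst ennreal_plus[symmetric]) (auto intro!: sum_nonneg simp: add.commute)
  finally show ?case .
qed

text \<open>A Rosenthal-type bound, one variable at a time. The constant 4 \<kappa> closes the
  induction: the mixed term 8 s_k S is at most the cross term 8 \<kappa> s_k S of 4 \<kappa> (S +
  s_k)^2, and 3 \<kappa> s_k^2 fits below 4 \<kappa> s_k^2.\<close>

lemma nn_integral_sum_power4_le:
  fixes A :: "'i set" and f :: "'i \<Rightarrow> 'a \<Rightarrow> complex"
  assumes A: "finite A"
    and f[measurable]: "\<And>b. b \<in> A \<Longrightarrow> f b \<in> borel_measurable M"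
    and i2: "\<And>b. b \<in> A \<Longrightarrow> integrable M (\<lambda>y. (cmod (f b y))\<^sup>2)"
    and mean: "\<And>b. b \<in> A \<Longrightarrow> (\<integral>y. f b y \<partial>M) = 0"
    and s: "\<And>b. b \<in> A \<Longrightarrow> (\<integral>y. (cmod (f b y))\<^sup>2 \<partial>M) \<le> s b"
    and i4: "\<And>b. b \<in> A \<Longrightarrow> integrable M (\<lambda>y. cmod (f b y) ^ 4)"
    and q: "\<And>b. b \<in> A \<Longrightarrow> (\<integral>y. cmod (f b y) ^ 4 \<partial>M) \<le> \<kappa> * (s b)\<^sup>2"
    and \<kappa>: "\<kappa> \<ge> 1"
  shows "(\<integral>\<^sup>+x. ennreal (cmod (\<Sum>b\<in>A. f b (x b)) ^ 4) \<partial>PiM A (\<lambda>_. M)) \<le> ennreal (4 * \<kappa> * (\<Sum>b\<in>A. s b)\<^sup>2)"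
  using A f i2 mean s i4 q
proof (induction A)
  case empty
  then show ?case by simp
next
  case (insert k A)
  interpret P: prob_space "PiM A (\<lambda>_. M)" by (rule prob_space_PiM_const)
  note [measurable] = insert.prems(1)
  have s0: "s b \<ge> 0" if "b \<in> insert k A" for b
    by (rule order_trans[OF _ insert.prems(4)[OF that]]) simp
  let ?L = "\<lambda>x. \<Sum>b\<in>A. f b (x b)" and ?S = "\<Sum>b\<in>A. s b"
  have S0: "?S \<ge> 0" using s0 by (intro sum_nonneg) auto
  have "(\<integral>\<^sup>+x. ennreal (cmod (\<Sum>b\<in>insert k A. f b (x b)) ^ 4) \<partial>PiM (insert k A) (\<lambda>_. M))
      = (\<integral>\<^sup>+x. (\<integral>\<^sup>+y. ennreal (cmod (\<Sum>b\<in>insert k A. f b ((x(k := y)) b)) ^ 4) \<partial>M) \<partial>PiM A (\<lambda>_. M))"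
    by (rule PiM_const_insert[OF insert.hyps]) measurable
  also have "\<dots> = (\<integral>\<^sup>+x. (\<integral>\<^sup>+y. ennreal (cmod (?L x + f k y) ^ 4) \<partial>M) \<partial>PiM A (\<lambda>_. M))"
  proof -
    have "(\<Sum>b\<in>insert k A. f b ((x(k := y)) b)) = ?L x + f k y" for x y
    proof -
      have "(\<Sum>b\<in>A. f b ((x(k := y)) b)) = ?L x"
        using insert.hyps by (intro sum.cong) auto
      then show ?thesis using insert.hyps by (simp add: add.commute)
    qed
    then show ?thesis by simp
  qed
  also have "\<dots> \<le> (\<integral>\<^sup>+x. ennreal (cmod (?L x) ^ 4 + 8 * (cmod (?L x))\<^sup>2 * s k + 3 * (\<kappa> * (s k)\<^sup>2)) \<partial>PiM A (\<lambda>_. M))"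
    by (intro nn_integral_mono nn_integral_shift_power4_le) (use insert.prems in auto)
  also have "\<dots> = (\<integral>\<^sup>+x. ennreal (cmod (?L x) ^ 4) + ennreal (8 * s k) * ennreal ((cmod (?L x))\<^sup>2)
      + ennreal (3 * (\<kappa> * (s k)\<^sup>2)) \<partial>PiM A (\<lambda>_. M))"
    using s0[of k] \<kappa> by (intro nn_integral_cong) (simp add: ennreal_mult[symmetric] mult_ac flip: ennreal_plus)
  also have "\<dots> = (\<integral>\<^sup>+x. ennreal (cmod (?L x) ^ 4) \<partial>PiM A (\<lambda>_. M))
      + ennreal (8 * s k) * (\<integral>\<^sup>+x. ennreal ((cmod (?L x))\<^sup>2) \<partial>PiM A (\<lambda>_. M)) + ennreal (3 * (\<kappa> * (s k)\<^sup>2))"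
    by (simp add: nn_integral_add nn_integral_cmult P.emeasure_space_1)
  also have "\<dots> \<le> ennreal (4 * \<kappa> * ?S\<^sup>2) + ennreal (8 * s k) * ennreal ?S + ennreal (3 * (\<kappa> * (s k)\<^sup>2))"
    using insert by (intro add_mono mult_left_mono insert.IH nn_integral_sum_power2_le) auto
  also have "\<dots> = ennreal (4 * \<kappa> * ?S\<^sup>2 + 8 * s k * ?S + 3 * (\<kappa> * (s k)\<^sup>2))"
    using s0[of k] S0 \<kappa> by (simp add: ennreal_mult[symmetric] flip: ennreal_plus)
  also have "\<dots> \<le> ennreal (4 * \<kappa> * (\<Sum>b\<in>insert k A. s b)\<^sup>2)"
  proof (rule ennreal_leI)
    have "1 * (s k * ?S) \<le> \<kappa> * (s k * ?S)" using \<kappa> s0[of k] S0 by (intro mult_right_mono) auto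
    moreover have "0 \<le> \<kappa> * (s k)\<^sup>2" using \<kappa> by simp
    ultimately show "4 * \<kappa> * ?S\<^sup>2 + 8 * s k * ?S + 3 * (\<kappa> * (s k)\<^sup>2) \<le> 4 * \<kappa> * (\<Sum>b\<in>insert k A. s b)\<^sup>2"
      using insert.hyps by (simp add: power2_eq_square algebra_simps)
  qed
  finally show ?case .
qed

text \<open>A Bennett-type inequality that only uses variances: bounding \<open>exp z\<close> by a quadratic
  on \<open>\<bar>z\<bar> \<le> c\<close> which is nonnegative everywhere makes any centring of truncated
  variables superfluous.\<close>

lemma bounded_deviation:
  fixes A :: "'i set" and f :: "'i \<Rightarrow> 'a \<Rightarrow> real"
  assumes A: "finite A" and f[measurable]: "\<And>a. a \<in> A \<Longrightarrow> f a \<in> borel_measurable M"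
    and i2: "\<And>a. a \<in> A \<Longrightarrow> integrable M (\<lambda>y. (f a y)\<^sup>2)"
    and mean: "\<And>a. a \<in> A \<Longrightarrow> (\<integral>y. f a y \<partial>M) = 0"
    and v: "(\<Sum>a\<in>A. \<integral>y. (f a y)\<^sup>2 \<partial>M) \<le> v"
    and t: "t \<ge> 0" and b: "b \<ge> 0"
  shows "emeasure (PiM A (\<lambda>_. M))
      {x \<in> space (PiM A (\<lambda>_. M)). (\<Sum>a\<in>A. f a (x a)) > \<epsilon> \<and> (\<forall>a\<in>A. \<bar>f a (x a)\<bar> \<le> b)}
    \<le> ennreal (exp (- t * \<epsilon> + t\<^sup>2 * exp (t * b) * v))"
proof -
  interpret P: product_prob_space "\<lambda>_::'i. M" by (rule product_prob_space_const)
  let ?P = "PiM A (\<lambda>_. M)"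
  let ?E = "{x \<in> space ?P. (\<Sum>a\<in>A. f a (x a)) > \<epsilon> \<and> (\<forall>a\<in>A. \<bar>f a (x a)\<bar> \<le> b)}"
  define h where "h z = 1 + t * z + t\<^sup>2 * exp (t * b) * z\<^sup>2" for z :: real
  \<comment> \<open>1 + u + u^2 = (1 + 2 u)^2 / 4 + 3/4, and the factor exp (t b) \<ge> 1 only
    increases the last term. Off the event the product of the \<open>h\<close> then still dominates
    the indicator.\<close>
  have h0: "h z \<ge> 0" for z
  proof -
    have "1 \<le> exp (t * b)" using t b by simp
    then have "(t * z)\<^sup>2 * 1 \<le> (t * z)\<^sup>2 * exp (t * b)" by (intro mult_left_mono) auto
    moreover have "0 \<le> (1 + 2 * (t * z))\<^sup>2" by simp
    moreover have "(1 + 2 * (t * z))\<^sup>2 = 1 + 4 * (t * z) + 4 * (t * z)\<^sup>2"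
      by (simp add: power2_eq_square algebra_simps)
    moreover have "h z = 1 + t * z + (t * z)\<^sup>2 * exp (t * b)"
      by (simp add: h_def power_mult_distrib mult_ac)
    ultimately show ?thesis using zero_le_power2[of "t * z"] by linarith
  qed
  have E[measurable]: "?E \<in> sets ?P" using A by measurable
  have le: "indicator ?E x \<le> ennreal (exp (- t * \<epsilon>)) * (\<Prod>a\<in>A. ennreal (h (f a (x a))))" for x
  proof (cases "x \<in> ?E")
    case True
    have "1 \<le> exp (- t * \<epsilon>) * exp (t * (\<Sum>a\<in>A. f a (x a)))"
      using True t by (auto simp flip: exp_add simp: mult_left_mono)
    also have "exp (t * (\<Sum>a\<in>A. f a (x a))) = (\<Prod>a\<in>A. exp (t * f a (x a)))"
      using A by (simp add: sum_distrib_left exp_sum)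
    also have "\<dots> \<le> (\<Prod>a\<in>A. h (f a (x a)))"
    proof (intro prod_mono conjI)
      fix a assume "a \<in> A"
      then have "\<bar>t * f a (x a)\<bar> \<le> t * b" using True t by (auto simp: abs_mult intro!: mult_left_mono)
      from exp_le_quadratic[OF this] show "exp (t * f a (x a)) \<le> h (f a (x a))"
        by (simp add: h_def power_mult_distrib mult_ac)
    qed simp
    finally have "1 \<le> exp (- t * \<epsilon>) * (\<Prod>a\<in>A. h (f a (x a)))" by simp
    then have "ennreal 1 \<le> ennreal (exp (- t * \<epsilon>) * (\<Prod>a\<in>A. h (f a (x a))))" by (rule ennreal_leI)
    then show ?thesis using True h0 by (simp add: ennreal_mult prod_ennreal prod_nonneg)
  qed simp
  have "emeasure ?P ?E = (\<integral>\<^sup>+x. indicator ?E x \<partial>?P)" by simp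
  also have "\<dots> \<le> (\<integral>\<^sup>+x. ennreal (exp (- t * \<epsilon>)) * (\<Prod>a\<in>A. ennreal (h (f a (x a)))) \<partial>?P)"
    by (intro nn_integral_mono le)
  also have "\<dots> = ennreal (exp (- t * \<epsilon>)) * (\<integral>\<^sup>+x. (\<Prod>a\<in>A. ennreal (h (f a (x a)))) \<partial>?P)"
    unfolding h_def by (rule nn_integral_cmult) (use A in measurable)
  also have "(\<integral>\<^sup>+x. (\<Prod>a\<in>A. ennreal (h (f a (x a)))) \<partial>?P) = (\<Prod>a\<in>A. \<integral>\<^sup>+y. ennreal (h (f a y)) \<partial>M)"
    unfolding h_def by (rule P.product_nn_integral_prod[OF A]) measurable
  also have "\<dots> \<le> (\<Prod>a\<in>A. ennreal (exp (t\<^sup>2 * exp (t * b) * (\<integral>y. (f a y)\<^sup>2 \<partial>M))))"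
  proof (intro prod_mono_ennreal)
    fix a assume a: "a \<in> A"
    have i1: "integrable M (f a)" by (rule square_integrable_imp_integrable[OF f[OF a]]) (use i2[OF a] in simp)
    have "(\<integral>\<^sup>+y. ennreal (h (f a y)) \<partial>M) = ennreal (\<integral>y. h (f a y) \<partial>M)"
      using i1 i2[OF a] h0 by (intro nn_integral_eq_integral) (auto simp: h_def)
    also have "(\<integral>y. h (f a y) \<partial>M) = 1 + t\<^sup>2 * exp (t * b) * (\<integral>y. (f a y)\<^sup>2 \<partial>M)"
      using i1 i2[OF a] mean[OF a] by (simp add: h_def prob_space)
    also have "\<dots> \<le> exp (t\<^sup>2 * exp (t * b) * (\<integral>y. (f a y)\<^sup>2 \<partial>M))"
      by (rule exp_ge_add_one_self)
    finally show "(\<integral>\<^sup>+y. ennreal (h (f a y)) \<partial>M) \<le> ennreal (exp (t\<^sup>2 * exp (t * b) * (\<integral>y. (f a y)\<^sup>2 \<partial>M)))"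
      by (simp add: ennreal_leI)
  qed
  also have "\<dots> = ennreal (exp (t\<^sup>2 * exp (t * b) * (\<Sum>a\<in>A. \<integral>y. (f a y)\<^sup>2 \<partial>M)))"
    using A by (simp add: prod_ennreal exp_sum sum_distrib_left)
  also have "\<dots> \<le> ennreal (exp (t\<^sup>2 * exp (t * b) * v))"
    using v by (intro ennreal_leI) (auto intro!: mult_left_mono)
  finally have "emeasure ?P ?E \<le> ennreal (exp (- t * \<epsilon>)) * ennreal (exp (t\<^sup>2 * exp (t * b) * v))"
    by (simp add: mult_left_mono)
  then show ?thesis unfolding exp_add by (simp add: ennreal_mult)
qed

end

section \<open>Off-diagonal parts of quadratic forms\<close>

lemma borel_measurable_cnj [measurable]: "cnj \<in> borel_measurable borel"
  by (intro borel_measurable_continuous_onI continuous_intros)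

definition offdiag :: "('i \<Rightarrow> 'i \<Rightarrow> complex) \<Rightarrow> 'i set \<Rightarrow> ('i \<Rightarrow> complex) \<Rightarrow> complex" where
  "offdiag C A x = (\<Sum>a\<in>A. \<Sum>b\<in>A - {a}. cnj (x a) * C a b * x b)"

text \<open>The martingale structure of the off-diagonal form: the new variable enters only
  linearly, through itself and its conjugate, with coefficients built from the old
  variables.\<close>

lemma offdiag_insert:
  assumes A: "finite A" "k \<notin> A"
  shows "offdiag C (insert k A) x
    = offdiag C A x + (cnj (x k) * (\<Sum>b\<in>A. C k b * x b) + x k * (\<Sum>a\<in>A. cnj (x a) * C a k))"
proof -
  have "(\<Sum>b\<in>insert k A - {a}. cnj (x a) * C a b * x b)
      = (\<Sum>b\<in>A - {a}. cnj (x a) * C a b * x b) + cnj (x a) * C a k * x k" if "a \<in> A" for a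
  proof -
    have "insert k A - {a} = insert k (A - {a})" using that A by auto
    then show ?thesis using A by (simp add: add.commute)
  qed
  moreover have "insert k A - {k} = A" using A by auto
  ultimately show ?thesis
    using A by (simp add: offdiag_def sum.distrib sum_distrib_left algebra_simps)
qed

text \<open>Of a Hermitian contraction only the bound on the norm of each row is retained. It passes
  to principal submatrices, over which the moment bounds run by induction, and it holds for the
  resolvent.\<close>

definition hermitian_contraction_on :: "'i set \<Rightarrow> ('i \<Rightarrow> 'i \<Rightarrow> complex) \<Rightarrow> bool" where
  "hermitian_contraction_on A C \<longleftrightarrow>
     (\<forall>a\<in>A. \<forall>b\<in>A. C a b = cnj (C b a)) \<and> (\<forall>a\<in>A. (\<Sum>b\<in>A. (cmod (C a b))\<^sup>2) \<le> 1)"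

lemma hermitian_contraction_on_subset:
  assumes "hermitian_contraction_on B C" "A \<subseteq> B" "finite B"
  shows "hermitian_contraction_on A C"
proof -
  have "(\<Sum>b\<in>A. (cmod (C a b))\<^sup>2) \<le> (\<Sum>b\<in>B. (cmod (C a b))\<^sup>2)" for a
    using assms by (intro sum_mono2) auto
  then show ?thesis using assms unfolding hermitian_contraction_on_def by (meson order_trans subsetD)
qed

text \<open>The law of one rescaled entry; all estimates take place on product measures of
  it.\<close>

locale unit_law = prob_space mu for mu :: "complex measure" +
  assumes sets_mu [measurable_cong]: "sets mu = sets borel"
    and mean: "(\<integral>z. z \<partial>mu) = 0"
    and square_integrable: "integrable mu (\<lambda>z. (cmod z)\<^sup>2)"
    and variance: "(\<integral>z. (cmod z)\<^sup>2 \<partial>mu) = 1"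
begin

lemma space_mu [simp]: "space mu = UNIV"
  using sets_eq_imp_space_eq[OF sets_mu] by simp

lemma integrable_id: "integrable mu (\<lambda>z. z)"
  by (rule complex_square_integrable_imp_integrable) (use square_integrable in auto)

lemma scaled_moments:
  shows "integrable mu (\<lambda>y. (cmod (v * y))\<^sup>2)" "(\<integral>y. v * y \<partial>mu) = 0"
    "(\<integral>y. (cmod (v * y))\<^sup>2 \<partial>mu) = (cmod v)\<^sup>2"
  using square_integrable integrable_id mean variance by (auto simp: norm_mult power_mult_distrib)

text \<open>\<open>D u\<close> is the increment of the off-diagonal form when a new variable y
  arrives. From |D u y| \<le> 2 |u| |y| come the constants 4 = 2^2 and 16 = 2^4.\<close>

lemma two_sided_moments:
  defines "D \<equiv> \<lambda>u y. cnj y * u + y * cnj u"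
  shows "D u \<in> borel_measurable mu" "integrable mu (\<lambda>y. (cmod (D u y))\<^sup>2)" "(\<integral>y. D u y \<partial>mu) = 0"
    "(\<integral>y. (cmod (D u y))\<^sup>2 \<partial>mu) \<le> 4 * (cmod u)\<^sup>2"
    "integrable mu (\<lambda>y. cmod y ^ 4) \<Longrightarrow> integrable mu (\<lambda>y. cmod (D u y) ^ 4)"
    "integrable mu (\<lambda>y. cmod y ^ 4) \<Longrightarrow> (\<integral>y. cmod (D u y) ^ 4 \<partial>mu) \<le> 16 * (\<integral>y. cmod y ^ 4 \<partial>mu) * cmod u ^ 4"
proof -
  show m[measurable]: "D u \<in> borel_measurable mu" unfolding D_def by measurable
  have b: "cmod (D u y) \<le> 2 * cmod u * cmod y" for y
    unfolding D_def by (rule order_trans[OF norm_triangle_ineq]) (simp add: norm_mult)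
  have b2: "(cmod (D u y))\<^sup>2 \<le> 4 * (cmod u)\<^sup>2 * (cmod y)\<^sup>2" for y
    using power_mono[OF b, of y 2] by (simp add: power_mult_distrib)
  have b4: "cmod (D u y) ^ 4 \<le> 16 * cmod u ^ 4 * cmod y ^ 4" for y
    using power_mono[OF b, of y 4] by (simp add: power_mult_distrib)
  show i2: "integrable mu (\<lambda>y. (cmod (D u y))\<^sup>2)"
    by (rule Bochner_Integration.integrable_bound[of mu "\<lambda>y. 4 * (cmod u)\<^sup>2 * (cmod y)\<^sup>2"])
       (use square_integrable b2 in auto)
  have "(\<integral>y. (cmod (D u y))\<^sup>2 \<partial>mu) \<le> (\<integral>y. 4 * (cmod u)\<^sup>2 * (cmod y)\<^sup>2 \<partial>mu)"
    using i2 square_integrable b2 by (intro integral_mono) auto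
  then show "(\<integral>y. (cmod (D u y))\<^sup>2 \<partial>mu) \<le> 4 * (cmod u)\<^sup>2" using variance by simp
  show "(\<integral>y. D u y \<partial>mu) = 0" unfolding D_def using integrable_id mean by simp
  assume i: "integrable mu (\<lambda>y. cmod y ^ 4)"
  show i4: "integrable mu (\<lambda>y. cmod (D u y) ^ 4)"
    by (rule Bochner_Integration.integrable_bound[of mu "\<lambda>y. 16 * cmod u ^ 4 * cmod y ^ 4"])
       (use i b4 in auto)
  have "(\<integral>y. cmod (D u y) ^ 4 \<partial>mu) \<le> (\<integral>y. 16 * cmod u ^ 4 * cmod y ^ 4 \<partial>mu)"
    using i4 i b4 by (intro integral_mono) auto
  then show "(\<integral>y. cmod (D u y) ^ 4 \<partial>mu) \<le> 16 * (\<integral>y. cmod y ^ 4 \<partial>mu) * cmod u ^ 4" by (simp add: mult_ac)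
qed

lemma offdiag_measurable [measurable]:
  "(\<lambda>x. offdiag C A x) \<in> borel_measurable (PiM A (\<lambda>_. mu))"
  unfolding offdiag_def by (intro borel_measurable_sum) measurable

lemma offdiag_nn_integral_insert:
  fixes A :: "'i set" and F :: "complex \<Rightarrow> ennreal"
  assumes A: "finite A" "k \<notin> A" and C: "hermitian_contraction_on (insert k A) C"
    and F[measurable]: "F \<in> borel_measurable borel"
  shows "(\<integral>\<^sup>+x. F (offdiag C (insert k A) x) \<partial>PiM (insert k A) (\<lambda>_. mu))
    = (\<integral>\<^sup>+x. (\<integral>\<^sup>+y. F (offdiag C A x + (cnj y * (\<Sum>b\<in>A. C k b * x b) + y * cnj (\<Sum>b\<in>A. C k b * x b))) \<partial>mu)
        \<partial>PiM A (\<lambda>_. mu))"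
proof -
  have "offdiag C (insert k A) (x(k := y))
      = offdiag C A x + (cnj y * (\<Sum>b\<in>A. C k b * x b) + y * cnj (\<Sum>b\<in>A. C k b * x b))" for x y
  proof -
    have "offdiag C A (x(k := y)) = offdiag C A x"
      unfolding offdiag_def using A by (intro sum.cong refl) auto
    moreover have "(\<Sum>b\<in>A. C k b * (x(k := y)) b) = (\<Sum>b\<in>A. C k b * x b)"
      using A by (intro sum.cong refl) auto
    moreover have "(\<Sum>a\<in>A. cnj ((x(k := y)) a) * C a k) = cnj (\<Sum>b\<in>A. C k b * x b)"
    proof -
      have "C a k = cnj (C k a)" if "a \<in> A" for a
        using C that unfolding hermitian_contraction_on_def by blast
      then show ?thesis using A by (auto simp: cnj_sum mult.commute intro!: sum.cong)
    qed
    ultimately show ?thesis using A by (simp add: offdiag_insert)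
  qed
  then show ?thesis by (subst PiM_const_insert[OF A]) auto
qed

lemma linear_form_power2:
  fixes A :: "'i set"
  assumes "finite A"
  shows "(\<integral>\<^sup>+x. ennreal ((cmod (\<Sum>b\<in>A. v b * x b))\<^sup>2) \<partial>PiM A (\<lambda>_. mu)) \<le> ennreal (\<Sum>b\<in>A. (cmod (v b))\<^sup>2)"
  by (rule nn_integral_sum_power2_le[of A "\<lambda>b y. v b * y"]) (use assms scaled_moments in auto)

lemma linear_form_power4:
  fixes A :: "'i set"
  assumes "finite A" and i4: "integrable mu (\<lambda>y. cmod y ^ 4)"
    and \<kappa>: "\<kappa> \<ge> 1" "(\<integral>y. cmod y ^ 4 \<partial>mu) \<le> \<kappa>"
  shows "(\<integral>\<^sup>+x. ennreal (cmod (\<Sum>b\<in>A. v b * x b) ^ 4) \<partial>PiM A (\<lambda>_. mu))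
    \<le> ennreal (4 * \<kappa> * (\<Sum>b\<in>A. (cmod (v b))\<^sup>2)\<^sup>2)"
proof (rule nn_integral_sum_power4_le[of A "\<lambda>b y. v b * y"])
  show "(\<integral>y. cmod (v b * y) ^ 4 \<partial>mu) \<le> \<kappa> * ((cmod (v b))\<^sup>2)\<^sup>2" for b
  proof -
    have "cmod (v b) ^ 4 * (\<integral>y. cmod y ^ 4 \<partial>mu) \<le> cmod (v b) ^ 4 * \<kappa>"
      using \<kappa> by (intro mult_left_mono) auto
    then show ?thesis using i4 by (simp add: norm_mult power_mult_distrib mult_ac flip: power_mult)
  qed
  show "integrable mu (\<lambda>y. cmod (v b * y) ^ 4)" for b
    using i4 by (simp add: norm_mult power_mult_distrib)
qed (use assms scaled_moments in auto)

text \<open>Given the earlier variables, an increment has second moment at most 4 |u|^2, and u is a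
  linear form with coefficients from one row of \<open>C\<close>, so E |u|^2 \<le> 1. Each index
  therefore adds at most 4.\<close>

lemma offdiag_power2:
  fixes A :: "'i set"
  assumes "finite A" "hermitian_contraction_on A C"
  shows "(\<integral>\<^sup>+x. ennreal ((cmod (offdiag C A x))\<^sup>2) \<partial>PiM A (\<lambda>_. mu)) \<le> ennreal (4 * card A)"
  using assms
proof (induction A)
  case empty
  then show ?case by (simp add: offdiag_def)
next
  case (insert k A)
  let ?u = "\<lambda>x. \<Sum>b\<in>A. C k b * x b"
  have C: "hermitian_contraction_on A C"
    using hermitian_contraction_on_subset[OF insert.prems] insert.hyps by auto
  have row: "(\<Sum>b\<in>A. (cmod (C k b))\<^sup>2) \<le> 1"
  proof -
    have "(\<Sum>b\<in>A. (cmod (C k b))\<^sup>2) \<le> (\<Sum>b\<in>insert k A. (cmod (C k b))\<^sup>2)"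
      using insert.hyps by (intro sum_mono2) auto
    also have "\<dots> \<le> 1" using insert.prems unfolding hermitian_contraction_on_def by blast
    finally show ?thesis .
  qed
  have "(\<integral>\<^sup>+x. ennreal ((cmod (offdiag C (insert k A) x))\<^sup>2) \<partial>PiM (insert k A) (\<lambda>_. mu))
      \<le> (\<integral>\<^sup>+x. ennreal ((cmod (offdiag C A x))\<^sup>2 + 4 * (cmod (?u x))\<^sup>2) \<partial>PiM A (\<lambda>_. mu))"
    by (subst offdiag_nn_integral_insert[OF insert.hyps insert.prems, of "\<lambda>z. ennreal ((cmod z)\<^sup>2)"], measurable)
       (intro nn_integral_mono nn_integral_shift_power2_le two_sided_moments)
  also have "\<dots> = (\<integral>\<^sup>+x. ennreal ((cmod (offdiag C A x))\<^sup>2) + 4 * ennreal ((cmod (?u x))\<^sup>2) \<partial>PiM A (\<lambda>_. mu))"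
    by (intro nn_integral_cong) (simp add: ennreal_mult)
  also have "\<dots> = (\<integral>\<^sup>+x. ennreal ((cmod (offdiag C A x))\<^sup>2) \<partial>PiM A (\<lambda>_. mu))
      + 4 * (\<integral>\<^sup>+x. ennreal ((cmod (?u x))\<^sup>2) \<partial>PiM A (\<lambda>_. mu))"
    by (simp add: nn_integral_add nn_integral_cmult)
  also have "\<dots> \<le> ennreal (4 * card A) + 4 * ennreal 1"
    using insert.IH[OF C] order_trans[OF linear_form_power2[OF insert.hyps(1), of "C k"] ennreal_leI[OF row]]
    by (intro add_mono mult_left_mono) auto
  also have "\<dots> = ennreal (4 * card (insert k A))"
    using insert.hyps by (simp add: ennreal_plus[symmetric] algebra_simps flip: ennreal_numeral del: ennreal_plus)
  finally show ?case .
qed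

text \<open>The mixed term 32 |T|^2 |u|^2 is not estimated jointly but split into \<theta> |T|^4 +
  (256 / \<theta>) |u|^4. The recursion then needs only the fourth moment of the linear form u. Its
  growth (1 + \<theta>)^n stays bounded for \<theta> = 1/n, at the price of an increment of order
  n.\<close>

lemma offdiag_power4:
  fixes A :: "'i set"
  assumes i4: "integrable mu (\<lambda>y. cmod y ^ 4)"
    and \<kappa>: "\<kappa> \<ge> 1" "(\<integral>y. cmod y ^ 4 \<partial>mu) \<le> \<kappa>" and \<theta>: "\<theta> > 0"
    and "finite A" "hermitian_contraction_on A C"
  shows "(\<integral>\<^sup>+x. ennreal (cmod (offdiag C A x) ^ 4) \<partial>PiM A (\<lambda>_. mu))
    \<le> ennreal ((1 + \<theta>) ^ card A * (card A * ((256 / \<theta> + 48 * \<kappa>) * (4 * \<kappa>))))"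
  using assms(5,6)
proof (induction A)
  case empty
  then show ?case by (simp add: offdiag_def)
next
  case (insert k A)
  let ?u = "\<lambda>x. \<Sum>b\<in>A. C k b * x b" and ?T = "offdiag C A"
  \<comment> \<open>48 = 3 * 16, from the weight 3 of the fourth power and the bound 16 \<kappa>
    |u|^4 on the fourth moment of the increment. The factor 4 \<kappa> in \<open>?c\<close> bounds
    the fourth moment of a linear form with coefficients from one row.\<close>
  let ?e = "256 / \<theta> + 48 * \<kappa>"
  let ?c = "?e * (4 * \<kappa>)"
  have e0: "?e \<ge> 0" using \<theta> \<kappa> by simp
  then have c0: "?c \<ge> 0" using \<kappa> by simp
  have C: "hermitian_contraction_on A C"
    using hermitian_contraction_on_subset[OF insert.prems] insert.hyps by auto
  have row: "(\<Sum>b\<in>A. (cmod (C k b))\<^sup>2) \<le> 1"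
  proof -
    have "(\<Sum>b\<in>A. (cmod (C k b))\<^sup>2) \<le> (\<Sum>b\<in>insert k A. (cmod (C k b))\<^sup>2)"
      using insert.hyps by (intro sum_mono2) auto
    also have "\<dots> \<le> 1" using insert.prems unfolding hermitian_contraction_on_def by blast
    finally show ?thesis .
  qed
  then have "(\<Sum>b\<in>A. (cmod (C k b))\<^sup>2)\<^sup>2 \<le> 1\<^sup>2" by (intro power_mono sum_nonneg) auto
  then have row4: "4 * \<kappa> * (\<Sum>b\<in>A. (cmod (C k b))\<^sup>2)\<^sup>2 \<le> 4 * \<kappa>" using \<kappa> by simp
  have step: "cmod T ^ 4 + 8 * (cmod T)\<^sup>2 * (4 * (cmod u)\<^sup>2) + 3 * (16 * \<kappa> * cmod u ^ 4)
      \<le> (1 + \<theta>) * cmod T ^ 4 + ?e * cmod u ^ 4" for T u :: complex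
  proof -
    have "0 \<le> (\<theta> * (cmod T)\<^sup>2 - 16 * (cmod u)\<^sup>2)\<^sup>2 / \<theta>" using \<theta> by simp
    also have "\<dots> = \<theta> * cmod T ^ 4 - 32 * ((cmod T)\<^sup>2 * (cmod u)\<^sup>2) + 256 / \<theta> * cmod u ^ 4"
      using \<theta> by (simp add: power2_eq_square power4_eq_xxxx field_simps)
    finally show ?thesis by (simp add: algebra_simps)
  qed
  have "(\<integral>\<^sup>+x. ennreal (cmod (offdiag C (insert k A) x) ^ 4) \<partial>PiM (insert k A) (\<lambda>_. mu))
      \<le> (\<integral>\<^sup>+x. ennreal (cmod (?T x) ^ 4 + 8 * (cmod (?T x))\<^sup>2 * (4 * (cmod (?u x))\<^sup>2)
          + 3 * (16 * \<kappa> * cmod (?u x) ^ 4)) \<partial>PiM A (\<lambda>_. mu))"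
  proof (subst offdiag_nn_integral_insert[OF insert.hyps insert.prems, of "\<lambda>z. ennreal (cmod z ^ 4)"], measurable,
      intro nn_integral_mono nn_integral_shift_power4_le two_sided_moments i4)
    fix x
    have "16 * (\<integral>y. cmod y ^ 4 \<partial>mu) * cmod (?u x) ^ 4 \<le> 16 * \<kappa> * cmod (?u x) ^ 4"
      using \<kappa> by (intro mult_right_mono) auto
    then show "(\<integral>y. cmod (cnj y * ?u x + y * cnj (?u x)) ^ 4 \<partial>mu) \<le> 16 * \<kappa> * cmod (?u x) ^ 4"
      using two_sided_moments(6)[OF i4, of "?u x"] by linarith
  qed
  also have "\<dots> \<le> (\<integral>\<^sup>+x. ennreal ((1 + \<theta>) * cmod (?T x) ^ 4 + ?e * cmod (?u x) ^ 4) \<partial>PiM A (\<lambda>_. mu))"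
    by (intro nn_integral_mono ennreal_leI step)
  also have "\<dots> = (\<integral>\<^sup>+x. ennreal (1 + \<theta>) * ennreal (cmod (?T x) ^ 4) + ennreal ?e * ennreal (cmod (?u x) ^ 4)
      \<partial>PiM A (\<lambda>_. mu))"
    using \<theta> e0 by (intro nn_integral_cong) (simp add: ennreal_mult[symmetric] flip: ennreal_plus)
  also have "\<dots> = ennreal (1 + \<theta>) * (\<integral>\<^sup>+x. ennreal (cmod (?T x) ^ 4) \<partial>PiM A (\<lambda>_. mu))
      + ennreal ?e * (\<integral>\<^sup>+x. ennreal (cmod (?u x) ^ 4) \<partial>PiM A (\<lambda>_. mu))"
    by (simp add: nn_integral_add nn_integral_cmult)
  also have "\<dots> \<le> ennreal (1 + \<theta>) * ennreal ((1 + \<theta>) ^ card A * (card A * ?c)) + ennreal ?e * ennreal (4 * \<kappa>)"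
    using insert.IH[OF C] order_trans[OF linear_form_power4[OF insert.hyps(1) i4 \<kappa>, of "C k"] ennreal_leI[OF row4]]
    by (intro add_mono mult_left_mono) auto
  also have "\<dots> = ennreal ((1 + \<theta>) * ((1 + \<theta>) ^ card A * (card A * ?c)) + ?c)"
    using \<theta> e0 c0 \<kappa> by (simp add: ennreal_mult[symmetric] flip: ennreal_plus)
  also have "\<dots> \<le> ennreal ((1 + \<theta>) ^ card (insert k A) * (card (insert k A) * ?c))"
  proof (rule ennreal_leI)
    define c where "c = ?c"
    have "1 * c \<le> (1 + \<theta>) ^ Suc (card A) * c"
      using \<theta> c0 unfolding c_def by (intro mult_right_mono one_le_power) auto
    then show "(1 + \<theta>) * ((1 + \<theta>) ^ card A * (card A * ?c)) + ?c \<le> (1 + \<theta>) ^ card (insert k A)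
        * (card (insert k A) * ?c)"
      unfolding c_def[symmetric] using insert.hyps by (simp add: algebra_simps)
  qed
  finally show ?case .
qed

end

definition qform :: "('i \<Rightarrow> 'i \<Rightarrow> complex) \<Rightarrow> 'i set \<Rightarrow> ('i \<Rightarrow> complex) \<Rightarrow> complex" where
  "qform C A x = (\<Sum>a\<in>A. \<Sum>b\<in>A. cnj (x a) * C a b * x b)"

lemma qform_split:
  assumes "finite A"
  shows "qform C A x = offdiag C A x + (\<Sum>a\<in>A. C a a * complex_of_real ((cmod (x a))\<^sup>2))"
proof -
  have "(\<Sum>b\<in>A. cnj (x a) * C a b * x b) = (\<Sum>b\<in>A - {a}. cnj (x a) * C a b * x b)
      + C a a * complex_of_real ((cmod (x a))\<^sup>2)"
    if "a \<in> A" for a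
    unfolding sum.remove[OF assms that] by (simp add: complex_norm_square mult_ac del: of_real_power)
  then show ?thesis by (simp add: qform_def offdiag_def sum.distrib)
qed

lemma qform_centred:
  assumes "finite A" "hermitian_contraction_on A C"
  shows "Re (qform C A x) - (\<Sum>a\<in>A. Re (C a a)) = Re (offdiag C A x) + (\<Sum>a\<in>A. Re (C a a) * ((cmod (x a))\<^sup>2 - 1))"
  unfolding qform_split[OF assms(1)] by (simp add: sum_subtractf algebra_simps)

lemma hermitian_contraction_on_diag:
  assumes "finite A" "hermitian_contraction_on A C" "a \<in> A"
  shows "\<bar>Re (C a a)\<bar> \<le> 1"
proof -
  have "(cmod (C a a))\<^sup>2 \<le> (\<Sum>b\<in>A. (cmod (C a b))\<^sup>2)"
    using assms by (intro member_le_sum) auto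
  also have "\<dots> \<le> 1" using assms unfolding hermitian_contraction_on_def by blast
  finally have "cmod (C a a) \<le> 1" by (simp add: abs_square_le_1)
  then show ?thesis using abs_Re_le_cmod order_trans by blast
qed

context prob_space
begin

lemma nn_integral_PiM_component:
  fixes A :: "'i set"
  assumes i: "i \<in> A" and f: "f \<in> borel_measurable M"
  shows "(\<integral>\<^sup>+x. f (x i) \<partial>PiM A (\<lambda>_. M)) = (\<integral>\<^sup>+y. f y \<partial>M)"
proof -
  interpret P: product_prob_space "\<lambda>_::'i. M" A by (rule product_prob_space_const)
  have "(\<integral>\<^sup>+y. f y \<partial>M) = (\<integral>\<^sup>+y. f y \<partial>distr (PiM A (\<lambda>_. M)) M (\<lambda>x. x i))"
    using P.PiM_component[OF i] by simp
  also have "\<dots> = (\<integral>\<^sup>+x. f (x i) \<partial>PiM A (\<lambda>_. M))"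
    by (rule nn_integral_distr) (use i f in measurable)
  finally show ?thesis ..
qed

end

section \<open>Mean deviation of quadratic forms under two moments, tail bounds under the
  cut-off\<close>

context unit_law
begin

lemma prob_UNIV [simp]: "prob UNIV = 1"
  using prob_space by simp

lemma tail_second_moment:
  assumes e: "e > 0"
  shows "\<exists>\<tau>\<ge>0. (\<integral>z. (cmod z)\<^sup>2 * indicator {z. (cmod z)\<^sup>2 > \<tau>} z \<partial>mu) \<le> e"
proof -
  let ?f = "\<lambda>(n::nat) z. (cmod z)\<^sup>2 * indicator {z. (cmod z)\<^sup>2 > real n} z :: real"
  have "(\<lambda>n. \<integral>z. ?f n z \<partial>mu) \<longlonglongrightarrow> (\<integral>z. 0 \<partial>mu)"
  proof (rule integral_dominated_convergence[where w = "\<lambda>z. (cmod z)\<^sup>2"])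
    show "AE z in mu. (\<lambda>n. ?f n z) \<longlonglongrightarrow> 0"
    proof (intro AE_I2 tendsto_eventually)
      fix z :: complex
      obtain n0 :: nat where "(cmod z)\<^sup>2 \<le> real n0" using real_arch_simple by blast
      then show "\<forall>\<^sub>F n in sequentially. ?f n z = 0"
        by (intro eventually_sequentiallyI[of n0]) (auto simp: indicator_def)
    qed
    show "AE z in mu. norm (?f n z) \<le> (cmod z)\<^sup>2" for n by (auto simp: indicator_def)
  qed (use square_integrable in auto)
  then have "\<forall>\<^sub>F n in sequentially. (\<integral>z. ?f n z \<partial>mu) < e"
    using e by (intro order_tendstoD(2)) auto
  then obtain n where "(\<integral>z. ?f n z \<partial>mu) < e" by (auto simp: eventually_sequentially)
  then show ?thesis by (intro exI[of _ "real n"]) auto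
qed

text \<open>The squared moduli may have infinite variance, so they are split at level \<tau>. The
  bounded part g has variance at most E g^2 \<le> \<tau> E g \<le> \<tau> and contributes on the
  scale sqrt n. The tail h is estimated in mean only, by 2 \<eta> per index, which is made small by
  the choice of \<tau> and not of n.\<close>

lemma diag_L1:
  fixes A :: "'i set" and c :: "'i \<Rightarrow> real" and \<eta> :: real
  assumes A: "finite A" "A \<noteq> {}" and c: "\<And>a. a \<in> A \<Longrightarrow> \<bar>c a\<bar> \<le> 1"
    and \<tau>: "\<tau> \<ge> 0" and \<eta>: "(\<integral>z. (cmod z)\<^sup>2 * indicator {z. (cmod z)\<^sup>2 > \<tau>} z \<partial>mu) \<le> \<eta>"
  shows "(\<integral>\<^sup>+x. ennreal \<bar>\<Sum>a\<in>A. c a * ((cmod (x a))\<^sup>2 - 1)\<bar> \<partial>PiM A (\<lambda>_. mu))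
    \<le> ennreal (sqrt (card A) * (1 + \<tau>) / 2 + 2 * real (card A) * \<eta>)"
proof -
  interpret P: prob_space "PiM A (\<lambda>_. mu)" by (rule prob_space_PiM_const)
  define h where "h z = (cmod z)\<^sup>2 * indicator {z. (cmod z)\<^sup>2 > \<tau>} z" for z :: complex
  define g where "g z = (cmod z)\<^sup>2 * indicator {z. (cmod z)\<^sup>2 \<le> \<tau>} z" for z :: complex
  have gh: "(cmod z)\<^sup>2 = g z + h z" for z by (auto simp: g_def h_def indicator_def)
  have [measurable]: "g \<in> borel_measurable mu" "h \<in> borel_measurable mu" unfolding g_def h_def by measurable
  have g0: "0 \<le> g z" "g z \<le> \<tau>" "h z \<ge> 0" "g z \<le> (cmod z)\<^sup>2" "h z \<le> (cmod z)\<^sup>2" for z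
    using \<tau> by (auto simp: g_def h_def indicator_def)
  have ig: "integrable mu g" and ih: "integrable mu h"
    by (rule Bochner_Integration.integrable_bound[OF square_integrable], use g0 in auto)+
  define m where "m = (\<integral>z. g z \<partial>mu)"
  define e where "e = (\<integral>z. h z \<partial>mu)"
  have em: "m + e = 1" unfolding m_def e_def using ig ih variance
      by (simp add: gh flip: Bochner_Integration.integral_add)
  have e0: "e \<ge> 0" "e \<le> \<eta>" using \<eta> g0 by (auto simp: e_def h_def)
  have m01: "0 \<le> m" "m \<le> 1" unfolding m_def using em e0 g0 by (auto simp: m_def)
  let ?n = "real (card A)"
  have n: "?n > 0" using A by (simp add: card_gt_0_iff)
  let ?F = "\<lambda>x. \<Sum>a\<in>A. complex_of_real (c a * (g (x a) - m))"
  let ?G = "\<lambda>x. \<Sum>a\<in>A. h (x a) + e"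
  have F2: "(\<integral>\<^sup>+x. ennreal ((cmod (?F x))\<^sup>2) \<partial>PiM A (\<lambda>_. mu)) \<le> ennreal (\<Sum>a\<in>A. \<tau>)"
  proof (rule nn_integral_sum_power2_le[of A "\<lambda>a z. complex_of_real (c a * (g z - m))"])
    fix a assume a: "a \<in> A"
    have ig2: "integrable mu (\<lambda>z. (g z)\<^sup>2)"
      by (rule Bochner_Integration.integrable_bound[of mu "\<lambda>z. \<tau> * g z"])
         (use ig g0 \<tau> in \<open>auto simp: power2_eq_square intro!: mult_right_mono\<close>)
    have igm: "integrable mu (\<lambda>z. (g z - m)\<^sup>2)"
      unfolding power2_diff using ig ig2 by auto
    show "(\<lambda>z. complex_of_real (c a * (g z - m))) \<in> borel_measurable mu" by measurable
    show i: "integrable mu (\<lambda>z. (cmod (complex_of_real (c a * (g z - m))))\<^sup>2)"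
      using igm by (simp add: norm_mult power_mult_distrib del: of_real_mult of_real_diff)
    have "(\<integral>z. c a * (g z - m) \<partial>mu) = 0" using ig by (simp add: m_def prob_space)
    then show "(\<integral>z. complex_of_real (c a * (g z - m)) \<partial>mu) = 0"
      by (simp only: integral_complex_of_real of_real_0)
    have "(\<integral>z. (cmod (complex_of_real (c a * (g z - m))))\<^sup>2 \<partial>mu) \<le> (\<integral>z. (g z - m)\<^sup>2 \<partial>mu)"
    proof (rule integral_mono[OF i igm])
      fix z
      have "(c a)\<^sup>2 * (g z - m)\<^sup>2 \<le> 1 * (g z - m)\<^sup>2"
        using c[OF a] by (intro mult_right_mono) (auto simp: abs_square_le_1)
      then show "(cmod (complex_of_real (c a * (g z - m))))\<^sup>2 \<le> (g z - m)\<^sup>2"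
        by (simp add: norm_of_real power_mult_distrib del: of_real_mult of_real_diff)
    qed
    also have "\<dots> = (\<integral>z. (g z)\<^sup>2 \<partial>mu) - m\<^sup>2"
      unfolding power2_diff using ig ig2 by (simp add: m_def[symmetric] prob_space power2_eq_square)
    also have "\<dots> \<le> (\<integral>z. (g z)\<^sup>2 \<partial>mu)" by simp
    also have "\<dots> \<le> (\<integral>z. \<tau> * g z \<partial>mu)"
      using ig ig2 g0 by (intro integral_mono) (auto simp: power2_eq_square intro!: mult_right_mono)
    also have "\<dots> = \<tau> * m" by (simp add: m_def)
    also have "\<dots> \<le> \<tau>" using m01 \<tau> by (simp add: mult_left_le)
    finally show "(\<integral>z. (cmod (complex_of_real (c a * (g z - m))))\<^sup>2 \<partial>mu) \<le> \<tau>" .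
  qed (use A in auto)
  have pt: "\<bar>\<Sum>a\<in>A. c a * ((cmod (x a))\<^sup>2 - 1)\<bar> \<le> sqrt ?n / 2 + 1 / (2 * sqrt ?n) * (cmod (?F x))\<^sup>2 + ?G x" for x
  proof -
    have s: "c a * ((cmod (x a))\<^sup>2 - 1) = c a * (g (x a) - m) + c a * (h (x a) - e)" for a
      unfolding gh em[symmetric] by (simp add: algebra_simps)
    have "\<bar>\<Sum>a\<in>A. c a * (h (x a) - e)\<bar> \<le> ?G x"
    proof (rule order_trans[OF sum_abs], rule sum_mono)
      fix a assume "a \<in> A"
      have "\<bar>c a\<bar> * \<bar>h (x a) - e\<bar> \<le> 1 * (h (x a) + e)"
        using c[OF \<open>a \<in> A\<close>] g0(3)[of "x a"] e0 by (intro mult_mono) auto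
      then show "\<bar>c a * (h (x a) - e)\<bar> \<le> h (x a) + e" by (simp add: abs_mult)
    qed
    \<comment> \<open>f \<le> sqrt n / 2 + f^2 / (2 sqrt n) passes from second to first moments
      pointwise under the integral, in place of Jensen's inequality.\<close>
    moreover have "\<bar>\<Sum>a\<in>A. c a * (g (x a) - m)\<bar> \<le> sqrt ?n / 2 + 1 / (2 * sqrt ?n) * (cmod (?F x))\<^sup>2"
    proof -
      define f where "f = cmod (?F x)"
      have f: "\<bar>\<Sum>a\<in>A. c a * (g (x a) - m)\<bar> = f"
        unfolding f_def of_real_sum[symmetric] norm_of_real ..
      have "0 \<le> (f - sqrt ?n)\<^sup>2 / (2 * sqrt ?n)" by simp
      also have "\<dots> = 1 / (2 * sqrt ?n) * f\<^sup>2 - f + sqrt ?n / 2"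
        using n by (simp add: power2_eq_square field_simps)
      finally show ?thesis unfolding f f_def[symmetric] by simp
    qed
    ultimately show ?thesis unfolding s sum.distrib by linarith
  qed
  have "(\<integral>\<^sup>+x. ennreal \<bar>\<Sum>a\<in>A. c a * ((cmod (x a))\<^sup>2 - 1)\<bar> \<partial>PiM A (\<lambda>_. mu))
      \<le> (\<integral>\<^sup>+x. ennreal (sqrt ?n / 2 + 1 / (2 * sqrt ?n) * (cmod (?F x))\<^sup>2 + ?G x) \<partial>PiM A (\<lambda>_. mu))"
    by (intro nn_integral_mono ennreal_leI pt)
  also have "\<dots> = (\<integral>\<^sup>+x. ennreal (sqrt ?n / 2) + ennreal (1 / (2 * sqrt ?n)) * ennreal ((cmod (?F x))\<^sup>2)
      + (\<Sum>a\<in>A. ennreal (h (x a)) + ennreal e) \<partial>PiM A (\<lambda>_. mu))"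
  proof (intro nn_integral_cong)
    fix x
    have "ennreal (?G x) = (\<Sum>a\<in>A. ennreal (h (x a)) + ennreal e)"
      using g0 e0 by (subst sum_ennreal[symmetric]) auto
    moreover have "?G x \<ge> 0" using g0 e0 by (intro sum_nonneg) auto
    ultimately show "ennreal (sqrt ?n / 2 + 1 / (2 * sqrt ?n) * (cmod (?F x))\<^sup>2 + ?G x)
      = ennreal (sqrt ?n / 2) + ennreal (1 / (2 * sqrt ?n)) * ennreal ((cmod (?F x))\<^sup>2)
          + (\<Sum>a\<in>A. ennreal (h (x a)) + ennreal e)"
      by (subst ennreal_plus, simp, simp, subst ennreal_plus, simp, simp, subst ennreal_mult) auto
  qed
  also have "\<dots> = ennreal (sqrt ?n / 2) + ennreal (1 / (2 * sqrt ?n)) * (\<integral>\<^sup>+x. ennreal ((cmod (?F x))\<^sup>2)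
      \<partial>PiM A (\<lambda>_. mu))
      + (\<Sum>a\<in>A. ennreal e + ennreal e)"
  proof -
    have "(\<integral>\<^sup>+x. ennreal (h (x a)) \<partial>PiM A (\<lambda>_. mu)) = ennreal e" if "a \<in> A" for a
      using nn_integral_PiM_component[OF that, of "\<lambda>z. ennreal (h z)"] nn_integral_eq_integral[OF ih] g0
      by (simp add: e_def)
    then show ?thesis
      by (simp add: nn_integral_add nn_integral_cmult nn_integral_sum P.emeasure_space_1 distrib_left)
  qed
  also have "\<dots> \<le> ennreal (sqrt ?n / 2) + ennreal (1 / (2 * sqrt ?n)) * ennreal (\<Sum>a\<in>A. \<tau>) + (\<Sum>a\<in>A. ennreal e
      + ennreal e)"
    using F2 by (intro add_mono mult_left_mono) auto
  also have "(\<Sum>a\<in>A. ennreal e + ennreal e) = ennreal (\<Sum>a\<in>A. e + e)"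
    unfolding ennreal_plus[OF e0(1) e0(1), symmetric] using e0 by (intro sum_ennreal) auto
  also have "ennreal (sqrt ?n / 2) + ennreal (1 / (2 * sqrt ?n)) * ennreal (\<Sum>a\<in>A. \<tau>) + ennreal (\<Sum>a\<in>A. e + e)
      = ennreal (sqrt ?n / 2 + 1 / (2 * sqrt ?n) * (?n * \<tau>) + ?n * (e + e))"
    using e0 \<tau> by (simp add: ennreal_mult[symmetric] flip: ennreal_plus)
  also have "\<dots> \<le> ennreal (sqrt ?n * (1 + \<tau>) / 2 + 2 * ?n * \<eta>)"
  proof (rule ennreal_leI)
    have "?n / sqrt ?n = sqrt ?n" using n by (simp add: real_div_sqrt)
    then have "1 / (2 * sqrt ?n) * (?n * \<tau>) = sqrt ?n * \<tau> / 2" using n by (simp add: field_simps)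
    moreover have "?n * (e + e) \<le> 2 * ?n * \<eta>" using e0 n by simp
    moreover have "sqrt ?n * (1 + \<tau>) / 2 = sqrt ?n / 2 + sqrt ?n * \<tau> / 2" by (simp add: field_simps)
    ultimately show "sqrt ?n / 2 + 1 / (2 * sqrt ?n) * (?n * \<tau>) + ?n * (e + e) \<le> sqrt ?n * (1 + \<tau>) / 2 + 2 * ?n * \<eta>"
      by linarith
  qed
  finally show ?thesis .
qed

text \<open>The off-diagonal part has second moment at most 4 n and enters through the same
  pointwise splitting as in \<open>diag_L1\<close>, giving sqrt n / 2 + 2 sqrt n. With sqrt n / 2
  from the diagonal part this makes 3 sqrt n.\<close>

lemma qform_L1:
  fixes A :: "'i set" and \<eta> :: real
  assumes A: "finite A" "A \<noteq> {}" and C: "hermitian_contraction_on A C"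
    and \<tau>: "\<tau> \<ge> 0" and \<eta>: "(\<integral>z. (cmod z)\<^sup>2 * indicator {z. (cmod z)\<^sup>2 > \<tau>} z \<partial>mu) \<le> \<eta>"
  shows "(\<integral>\<^sup>+x. ennreal \<bar>Re (qform C A x) - (\<Sum>a\<in>A. Re (C a a))\<bar> \<partial>PiM A (\<lambda>_. mu))
    \<le> ennreal (sqrt (card A) * (3 + \<tau>) + 2 * real (card A) * \<eta>)"
proof -
  interpret P: prob_space "PiM A (\<lambda>_. mu)" by (rule prob_space_PiM_const)
  let ?n = "real (card A)"
  have n: "?n > 0" using A by (simp add: card_gt_0_iff)
  have \<eta>0: "\<eta> \<ge> 0" by (rule order_trans[OF _ \<eta>]) simp
  let ?D = "\<lambda>x. \<Sum>a\<in>A. Re (C a a) * ((cmod (x a))\<^sup>2 - 1)"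
  have pt: "\<bar>Re (qform C A x) - (\<Sum>a\<in>A. Re (C a a))\<bar>
      \<le> sqrt ?n / 2 + 1 / (2 * sqrt ?n) * (cmod (offdiag C A x))\<^sup>2 + \<bar>?D x\<bar>" for x
  proof -
    define f where "f = cmod (offdiag C A x)"
    have "0 \<le> (f - sqrt ?n)\<^sup>2 / (2 * sqrt ?n)" by simp
    also have "\<dots> = 1 / (2 * sqrt ?n) * f\<^sup>2 - f + sqrt ?n / 2"
      using n by (simp add: power2_eq_square field_simps)
    finally have "f \<le> sqrt ?n / 2 + 1 / (2 * sqrt ?n) * f\<^sup>2" by simp
    moreover have "\<bar>Re (offdiag C A x)\<bar> \<le> f" unfolding f_def by (rule abs_Re_le_cmod)
    ultimately show ?thesis unfolding qform_centred[OF A(1) C] f_def by linarith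
  qed
  have "(\<integral>\<^sup>+x. ennreal \<bar>Re (qform C A x) - (\<Sum>a\<in>A. Re (C a a))\<bar> \<partial>PiM A (\<lambda>_. mu))
      \<le> (\<integral>\<^sup>+x. ennreal (sqrt ?n / 2 + 1 / (2 * sqrt ?n) * (cmod (offdiag C A x))\<^sup>2 + \<bar>?D x\<bar>) \<partial>PiM A (\<lambda>_. mu))"
    by (intro nn_integral_mono ennreal_leI pt)
  also have "\<dots> = (\<integral>\<^sup>+x. ennreal (sqrt ?n / 2) + ennreal (1 / (2 * sqrt ?n))
      * ennreal ((cmod (offdiag C A x))\<^sup>2) + ennreal \<bar>?D x\<bar> \<partial>PiM A (\<lambda>_. mu))"
    by (intro nn_integral_cong) (subst ennreal_plus, simp, simp, subst ennreal_plus, simp, simp, subst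
        ennreal_mult, auto)
  also have "\<dots> = ennreal (sqrt ?n / 2) + ennreal (1 / (2 * sqrt ?n)) * (\<integral>\<^sup>+x. ennreal ((cmod (offdiag C A
      x))\<^sup>2) \<partial>PiM A (\<lambda>_. mu))
      + (\<integral>\<^sup>+x. ennreal \<bar>?D x\<bar> \<partial>PiM A (\<lambda>_. mu))"
    by (simp add: nn_integral_add nn_integral_cmult P.emeasure_space_1)
  also have "\<dots> \<le> ennreal (sqrt ?n / 2) + ennreal (1 / (2 * sqrt ?n)) * ennreal (4 * card A)
      + ennreal (sqrt ?n * (1 + \<tau>) / 2 + 2 * ?n * \<eta>)"
  proof -
    have "(\<integral>\<^sup>+x. ennreal \<bar>?D x\<bar> \<partial>PiM A (\<lambda>_. mu)) \<le> ennreal (sqrt ?n * (1 + \<tau>) / 2 + 2 * ?n * \<eta>)"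
      by (rule diag_L1[OF A hermitian_contraction_on_diag[OF A(1) C] \<tau> \<eta>])
    then show ?thesis using offdiag_power2[OF A(1) C] by (intro add_mono mult_left_mono) auto
  qed
  also have "\<dots> = ennreal (sqrt ?n / 2 + 1 / (2 * sqrt ?n) * (4 * ?n) + (sqrt ?n * (1 + \<tau>) / 2 + 2 * ?n * \<eta>))"
    using \<tau> \<eta>0 by (simp add: ennreal_mult[symmetric] flip: ennreal_plus)
  also have "\<dots> \<le> ennreal (sqrt ?n * (3 + \<tau>) + 2 * ?n * \<eta>)"
  proof (rule ennreal_leI)
    have "?n / sqrt ?n = sqrt ?n" using n by (simp add: real_div_sqrt)
    then have 1: "1 / (2 * sqrt ?n) * (4 * ?n) = 2 * sqrt ?n" using n by (simp add: field_simps)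
    have 2: "sqrt ?n * (1 + \<tau>) / 2 = sqrt ?n / 2 + sqrt ?n * \<tau> / 2" "sqrt ?n * (3 + \<tau>) = 3 * sqrt ?n + sqrt ?n * \<tau>"
      by (simp_all add: field_simps)
    have "s / 2 + 2 * s + (s / 2 + p / 2 + z) \<le> 3 * s + p + z" if "p \<ge> 0" for s p z :: real
      using that by simp
    from this[of "sqrt ?n * \<tau>" "sqrt ?n" "2 * ?n * \<eta>"] show "sqrt ?n / 2 + 1 / (2 * sqrt ?n) * (4 * ?n)
        + (sqrt ?n * (1 + \<tau>) / 2 + 2 * ?n * \<eta>)
      \<le> sqrt ?n * (3 + \<tau>) + 2 * ?n * \<eta>"
      unfolding 1 2 using \<tau> by simp
  qed
  finally show ?thesis .
qed

text \<open>If the modulus of z exceeds \<epsilon> n, one of Re z, - Re z, Im z, - Im z exceeds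
  \<epsilon> n / 2. These are the real parts of z times 1, -1, -i, i, so one real deviation bound is
  used four times. Since |v a|^2 \<le> V n, the condition on |x a|^2 V bounds each normalized
  summand by b.\<close>

lemma linear_form_deviation:
  fixes A :: "'i set"
  assumes A: "finite A" and n: "n > 0" and v: "(\<Sum>a\<in>A. (cmod (v a))\<^sup>2) \<le> V * n"
    and t: "t \<ge> 0" and b: "b \<ge> 0"
  shows "emeasure (PiM A (\<lambda>_. mu))
      {x \<in> space (PiM A (\<lambda>_. mu)). cmod (\<Sum>a\<in>A. cnj (x a) * v a) > \<epsilon> * n \<and> (\<forall>a\<in>A. (cmod (x a))\<^sup>2 * V \<le> b\<^sup>2 * n)}
    \<le> 4 * ennreal (exp (- t * (\<epsilon> / 2) + t\<^sup>2 * exp (t * b) * (V / n)))"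
proof -
  interpret P: prob_space "PiM A (\<lambda>_. mu)" by (rule prob_space_PiM_const)
  let ?P = "PiM A (\<lambda>_. mu)"
  define f where "f s a y = Re (s * (cnj y * v a)) / n" for s a y
  let ?B = "\<lambda>s. {x \<in> space ?P. (\<Sum>a\<in>A. f s a (x a)) > \<epsilon> / 2 \<and> (\<forall>a\<in>A. \<bar>f s a (x a)\<bar> \<le> b)}"
  let ?S = "{x \<in> space ?P. cmod (\<Sum>a\<in>A. cnj (x a) * v a) > \<epsilon> * n \<and> (\<forall>a\<in>A. (cmod (x a))\<^sup>2 * V \<le> b\<^sup>2 * n)}"
  have [measurable]: "f s a \<in> borel_measurable mu" for s a unfolding f_def by measurable
  have fb: "\<bar>f s a y\<bar> \<le> cmod y * cmod (v a) / n" if "cmod s = 1" for s a y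
    using abs_Re_le_cmod[of "s * (cnj y * v a)"] n that by (simp add: f_def norm_mult divide_right_mono)
  have fb2: "(f s a y)\<^sup>2 \<le> (cmod (v a))\<^sup>2 / n\<^sup>2 * (cmod y)\<^sup>2" if "cmod s = 1" for s a y
  proof -
    have "\<bar>f s a y\<bar>\<^sup>2 \<le> (cmod y * cmod (v a) / n)\<^sup>2" using fb[OF that] by (intro power_mono) auto
    then show ?thesis by (simp add: power_mult_distrib power_divide mult.commute)
  qed
  have bound: "emeasure ?P (?B s) \<le> ennreal (exp (- t * (\<epsilon> / 2) + t\<^sup>2 * exp (t * b) * (V / n)))" if s: "cmod s
      = 1" for s
  proof (rule bounded_deviation[OF A _ _ _ _ t b])
    fix a assume "a \<in> A"
    show "f s a \<in> borel_measurable mu" by measurable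
    show "integrable mu (\<lambda>y. (f s a y)\<^sup>2)"
      by (rule Bochner_Integration.integrable_bound[of mu "\<lambda>y. (cmod (v a))\<^sup>2 / n\<^sup>2 * (cmod y)\<^sup>2"])
         (use square_integrable fb2[OF s] in auto)
    have "(\<integral>y. Re (s * (cnj y * v a)) \<partial>mu) = Re (\<integral>y. s * (cnj y * v a) \<partial>mu)"
      using integrable_id by (intro integral_Re) simp
    then show "(\<integral>y. f s a y \<partial>mu) = 0" unfolding f_def using mean by simp
  next
    have "(\<Sum>a\<in>A. \<integral>y. (f s a y)\<^sup>2 \<partial>mu) \<le> (\<Sum>a\<in>A. (cmod (v a))\<^sup>2 / n\<^sup>2)"
    proof (rule sum_mono)
      fix a
      have i: "integrable mu (\<lambda>y. (f s a y)\<^sup>2)"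
        by (rule Bochner_Integration.integrable_bound[of mu "\<lambda>y. (cmod (v a))\<^sup>2 / n\<^sup>2 * (cmod y)\<^sup>2"])
           (use square_integrable fb2[OF s] in auto)
      have "(\<integral>y. (f s a y)\<^sup>2 \<partial>mu) \<le> (\<integral>y. (cmod (v a))\<^sup>2 / n\<^sup>2 * (cmod y)\<^sup>2 \<partial>mu)"
        using i square_integrable fb2[OF s] by (intro integral_mono) auto
      then show "(\<integral>y. (f s a y)\<^sup>2 \<partial>mu) \<le> (cmod (v a))\<^sup>2 / n\<^sup>2" using variance by simp
    qed
    also have "\<dots> = (\<Sum>a\<in>A. (cmod (v a))\<^sup>2) / n\<^sup>2" by (simp add: sum_divide_distrib)
    also have "\<dots> \<le> V * n / n\<^sup>2" using v by (intro divide_right_mono) auto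
    also have "\<dots> = V / n" using n by (simp add: power2_eq_square)
    finally show "(\<Sum>a\<in>A. \<integral>y. (f s a y)\<^sup>2 \<partial>mu) \<le> V / n" .
  qed
  have Bm: "?B s \<in> sets ?P" for s using A by measurable
  have "?S \<subseteq> (?B 1 \<union> ?B (-1)) \<union> (?B (-\<i>) \<union> ?B \<i>)"
  proof
    fix x assume x: "x \<in> ?S"
    let ?z = "\<Sum>a\<in>A. cnj (x a) * v a"
    have sum: "(\<Sum>a\<in>A. f s a (x a)) = Re (s * ?z) / n" for s
      by (simp only: f_def sum_divide_distrib[symmetric] Re_sum[symmetric] sum_distrib_left)
    have small: "\<bar>f s a (x a)\<bar> \<le> b" if a: "a \<in> A" and s: "cmod s = 1" for s a
    proof -
      have va: "(cmod (v a))\<^sup>2 \<le> V * n"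
        by (rule order_trans[OF member_le_sum v]) (use A a in auto)
      have "(cmod (x a) * cmod (v a))\<^sup>2 \<le> (cmod (x a))\<^sup>2 * (V * n)"
        unfolding power_mult_distrib using va by (intro mult_left_mono) auto
      also have "\<dots> = ((cmod (x a))\<^sup>2 * V) * n" by simp
      also have "\<dots> \<le> (b\<^sup>2 * n) * n" using x a n by (intro mult_right_mono) auto
      also have "\<dots> = (b * n)\<^sup>2" by (simp add: power2_eq_square)
      finally have "cmod (x a) * cmod (v a) \<le> b * n"
        by (rule power2_le_imp_le) (use b n in auto)
      then have "cmod (x a) * cmod (v a) / n \<le> b" using n by (simp add: divide_le_eq)
      then show ?thesis using fb[OF s] order_trans by blast
    qed
    have "\<epsilon> * n < \<bar>Re ?z\<bar> + \<bar>Im ?z\<bar>" using x cmod_le[of ?z] by auto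
    then have "Re ?z > \<epsilon> / 2 * n \<or> - Re ?z > \<epsilon> / 2 * n \<or> Im ?z > \<epsilon> / 2 * n \<or> - Im ?z > \<epsilon> / 2 * n"
      by (auto simp: abs_if split: if_splits)
    then have "Re (1 * ?z) / n > \<epsilon> / 2 \<or> Re ((-1) * ?z) / n > \<epsilon> / 2 \<or> Re ((-\<i>) * ?z) / n > \<epsilon> / 2
        \<or> Re (\<i> * ?z) / n > \<epsilon> / 2"
      unfolding pos_less_divide_eq[OF n] by simp
    then have "(\<Sum>a\<in>A. f 1 a (x a)) > \<epsilon> / 2 \<or> (\<Sum>a\<in>A. f (-1) a (x a)) > \<epsilon> / 2
        \<or> (\<Sum>a\<in>A. f (-\<i>) a (x a)) > \<epsilon> / 2 \<or> (\<Sum>a\<in>A. f \<i> a (x a)) > \<epsilon> / 2"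
      unfolding sum .
    then show "x \<in> (?B 1 \<union> ?B (-1)) \<union> (?B (-\<i>) \<union> ?B \<i>)" using x small by auto
  qed
  then have "emeasure ?P ?S \<le> emeasure ?P ((?B 1 \<union> ?B (-1)) \<union> (?B (-\<i>) \<union> ?B \<i>))"
    by (rule emeasure_mono) (use Bm in auto)
  also have "\<dots> \<le> (emeasure ?P (?B 1) + emeasure ?P (?B (-1))) + (emeasure ?P (?B (-\<i>)) + emeasure ?P (?B \<i>))"
    by (intro order_trans[OF emeasure_subadditive] add_mono sets.Un Bm) auto
  also have "\<dots> \<le> (ennreal (exp (- t * (\<epsilon> / 2) + t\<^sup>2 * exp (t * b) * (V / n))) + ennreal (exp (- t * (\<epsilon> / 2)
      + t\<^sup>2 * exp (t * b) * (V / n))))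
      + (ennreal (exp (- t * (\<epsilon> / 2) + t\<^sup>2 * exp (t * b) * (V / n))) + ennreal (exp (- t * (\<epsilon> / 2)
          + t\<^sup>2 * exp (t * b) * (V / n))))"
    by (intro add_mono bound) auto
  also have "\<dots> = 4 * ennreal (exp (- t * (\<epsilon> / 2) + t\<^sup>2 * exp (t * b) * (V / n)))"
    by (simp only: mult_2[symmetric] mult.assoc[symmetric]) simp
  finally show ?thesis .
qed

text \<open>The variance of |x|^2 - 1 is the fourth moment minus 1, which is where \<kappa> enters;
  the factor 2 accounts for the two signs of the deviation.\<close>

lemma diag_deviation:
  fixes A :: "'i set" and c :: "'i \<Rightarrow> real"
  assumes A: "finite A" "A \<noteq> {}" and c: "\<And>a. a \<in> A \<Longrightarrow> \<bar>c a\<bar> \<le> 1"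
    and i4: "integrable mu (\<lambda>y. cmod y ^ 4)" and \<kappa>: "(\<integral>y. cmod y ^ 4 \<partial>mu) \<le> \<kappa>"
    and t: "t \<ge> 0" and b: "b \<ge> 0"
  defines "n \<equiv> real (card A)"
  shows "emeasure (PiM A (\<lambda>_. mu))
      {x \<in> space (PiM A (\<lambda>_. mu)). \<bar>\<Sum>a\<in>A. c a * ((cmod (x a))\<^sup>2 - 1)\<bar> > \<epsilon> * n \<and> (\<forall>a\<in>A. (cmod (x a))\<^sup>2 + 1 \<le> b * n)}
    \<le> 2 * ennreal (exp (- t * \<epsilon> + t\<^sup>2 * exp (t * b) * (\<kappa> / n)))"
proof -
  let ?P = "PiM A (\<lambda>_. mu)"
  have n: "n > 0" unfolding n_def using A by (simp add: card_gt_0_iff)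
  define f where "f s a y = s * c a * ((cmod y)\<^sup>2 - 1) / n" for s :: real and a :: 'i and y :: complex
  let ?B = "\<lambda>s. {x \<in> space ?P. (\<Sum>a\<in>A. f s a (x a)) > \<epsilon> \<and> (\<forall>a\<in>A. \<bar>f s a (x a)\<bar> \<le> b)}"
  let ?S = "{x \<in> space ?P. \<bar>\<Sum>a\<in>A. c a * ((cmod (x a))\<^sup>2 - 1)\<bar> > \<epsilon> * n \<and> (\<forall>a\<in>A. (cmod (x a))\<^sup>2 + 1 \<le> b * n)}"
  have [measurable]: "f s a \<in> borel_measurable mu" for s a unfolding f_def by measurable
  have i2: "integrable mu (\<lambda>y. ((cmod y)\<^sup>2 - 1)\<^sup>2)"
    unfolding power2_diff using i4 square_integrable by (auto simp flip: power_mult)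
  have var: "(\<integral>y. ((cmod y)\<^sup>2 - 1)\<^sup>2 \<partial>mu) \<le> \<kappa>"
  proof -
    have "(\<integral>y. ((cmod y)\<^sup>2 - 1)\<^sup>2 \<partial>mu) = (\<integral>y. cmod y ^ 4 \<partial>mu) + 1 - 2"
      unfolding power2_diff using i4 square_integrable variance by (simp add: prob_space flip: power_mult)
    then show ?thesis using \<kappa> by simp
  qed
  have i2f: "integrable mu (\<lambda>y. (f s a y)\<^sup>2)" for s a
    using i2 by (simp add: f_def power_mult_distrib power_divide)
  have bound: "emeasure ?P (?B s) \<le> ennreal (exp (- t * \<epsilon> + t\<^sup>2 * exp (t * b) * (\<kappa> / n)))" if s: "s\<^sup>2 = 1" for s
  proof (rule bounded_deviation[OF A(1) _ i2f _ _ t b])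
    fix a assume "a \<in> A"
    show "f s a \<in> borel_measurable mu" by measurable
    show "(\<integral>y. f s a y \<partial>mu) = 0" unfolding f_def using square_integrable variance by (simp add: prob_space)
  next
    have "(\<Sum>a\<in>A. \<integral>y. (f s a y)\<^sup>2 \<partial>mu) \<le> (\<Sum>a\<in>A. \<kappa> / n\<^sup>2)"
    proof (rule sum_mono)
      fix a assume a: "a \<in> A"
      have "(\<integral>y. (f s a y)\<^sup>2 \<partial>mu) = (c a)\<^sup>2 / n\<^sup>2 * (\<integral>y. ((cmod y)\<^sup>2 - 1)\<^sup>2 \<partial>mu)"
        using s by (simp add: f_def power_mult_distrib power_divide)
      also have "\<dots> \<le> 1 / n\<^sup>2 * (\<integral>y. ((cmod y)\<^sup>2 - 1)\<^sup>2 \<partial>mu)"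
        using c[OF a] by (intro mult_right_mono divide_right_mono) (auto simp: abs_square_le_1)
      also have "\<dots> \<le> 1 / n\<^sup>2 * \<kappa>" using var by (intro mult_left_mono) auto
      finally show "(\<integral>y. (f s a y)\<^sup>2 \<partial>mu) \<le> \<kappa> / n\<^sup>2" by simp
    qed
    also have "\<dots> = \<kappa> / n" using n by (simp add: n_def[symmetric] power2_eq_square)
    finally show "(\<Sum>a\<in>A. \<integral>y. (f s a y)\<^sup>2 \<partial>mu) \<le> \<kappa> / n" .
  qed
  have Bm: "?B s \<in> sets ?P" for s using A by measurable
  have "?S \<subseteq> ?B 1 \<union> ?B (-1)"
  proof
    fix x assume x: "x \<in> ?S"
    let ?z = "\<Sum>a\<in>A. c a * ((cmod (x a))\<^sup>2 - 1)"
    have sum: "(\<Sum>a\<in>A. f s a (x a)) = s * ?z / n" for s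
      by (simp add: f_def sum_distrib_left sum_divide_distrib mult_ac)
    have small: "\<bar>f s a (x a)\<bar> \<le> b" if a: "a \<in> A" and s: "\<bar>s\<bar> = 1" for s a
    proof -
      have "\<bar>f s a (x a)\<bar> = \<bar>c a\<bar> * \<bar>(cmod (x a))\<^sup>2 - 1\<bar> / n" using n s by (simp add: f_def abs_mult)
      also have "\<dots> \<le> 1 * ((cmod (x a))\<^sup>2 + 1) / n"
        using c[OF a] n by (intro divide_right_mono mult_mono) (auto simp: abs_if)
      also have "\<dots> \<le> b" using x a n by (simp add: divide_le_eq)
      finally show ?thesis .
    qed
    have "?z > \<epsilon> * n \<or> - ?z > \<epsilon> * n" using x by (auto simp: abs_if split: if_splits)
    then have "1 * ?z / n > \<epsilon> \<or> (-1) * ?z / n > \<epsilon>"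
      by (simp only: pos_less_divide_eq[OF n] mult_1 mult_minus1)
    then have "(\<Sum>a\<in>A. f 1 a (x a)) > \<epsilon> \<or> (\<Sum>a\<in>A. f (-1) a (x a)) > \<epsilon>" unfolding sum .
    then show "x \<in> ?B 1 \<union> ?B (-1)" using x small by auto
  qed
  then have "emeasure ?P ?S \<le> emeasure ?P (?B 1 \<union> ?B (-1))"
    by (rule emeasure_mono) (use Bm in auto)
  also have "\<dots> \<le> emeasure ?P (?B 1) + emeasure ?P (?B (-1))"
    by (intro emeasure_subadditive Bm)
  also have "\<dots> \<le> ennreal (exp (- t * \<epsilon> + t\<^sup>2 * exp (t * b) * (\<kappa> / n))) + ennreal (exp (- t * \<epsilon>
      + t\<^sup>2 * exp (t * b) * (\<kappa> / n)))"
    by (intro add_mono bound) auto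
  finally show ?thesis by (simp add: mult_2)
qed

text \<open>Markov's inequality for the fourth power with \<theta> = 1/n: since (1 + 1/n)^n \<le> 3,
  the moment is of order n^2, and division by (\<epsilon> n)^4 leaves n^(-2). The factor 12 is this
  3 times the 4 of \<open>offdiag_power4\<close>.\<close>

lemma offdiag_deviation:
  fixes A :: "'i set"
  assumes A: "finite A" "A \<noteq> {}" and C: "hermitian_contraction_on A C"
    and i4: "integrable mu (\<lambda>y. cmod y ^ 4)" and \<kappa>: "\<kappa> \<ge> 1" "(\<integral>y. cmod y ^ 4 \<partial>mu) \<le> \<kappa>"
    and \<epsilon>: "\<epsilon> > 0"
  defines "n \<equiv> real (card A)"
  shows "emeasure (PiM A (\<lambda>_. mu)) {x \<in> space (PiM A (\<lambda>_. mu)). cmod (offdiag C A x) > \<epsilon> * n}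
    \<le> ennreal (12 * \<kappa> * (256 + 48 * \<kappa>) / \<epsilon> ^ 4 / n\<^sup>2)"
proof -
  let ?P = "PiM A (\<lambda>_. mu)"
  have n: "n \<ge> 1" unfolding n_def using A by (simp add: Suc_le_eq card_gt_0_iff)
  let ?S = "{x \<in> space ?P. cmod (offdiag C A x) > \<epsilon> * n}"
  have S[measurable]: "?S \<in> sets ?P" by measurable
  have "emeasure ?P ?S = (\<integral>\<^sup>+x. indicator ?S x \<partial>?P)" by simp
  also have "\<dots> \<le> (\<integral>\<^sup>+x. ennreal (1 / (\<epsilon> * n) ^ 4) * ennreal (cmod (offdiag C A x) ^ 4) \<partial>?P)"
  proof (rule nn_integral_mono)
    fix x
    show "indicator ?S x \<le> ennreal (1 / (\<epsilon> * n) ^ 4) * ennreal (cmod (offdiag C A x) ^ 4)"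
    proof (cases "x \<in> ?S")
      case True
      then have "(\<epsilon> * n) ^ 4 \<le> cmod (offdiag C A x) ^ 4" using \<epsilon> n by (intro power_mono) auto
      moreover have "(\<epsilon> * n) ^ 4 > 0" using \<epsilon> n by simp
      ultimately have "1 \<le> 1 / (\<epsilon> * n) ^ 4 * cmod (offdiag C A x) ^ 4" by (simp add: le_divide_eq)
      then have "ennreal 1 \<le> ennreal (1 / (\<epsilon> * n) ^ 4 * cmod (offdiag C A x) ^ 4)" by (rule ennreal_leI)
      then show ?thesis using True \<epsilon> n by (simp add: ennreal_mult[symmetric])
    qed simp
  qed
  also have "\<dots> = ennreal (1 / (\<epsilon> * n) ^ 4) * (\<integral>\<^sup>+x. ennreal (cmod (offdiag C A x) ^ 4) \<partial>?P)"
    by (rule nn_integral_cmult) measurable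
  also have "\<dots> \<le> ennreal (1 / (\<epsilon> * n) ^ 4) * ennreal ((1 + 1 / n) ^ card A * (card A * ((256 / (1 / n)
      + 48 * \<kappa>) * (4 * \<kappa>))))"
    using n by (intro mult_left_mono offdiag_power4[OF i4 \<kappa> _ A(1) C]) auto
  also have "\<dots> = ennreal (1 / (\<epsilon> * n) ^ 4 * ((1 + 1 / n) ^ card A * (n * ((256 * n + 48 * \<kappa>) * (4 * \<kappa>)))))"
    using n \<epsilon> \<kappa> by (subst ennreal_mult) (auto simp: n_def)
  also have "\<dots> \<le> ennreal (12 * \<kappa> * (256 + 48 * \<kappa>) / \<epsilon> ^ 4 / n\<^sup>2)"
  proof (rule ennreal_leI)
    have "(1 + 1 / n) ^ card A \<le> exp (1 / n) ^ card A"
      using exp_ge_add_one_self[of "1 / n"] n by (intro power_mono) auto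
    also have "\<dots> = exp 1" using n by (simp add: n_def exp_of_nat_mult[symmetric])
    finally have p: "(1 + 1 / n) ^ card A \<le> 3" using exp_le by linarith
    have "(256 * n + 48 * \<kappa>) \<le> n * (256 + 48 * \<kappa>)" using n \<kappa> by (simp add: algebra_simps)
    then have "n * ((256 * n + 48 * \<kappa>) * (4 * \<kappa>)) \<le> n * (n * (256 + 48 * \<kappa>) * (4 * \<kappa>))"
      using n \<kappa> by (intro mult_left_mono mult_right_mono) auto
    then have "(1 + 1 / n) ^ card A * (n * ((256 * n + 48 * \<kappa>) * (4 * \<kappa>))) \<le> 3 * (n * (n * (256 + 48 * \<kappa>) * (4 * \<kappa>)))"
      using p n \<kappa> by (intro mult_mono) auto
    then have "1 / (\<epsilon> * n) ^ 4 * ((1 + 1 / n) ^ card A * (n * ((256 * n + 48 * \<kappa>) * (4 * \<kappa>))))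
        \<le> 1 / (\<epsilon> * n) ^ 4 * (3 * (n * (n * (256 + 48 * \<kappa>) * (4 * \<kappa>))))"
      using n \<epsilon> by (intro mult_left_mono) auto
    also have "\<dots> = 12 * \<kappa> * (256 + 48 * \<kappa>) / \<epsilon> ^ 4 / n\<^sup>2"
      using n \<epsilon> by (simp add: power_mult_distrib power4_eq_xxxx power2_eq_square field_simps)
    finally show "1 / (\<epsilon> * n) ^ 4 * ((1 + 1 / n) ^ card A * (n * ((256 * n + 48 * \<kappa>) * (4 * \<kappa>))))
      \<le> 12 * \<kappa> * (256 + 48 * \<kappa>) / \<epsilon> ^ 4 / n\<^sup>2" .
  qed
  finally show ?thesis .
qed

end

section \<open>The resolvent of a random channel\<close>

lemma resolvent_list_measurable:
  assumes "\<And>k a. k \<in> set ks \<Longrightarrow> a < N \<Longrightarrow> (\<lambda>w. X w k a) \<in> borel_measurable M"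
    and "\<And>a. a < N \<Longrightarrow> (\<lambda>w. v w a) \<in> borel_measurable M" and "a < N"
  shows "(\<lambda>w. resolvent_list N g (X w) ks (v w) a) \<in> borel_measurable M"
  using assms
proof (induction ks arbitrary: v a)
  case Nil
  then show ?case by simp
next
  case (Cons k ks)
  have X[measurable]: "(\<lambda>w. X w k a) \<in> borel_measurable M" if "a < N" for a
    using Cons.prems(1)[of k a] that by simp
  have v[measurable]: "(\<lambda>w. resolvent_list N g (X w) ks (v w) a) \<in> borel_measurable M" if "a < N" for a
    using Cons.prems that by (intro Cons.IH) auto
  have h[measurable]: "(\<lambda>w. resolvent_list N g (X w) ks (X w k) a) \<in> borel_measurable M" if "a < N" for a
    using Cons.prems that by (intro Cons.IH) auto
  have [measurable]: "(\<lambda>w. ip N (X w k) (resolvent_list N g (X w) ks (X w k))) \<in> borel_measurable M"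
    "(\<lambda>w. ip N (X w k) (resolvent_list N g (X w) ks (v w))) \<in> borel_measurable M"
    unfolding ip_def by measurable
  show ?case unfolding resolvent_list.simps rank1_update_def using Cons.prems(3) by measurable
qed

lemma resolvent_measurable:
  assumes "finite J" "\<And>k a. k \<in> J \<Longrightarrow> a < N \<Longrightarrow> (\<lambda>w. X w k a) \<in> borel_measurable M"
    and "\<And>a. a < N \<Longrightarrow> (\<lambda>w. v w a) \<in> borel_measurable M" and "a < N"
  shows "(\<lambda>w. resolvent N g (X w) J (v w) a) \<in> borel_measurable M"
  unfolding resolvent_def by (rule resolvent_list_measurable) (simp_all add: assms)

lemma ip_resolvent_measurable:
  assumes "finite J" "\<And>k a. k \<in> J \<Longrightarrow> a < N \<Longrightarrow> (\<lambda>w. X w k a) \<in> borel_measurable M"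
    and u: "\<And>a. a < N \<Longrightarrow> (\<lambda>w. u w a) \<in> borel_measurable M"
    and v: "\<And>a. a < N \<Longrightarrow> (\<lambda>w. v w a) \<in> borel_measurable M"
  shows "(\<lambda>w. ip N (u w) (resolvent N g (X w) J (v w))) \<in> borel_measurable M"
proof -
  note [measurable] = u resolvent_measurable[of J N X M v, OF assms(1,2) v]
  show ?thesis unfolding ip_def by measurable
qed

lemma res_trace_measurable:
  assumes "finite J" "\<And>k a. k \<in> J \<Longrightarrow> a < N \<Longrightarrow> (\<lambda>w. X w k a) \<in> borel_measurable M"
  shows "(\<lambda>w. res_trace N g (X w) J) \<in> borel_measurable M"
proof -
  have [measurable]: "(\<lambda>w. resolvent N g (X w) J (unitv b) a) \<in> borel_measurable M" if "a < N" for a b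
    by (rule resolvent_measurable[OF assms _ that]) auto
  show ?thesis unfolding res_trace_def res_entry_def by measurable
qed

section \<open>Normalized forms and traces of the channel\<close>

definition channel_columns :: "(nat \<times> nat \<Rightarrow> complex) \<Rightarrow> nat \<Rightarrow> nat \<Rightarrow> complex" where
  "channel_columns x k a = x (a, k)"

text \<open>\<open>J\<close> is the set of columns inside the resolvent. For \<open>J\<close> the
  complement of a pair, \<gamma> times \<open>quad\<close> is a diagonal entry of the pair matrix
  and \<gamma> times \<open>cross\<close> the modulus of its off-diagonal entry.\<close>

definition quad :: "nat \<Rightarrow> real \<Rightarrow> nat set \<Rightarrow> nat \<Rightarrow> (nat \<times> nat \<Rightarrow> complex) \<Rightarrow> real" where
  "quad N \<gamma> J i x = Re (ip N (channel_columns x i) (resolvent N (\<gamma>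
      / real N) (channel_columns x) J (channel_columns x i))) / real N"

definition cross :: "nat \<Rightarrow> real \<Rightarrow> nat set \<Rightarrow> nat \<Rightarrow> nat \<Rightarrow> (nat \<times> nat \<Rightarrow> complex) \<Rightarrow> real" where
  "cross N \<gamma> J i j x = cmod (ip N (channel_columns x i) (resolvent N (\<gamma>
      / real N) (channel_columns x) J (channel_columns x j))) / real N"

definition ntrace :: "nat \<Rightarrow> real \<Rightarrow> nat set \<Rightarrow> (nat \<times> nat \<Rightarrow> complex) \<Rightarrow> real" where
  "ntrace N \<gamma> J x = res_trace N (\<gamma> / real N) (channel_columns x) J / real N"

context
  fixes N :: nat and \<gamma> :: real
  assumes N: "N > 0" and \<gamma>: "\<gamma> > 0"
begin

lemma gN: "\<gamma> / real N \<ge> 0" using N \<gamma> by simp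

lemma ntrace_bounds:
  assumes "finite J"
  shows "0 \<le> ntrace N \<gamma> J x"
  unfolding ntrace_def res_trace_def
  using res_entry_diag(2)[OF gN assms] by (intro divide_nonneg_nonneg sum_nonneg) auto

lemma quad_nonneg:
  assumes "finite J"
  shows "0 \<le> quad N \<gamma> J i x"
  unfolding quad_def
  using nrm2_resolvent_le_form[OF gN assms] nrm2_nonneg order_trans
  by (intro divide_nonneg_nonneg) (blast, simp)

lemma ntrace_insert:
  assumes "finite J" "k \<notin> J"
  shows "\<bar>ntrace N \<gamma> (insert k J) x - ntrace N \<gamma> J x\<bar> \<le> 1 / real N"
proof -
  have "\<bar>ntrace N \<gamma> (insert k J) x - ntrace N \<gamma> J x\<bar>
      = \<bar>res_trace N (\<gamma> / real N) (channel_columns x) (insert k J)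
          - res_trace N (\<gamma> / real N) (channel_columns x) J\<bar> / real N"
    unfolding ntrace_def by (simp add: abs_divide flip: diff_divide_distrib)
  also have "\<dots> \<le> 1 / real N"
    using res_trace_update_bound[OF gN assms] by (intro divide_right_mono) auto
  finally show ?thesis .
qed

lemma ntrace_identity:
  assumes "finite J"
  shows "1 = ntrace N \<gamma> J x + (\<Sum>k\<in>J. \<gamma> * quad N \<gamma> (J - {k}) k x / (1 + \<gamma> * quad N \<gamma> (J - {k}) k x)) / real N"
proof -
  have "real N / real N = (res_trace N (\<gamma> / real N) (channel_columns x) J
      + (\<Sum>k\<in>J. \<gamma> * quad N \<gamma> (J - {k}) k x / (1 + \<gamma> * quad N \<gamma> (J - {k}) k x))) / real N"
    by (subst (1) res_trace_identity[OF gN assms, where x = "channel_columns x"]) (simp add: quad_def)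
  then show ?thesis using N by (simp add: ntrace_def add_divide_distrib)
qed

lemma quad_insert:
  assumes "finite J" "k \<notin> J"
  shows "\<bar>quad N \<gamma> (insert k J) i x - quad N \<gamma> J i x\<bar> \<le> \<gamma> * (cross N \<gamma> J i k x)\<^sup>2"
proof -
  let ?q = "\<lambda>J. Re (ip N (channel_columns x i) (resolvent N (\<gamma> / real N) (channel_columns x) J (channel_columns
      x i)))"
  have "\<bar>quad N \<gamma> (insert k J) i x - quad N \<gamma> J i x\<bar> = \<bar>?q (insert k J) - ?q J\<bar> / real N"
    unfolding quad_def by (simp add: abs_divide flip: diff_divide_distrib)
  also have "\<dots> \<le> \<gamma> / real N * (cmod (ip N (channel_columns x i) (resolvent N (\<gamma>
      / real N) (channel_columns x) J (channel_columns x k))))\<^sup>2 / real N"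
    using form_update_diff[OF gN assms] by (intro divide_right_mono) auto
  also have "\<dots> = \<gamma> * (cross N \<gamma> J i k x)\<^sup>2"
    by (simp add: cross_def power2_eq_square)
  finally show ?thesis .
qed

text \<open>The map \<open>s \<mapsto> s + \<alpha> \<gamma> s / (1 + \<gamma> s)\<close> expands distances, so the trace
  identity pins down \<open>s\<close>.\<close>

lemma ntrace_near_fixpoint:
  assumes t: "t \<ge> 0" "1 = t + real K / real N * (\<gamma> * t / (1 + \<gamma> * t))"
  shows "\<bar>ntrace N \<gamma> {..<K} x - t\<bar>
    \<le> \<gamma> / real N * (\<Sum>k<K. \<bar>quad N \<gamma> ({..<K} - {k}) k x - ntrace N \<gamma> ({..<K} - {k}) x\<bar>) + \<gamma> * real K / (real N)\<^sup>2"
proof -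
  define \<phi> where "\<phi> y = \<gamma> * y / (1 + \<gamma> * y)" for y
  define s where "s = ntrace N \<gamma> {..<K} x"
  define q where "q k = quad N \<gamma> ({..<K} - {k}) k x" for k
  define s' where "s' k = ntrace N \<gamma> ({..<K} - {k}) x" for k
  have s0: "s \<ge> 0" and q0: "q k \<ge> 0" for k
    unfolding s_def q_def by (rule ntrace_bounds quad_nonneg, simp)+
  have \<phi>d: "\<phi> y - \<phi> z = \<gamma> * (y - z) / ((1 + \<gamma> * y) * (1 + \<gamma> * z))" if "y \<ge> 0" "z \<ge> 0" for y z
  proof -
    have "1 + \<gamma> * y > 0" "1 + \<gamma> * z > 0" using that \<gamma> by (simp_all add: add_pos_nonneg)
    then show ?thesis unfolding \<phi>_def by (simp add: field_simps)
  qed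
  have \<phi>lip: "\<bar>\<phi> y - \<phi> z\<bar> \<le> \<gamma> * \<bar>y - z\<bar>" if "y \<ge> 0" "z \<ge> 0" for y z
  proof -
    have "1 * 1 \<le> (1 + \<gamma> * y) * (1 + \<gamma> * z)" using that \<gamma> by (intro mult_mono) auto
    then have P: "(1 + \<gamma> * y) * (1 + \<gamma> * z) \<ge> 1" by simp
    then have "\<bar>\<phi> y - \<phi> z\<bar> = \<gamma> * \<bar>y - z\<bar> / ((1 + \<gamma> * y) * (1 + \<gamma> * z))"
      unfolding \<phi>d[OF that] abs_divide abs_mult[of \<gamma>] using \<gamma> by simp
    also have "\<dots> \<le> \<gamma> * \<bar>y - z\<bar> / 1"
      using P \<gamma> by (intro divide_left_mono) auto
    finally show ?thesis by simp
  qed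
  \<comment> \<open>\<phi> is increasing, so adding r (\<phi> s - \<phi> t) multiplies s - t by a
    factor 1 + d with d \<ge> 0.\<close>
  have mono: "\<bar>s - t\<bar> \<le> \<bar>(s - t) + r * (\<phi> s - \<phi> t)\<bar>" if "r \<ge> 0" for r
  proof -
    define d where "d = r * \<gamma> / ((1 + \<gamma> * s) * (1 + \<gamma> * t))"
    have "d \<ge> 0" unfolding d_def using that \<gamma> s0 t by (intro divide_nonneg_nonneg mult_nonneg_nonneg) auto
    have e: "(s - t) + r * (\<phi> s - \<phi> t) = (s - t) * (1 + d)"
      unfolding \<phi>d[OF s0 t(1)] d_def by (simp add: algebra_simps)
    have "\<bar>s - t\<bar> * 1 \<le> \<bar>s - t\<bar> * (1 + d)" using \<open>d \<ge> 0\<close> by (intro mult_left_mono) auto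
    then show ?thesis unfolding e abs_mult using \<open>d \<ge> 0\<close> by simp
  qed
  have "1 = s + (\<Sum>k<K. \<phi> (q k)) / real N"
    using ntrace_identity[of "{..<K}" x] by (simp add: s_def q_def \<phi>_def)
  moreover have "1 = t + real K / real N * \<phi> t" using t(2) by (simp add: \<phi>_def)
  ultimately have "(s - t) + real K / real N * (\<phi> s - \<phi> t) = real K / real N * \<phi> s - (\<Sum>k<K. \<phi> (q k)) / real N"
    unfolding right_diff_distrib by linarith
  also have "\<dots> = (\<Sum>k<K. \<phi> s - \<phi> (q k)) / real N"
    by (simp add: sum_subtractf diff_divide_distrib)
  finally have "\<bar>s - t\<bar> \<le> \<bar>(\<Sum>k<K. \<phi> s - \<phi> (q k)) / real N\<bar>"
    using mono[of "real K / real N"] by simp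
  also have "\<dots> \<le> (\<Sum>k<K. \<bar>\<phi> s - \<phi> (q k)\<bar>) / real N"
    unfolding abs_divide by (simp add: divide_right_mono)
  also have "\<dots> \<le> (\<Sum>k<K. \<gamma> * (\<bar>q k - s' k\<bar> + 1 / real N)) / real N"
  proof (intro divide_right_mono sum_mono)
    fix k assume k: "k \<in> {..<K}"
    \<comment> \<open>\<open>q k\<close> is to be compared with the trace that also leaves column k
      out. Passing to the full trace costs 1/N, which summed over k gives the term \<gamma> K /
      N^2.\<close>
    have "insert k ({..<K} - {k}) = {..<K}" using k by auto
    then have "\<bar>s - s' k\<bar> \<le> 1 / real N"
      using ntrace_insert[of "{..<K} - {k}" k x] by (simp add: s_def s'_def)
    then have "\<bar>s - q k\<bar> \<le> \<bar>q k - s' k\<bar> + 1 / real N" by linarith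
    then have "\<gamma> * \<bar>s - q k\<bar> \<le> \<gamma> * (\<bar>q k - s' k\<bar> + 1 / real N)" using \<gamma> by (intro mult_left_mono) auto
    then show "\<bar>\<phi> s - \<phi> (q k)\<bar> \<le> \<gamma> * (\<bar>q k - s' k\<bar> + 1 / real N)"
      using \<phi>lip[OF s0 q0, of k] by linarith
  qed simp
  also have "\<dots> = \<gamma> / real N * (\<Sum>k<K. \<bar>q k - s' k\<bar>) + \<gamma> * real K / (real N)\<^sup>2"
    by (simp add: sum_distrib_left[symmetric] sum.distrib power2_eq_square distrib_left add_divide_distrib)
  finally show ?thesis by (simp add: s_def q_def s'_def)
qed

end

lemma ennreal_affine:
  assumes "0 \<le> a" "0 \<le> b" "0 \<le> c"
  shows "ennreal (a * b + c) = ennreal a * ennreal b + ennreal c"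
  using assms by (simp add: ennreal_mult)

abbreviation grid :: "nat \<Rightarrow> nat set \<Rightarrow> (nat \<times> nat) set" where
  "grid N J \<equiv> {..<N} \<times> J"

lemma quad_measurable:
  assumes "\<And>k a. k \<in> insert i J \<Longrightarrow> a < N \<Longrightarrow> (\<lambda>w. X w (a, k)) \<in> borel_measurable M" "finite J"
  shows "(\<lambda>w. quad N \<gamma> J i (X w)) \<in> borel_measurable M"
proof -
  have [measurable]: "(\<lambda>w. ip N (channel_columns (X w) i) (resolvent N (\<gamma> / real N) (channel_columns (X w)) J
      (channel_columns (X w) i))) \<in> borel_measurable M"
    by (rule ip_resolvent_measurable) (use assms in \<open>auto simp: channel_columns_def\<close>)
  show ?thesis unfolding quad_def by measurable
qed

lemma cross_measurable:
  assumes "\<And>k a. k \<in> insert i (insert j J) \<Longrightarrow> a < N \<Longrightarrow> (\<lambda>w. X w (a, k)) \<in> borel_measurable M" "finite J"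
  shows "(\<lambda>w. cross N \<gamma> J i j (X w)) \<in> borel_measurable M"
proof -
  have [measurable]: "(\<lambda>w. ip N (channel_columns (X w) i) (resolvent N (\<gamma> / real N) (channel_columns (X w)) J
      (channel_columns (X w) j))) \<in> borel_measurable M"
    by (rule ip_resolvent_measurable) (use assms in \<open>auto simp: channel_columns_def\<close>)
  show ?thesis unfolding cross_def by measurable
qed

lemma ntrace_measurable:
  assumes "\<And>k a. k \<in> J \<Longrightarrow> a < N \<Longrightarrow> (\<lambda>w. X w (a, k)) \<in> borel_measurable M" "finite J"
  shows "(\<lambda>w. ntrace N \<gamma> J (X w)) \<in> borel_measurable M"
proof -
  have [measurable]: "(\<lambda>w. res_trace N (\<gamma> / real N) (channel_columns (X w)) J) \<in> borel_measurable M"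
    by (rule res_trace_measurable) (use assms in \<open>auto simp: channel_columns_def\<close>)
  show ?thesis unfolding ntrace_def by measurable
qed

lemma sum_grid_column: "(\<Sum>p\<in>grid N {i}. f p) = (\<Sum>a<N. f (a, i))"
  by (rule sum.reindex_bij_witness[of _ "\<lambda>a. (a, i)" fst]) auto

text \<open>The resolvent as a matrix indexed by the positions (a, i) of one column, the index set
  of the product factor that is integrated out; the column index is ignored.\<close>

definition column_matrix :: "nat \<Rightarrow> real \<Rightarrow> nat set \<Rightarrow> (nat \<times> nat \<Rightarrow> complex) \<Rightarrow> nat \<times> nat \<Rightarrow> nat \<times> nat \<Rightarrow> complex" where
  "column_matrix N \<gamma> J z p q = res_entry N (\<gamma> / real N) (channel_columns z) J (fst p) (fst q)"

lemma column_matrix_contraction: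
  assumes "N > 0" "\<gamma> > 0" "finite J"
  shows "hermitian_contraction_on (grid N {i}) (column_matrix N \<gamma> J z)"
  unfolding hermitian_contraction_on_def column_matrix_def sum_grid_column fst_conv
proof (intro conjI ballI)
  fix p q assume "p \<in> grid N {i}" "q \<in> grid N {i}"
  then have "fst p < N" "fst q < N" by auto
  then show "res_entry N (\<gamma> / real N) (channel_columns z) J (fst p) (fst q)
      = cnj (res_entry N (\<gamma> / real N) (channel_columns z) J (fst q) (fst p))"
    by (rule res_entry_cnj[OF gN[OF assms(1,2)] assms(3)])
next
  fix p assume "p \<in> grid N {i}"
  then have "fst p < N" by auto
  then show "(\<Sum>a<N. (cmod (res_entry N (\<gamma> / real N) (channel_columns z) J (fst p) a))\<^sup>2) \<le> 1"
    by (rule res_entry_diag(5)[OF gN[OF assms(1,2)] assms(3)])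
qed

lemma column_matrix_trace:
  "(\<Sum>p\<in>grid N {i}. Re (column_matrix N \<gamma> J z p p)) = real N * ntrace N \<gamma> J z" if "N > 0"
  unfolding sum_grid_column column_matrix_def ntrace_def res_trace_def using that by simp

text \<open>Equality holds at every coordinate, also outside the grid, since points of a product
  space take the value \<open>undefined\<close> there, and so does \<open>merge\<close>.
  \<open>resolvent_cong\<close> asks for this full equality.\<close>

lemma merge_columns:
  assumes z: "z \<in> space (PiM (grid N ({..<K} - {i})) (\<lambda>_. M))" and k: "k < K" "k \<noteq> i"
  shows "channel_columns (merge (grid N ({..<K} - {i})) (grid N {i}) (z, y)) k = channel_columns z k"
proof
  fix a
  show "channel_columns (merge (grid N ({..<K} - {i})) (grid N {i}) (z, y)) k a = channel_columns z k a"
    using z k by (auto simp: channel_columns_def merge_def space_PiM PiE_def extensional_def)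
qed

lemma merge_column_self:
  assumes "a < N"
  shows "channel_columns (merge (grid N ({..<K} - {i})) (grid N {i}) (z, y)) i a = y (a, i)"
  using assms by (auto simp: channel_columns_def merge_def)

context
  fixes N :: nat and \<gamma> :: real and K i :: nat and J :: "nat set" and M :: "complex measure"
    and z y :: "nat \<times> nat \<Rightarrow> complex"
  assumes N: "N > 0" and \<gamma>: "\<gamma> > 0" and J: "J \<subseteq> {..<K} - {i}"
    and z: "z \<in> space (PiM (grid N ({..<K} - {i})) (\<lambda>_. M))"
begin

private lemma fJ: "finite J" using J finite_subset by blast

private abbreviation "x \<equiv> merge (grid N ({..<K} - {i})) (grid N {i}) (z, y)"

text \<open>With the other columns frozen at \<open>z\<close>, the resolvent does not see the fresh
  column \<open>y\<close>; this is how independence enters.\<close>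

lemma merge_resolvent: "resolvent N g (channel_columns x) J = resolvent N g (channel_columns z) J"
  by (rule resolvent_cong[OF fJ]) (use J merge_columns[OF z] in auto)

lemma merge_ntrace: "ntrace N \<gamma> J x = ntrace N \<gamma> J z"
  unfolding ntrace_def res_trace_def res_entry_def merge_resolvent ..

lemma merge_quad: "real N * quad N \<gamma> J i x = Re (qform (column_matrix N \<gamma> J z) (grid N {i}) y)"
proof -
  have "qform (column_matrix N \<gamma> J z) (grid N {i}) y
      = (\<Sum>a<N. cnj (y (a, i)) * (\<Sum>b<N. res_entry N (\<gamma> / real N) (channel_columns z) J a b * y (b, i)))"
    unfolding qform_def sum_grid_column column_matrix_def by (simp add: sum_distrib_left mult.assoc)
  also have "\<dots> = (\<Sum>a<N. cnj (channel_columns x i a) * resolvent N (\<gamma>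
      / real N) (channel_columns z) J (channel_columns x i) a)"
    using resolvent_apply[OF gN[OF N \<gamma>] fJ] by (intro sum.cong) (auto simp: merge_column_self)
  also have "\<dots> = ip N (channel_columns x i) (resolvent N (\<gamma> / real N) (channel_columns x) J (channel_columns x i))"
    unfolding merge_resolvent ip_def ..
  finally show ?thesis using N by (simp add: quad_def)
qed

lemma merge_cross:
  assumes j: "j < K" "j \<noteq> i"
  shows "real N * cross N \<gamma> J i j x
    = cmod (\<Sum>p\<in>grid N {i}. cnj (y p) * resolvent N (\<gamma> / real N) (channel_columns z) J (channel_columns z j) (fst p))"
proof -
  have "ip N (channel_columns x i) (resolvent N (\<gamma> / real N) (channel_columns x) J (channel_columns x j))
      = (\<Sum>p\<in>grid N {i}. cnj (y p) * resolvent N (\<gamma> / real N) (channel_columns z) J (channel_columns z j) (fst p))"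
    unfolding merge_resolvent merge_columns[OF z j] ip_def sum_grid_column
    by (intro sum.cong) (auto simp: merge_column_self)
  then show ?thesis using N by (simp add: cross_def)
qed

end

section \<open>Integration over one column with the others fixed\<close>

context unit_law
begin

lemma prob_space_grid: "prob_space (PiM (grid N J) (\<lambda>_. mu))"
  by (rule prob_space_PiM_const)

lemma grid_component:
  "k \<in> J \<Longrightarrow> a < N \<Longrightarrow> (\<lambda>x. x (a, k)) \<in> borel_measurable (PiM (grid N J) (\<lambda>_. mu))"
  using measurable_component_singleton[of "(a, k)" "grid N J" "\<lambda>_. mu"]
  by (simp add: measurable_cong_sets[OF refl sets_mu])

lemma grid_nn_integral_fold:
  assumes i: "i < K" and F: "F \<in> borel_measurable (PiM (grid N {..<K}) (\<lambda>_. mu))"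
  shows "(\<integral>\<^sup>+x. F x \<partial>PiM (grid N {..<K}) (\<lambda>_. mu))
    = (\<integral>\<^sup>+z. (\<integral>\<^sup>+y. F (merge (grid N ({..<K} - {i})) (grid N {i}) (z, y)) \<partial>PiM (grid N {i}) (\<lambda>_. mu))
        \<partial>PiM (grid N ({..<K} - {i})) (\<lambda>_. mu))"
proof -
  interpret P: product_prob_space "\<lambda>_::nat \<times> nat. mu" by (rule product_prob_space_const)
  have g: "grid N ({..<K} - {i}) \<union> grid N {i} = grid N {..<K}" using i by auto
  show ?thesis
    using P.product_nn_integral_fold[of "grid N ({..<K} - {i})" "grid N {i}" F] F unfolding g by auto
qed

lemma grid_nn_integral_le:
  assumes i: "i < K" and F: "F \<in> borel_measurable (PiM (grid N {..<K}) (\<lambda>_. mu))"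
    and le: "\<And>z. z \<in> space (PiM (grid N ({..<K} - {i})) (\<lambda>_. mu)) \<Longrightarrow>
      (\<integral>\<^sup>+y. F (merge (grid N ({..<K} - {i})) (grid N {i}) (z, y)) \<partial>PiM (grid N {i}) (\<lambda>_. mu)) \<le> c"
  shows "(\<integral>\<^sup>+x. F x \<partial>PiM (grid N {..<K}) (\<lambda>_. mu)) \<le> c"
proof -
  interpret P: prob_space "PiM (grid N ({..<K} - {i})) (\<lambda>_. mu)" by (rule prob_space_grid)
  have "(\<integral>\<^sup>+x. F x \<partial>PiM (grid N {..<K}) (\<lambda>_. mu)) \<le> (\<integral>\<^sup>+z. c \<partial>PiM (grid N ({..<K} - {i})) (\<lambda>_. mu))"
    unfolding grid_nn_integral_fold[OF i F] by (rule nn_integral_mono) (rule le)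
  then show ?thesis by (simp add: P.emeasure_space_1)
qed

text \<open>Each section of \<open>E\<close> is merely covered by a measurable \<open>D\<close>,
  chosen separately for each \<open>z\<close>, so that deviation bounds for a fixed coefficient
  matrix apply with their own exceptional sets.\<close>

lemma grid_emeasure_le:
  assumes i: "i < K" and E: "E \<in> sets (PiM (grid N {..<K}) (\<lambda>_. mu))"
    and le: "\<And>z. z \<in> space (PiM (grid N ({..<K} - {i})) (\<lambda>_. mu)) \<Longrightarrow>
      \<exists>D \<in> sets (PiM (grid N {i}) (\<lambda>_. mu)).
        (\<forall>y \<in> space (PiM (grid N {i}) (\<lambda>_. mu)). merge (grid N ({..<K} - {i})) (grid N {i}) (z, y) \<in> E \<longrightarrow> y \<in> D)
        \<and> emeasure (PiM (grid N {i}) (\<lambda>_. mu)) D \<le> c"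
  shows "emeasure (PiM (grid N {..<K}) (\<lambda>_. mu)) E \<le> c"
proof -
  have "(\<integral>\<^sup>+x. indicator E x \<partial>PiM (grid N {..<K}) (\<lambda>_. mu)) \<le> c"
  proof (rule grid_nn_integral_le[OF i])
    show "indicator E \<in> borel_measurable (PiM (grid N {..<K}) (\<lambda>_. mu))" using E by simp
    fix z assume "z \<in> space (PiM (grid N ({..<K} - {i})) (\<lambda>_. mu))"
    from le[OF this] obtain D where D: "D \<in> sets (PiM (grid N {i}) (\<lambda>_. mu))"
      "\<And>y. y \<in> space (PiM (grid N {i}) (\<lambda>_. mu)) \<Longrightarrow> merge (grid N ({..<K} - {i})) (grid N {i}) (z, y) \<in> E \<Longrightarrow> y \<in> D"
      "emeasure (PiM (grid N {i}) (\<lambda>_. mu)) D \<le> c" by auto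
    have "(\<integral>\<^sup>+y. indicator E (merge (grid N ({..<K} - {i})) (grid N {i}) (z, y)) \<partial>PiM (grid N {i}) (\<lambda>_. mu))
        \<le> (\<integral>\<^sup>+y. indicator D y \<partial>PiM (grid N {i}) (\<lambda>_. mu))"
      using D(2) by (intro nn_integral_mono) (auto simp: indicator_def)
    then show "(\<integral>\<^sup>+y. indicator E (merge (grid N ({..<K} - {i})) (grid N {i}) (z, y)) \<partial>PiM (grid N {i}) (\<lambda>_. mu)) \<le> c"
      using D(1,3) by simp
  qed
  then show ?thesis using E by simp
qed

text \<open>For fixed other columns, N times \<open>quad\<close> is the real part of a quadratic
  form in the fresh column, with a fixed matrix of bounded rows whose trace is N times
  \<open>ntrace\<close>; \<open>qform_L1\<close> divided by N is the claim.\<close>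

lemma quad_L1:
  fixes \<eta> :: real
  assumes N: "N > 0" and \<gamma>: "\<gamma> > 0" and i: "i < K" and J: "J \<subseteq> {..<K} - {i}"
    and \<tau>: "\<tau> \<ge> 0" and \<eta>: "(\<integral>z. (cmod z)\<^sup>2 * indicator {z. (cmod z)\<^sup>2 > \<tau>} z \<partial>mu) \<le> \<eta>"
  shows "(\<integral>\<^sup>+x. ennreal \<bar>quad N \<gamma> J i x - ntrace N \<gamma> J x\<bar> \<partial>PiM (grid N {..<K}) (\<lambda>_. mu))
    \<le> ennreal ((3 + \<tau>) / sqrt N + 2 * \<eta>)"
proof (rule grid_nn_integral_le[OF i])
  have fJ: "finite J" using J finite_subset by blast
  have [measurable]: "(\<lambda>x. quad N \<gamma> J i x) \<in> borel_measurable (PiM (grid N {..<K}) (\<lambda>_. mu))"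
    "(\<lambda>x. ntrace N \<gamma> J x) \<in> borel_measurable (PiM (grid N {..<K}) (\<lambda>_. mu))"
    using i J fJ by (auto intro!: quad_measurable ntrace_measurable grid_component)
  show "(\<lambda>x. ennreal \<bar>quad N \<gamma> J i x - ntrace N \<gamma> J x\<bar>) \<in> borel_measurable (PiM (grid N {..<K}) (\<lambda>_. mu))"
    by measurable
  fix z assume z: "z \<in> space (PiM (grid N ({..<K} - {i})) (\<lambda>_. mu))"
  let ?C = "column_matrix N \<gamma> J z" and ?A = "grid N {i}"
  let ?m = "\<lambda>y. merge (grid N ({..<K} - {i})) ?A (z, y)"
  have C: "hermitian_contraction_on ?A ?C" by (rule column_matrix_contraction[OF N \<gamma> fJ])
  have cA: "card ?A = N" by simp
  have e: "ennreal \<bar>quad N \<gamma> J i (?m y) - ntrace N \<gamma> J (?m y)\<bar>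
      = ennreal (1 / real N) * ennreal \<bar>Re (qform ?C ?A y) - (\<Sum>p\<in>?A. Re (?C p p))\<bar>" for y
  proof -
    have "quad N \<gamma> J i (?m y) - ntrace N \<gamma> J (?m y) = 1 / real N * (Re (qform ?C ?A y) - (\<Sum>p\<in>?A. Re (?C p p)))"
      unfolding merge_quad[OF N \<gamma> J z, symmetric] column_matrix_trace[OF N] merge_ntrace[OF N \<gamma> J z]
      using N by (simp add: field_simps)
    then show ?thesis using N by (simp add: abs_mult ennreal_mult[symmetric])
  qed
  have qm: "(\<lambda>y. qform ?C ?A y) \<in> borel_measurable (PiM ?A (\<lambda>_. mu))"
    unfolding qform_def by (intro borel_measurable_sum) measurable
  have "(\<integral>\<^sup>+y. ennreal \<bar>quad N \<gamma> J i (?m y) - ntrace N \<gamma> J (?m y)\<bar> \<partial>PiM ?A (\<lambda>_. mu))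
      = ennreal (1 / real N) * (\<integral>\<^sup>+y. ennreal \<bar>Re (qform ?C ?A y) - (\<Sum>p\<in>?A. Re (?C p p))\<bar> \<partial>PiM ?A (\<lambda>_. mu))"
    unfolding e
    by (rule nn_integral_cmult, rule measurable_compose[OF qm, where g = "\<lambda>w. ennreal \<bar>Re w - _\<bar>"]) measurable
  also have "\<dots> \<le> ennreal (1 / real N) * ennreal (sqrt (real (card ?A)) * (3 + \<tau>) + 2 * real (card ?A) * \<eta>)"
    by (intro mult_left_mono qform_L1[OF _ _ C \<tau> \<eta>]) (use N in auto)
  also have "\<dots> = ennreal (1 / real N * (sqrt (real N) * (3 + \<tau>) + 2 * real N * \<eta>))"
    unfolding cA by (rule ennreal_mult'[symmetric]) simp
  also have "1 / real N * (sqrt (real N) * (3 + \<tau>) + 2 * real N * \<eta>) = (3 + \<tau>) / sqrt N + 2 * \<eta>"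
  proof -
    have "1 / real N * sqrt (real N) = 1 / sqrt (real N)"
      using N by (simp add: field_simps)
    then have "1 / real N * (sqrt (real N) * (3 + \<tau>)) = 1 / sqrt (real N) * (3 + \<tau>)"
      by (simp only: mult.assoc[symmetric])
    moreover have "1 / real N * (2 * real N * \<eta>) = 2 * \<eta>" using N by simp
    ultimately show ?thesis unfolding distrib_left[of "1 / real N"] by (simp add: add_divide_distrib)
  qed
  finally show "(\<integral>\<^sup>+y. ennreal \<bar>quad N \<gamma> J i (?m y) - ntrace N \<gamma> J (?m y)\<bar> \<partial>PiM ?A (\<lambda>_. mu))
    \<le> ennreal ((3 + \<tau>) / sqrt N + 2 * \<eta>)" .
qed

text \<open>The truncation level comes first and makes the tail term 2 (e/4) = e/2; only then is
  \<open>N\<close> taken large enough for the remaining term.\<close>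

lemma quad_L1_small:
  assumes \<gamma>: "\<gamma> > 0" and e: "e > 0"
  shows "\<exists>N0>0. \<forall>N\<ge>N0. \<forall>(K::nat) i J. i < K \<longrightarrow> J \<subseteq> {..<K} - {i} \<longrightarrow>
    (\<integral>\<^sup>+x. ennreal \<bar>quad N \<gamma> J i x - ntrace N \<gamma> J x\<bar> \<partial>PiM (grid N {..<K}) (\<lambda>_. mu)) \<le> ennreal e"
proof -
  from tail_second_moment[of "e / 4"] e obtain \<tau> where \<tau>: "\<tau> \<ge> 0"
    "(\<integral>z. (cmod z)\<^sup>2 * indicator {z. (cmod z)\<^sup>2 > \<tau>} z \<partial>mu) \<le> e / 4" by auto
  have "((\<lambda>N. (3 + \<tau>) / sqrt (real N)) \<longlongrightarrow> 0) sequentially" by real_asymp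
  then have "\<forall>\<^sub>F N in sequentially. (3 + \<tau>) / sqrt (real N) < e / 2"
    using e by (intro order_tendstoD(2)) auto
  then obtain N1 where N1: "\<And>N. N \<ge> N1 \<Longrightarrow> (3 + \<tau>) / sqrt (real N) < e / 2"
    by (auto simp: eventually_sequentially)
  show ?thesis
  proof (intro exI[of _ "Suc N1"] conjI allI impI)
    fix N K :: nat and i J assume a: "Suc N1 \<le> N" "i < K" "J \<subseteq> {..<K} - {i}"
    have "(\<integral>\<^sup>+x. ennreal \<bar>quad N \<gamma> J i x - ntrace N \<gamma> J x\<bar> \<partial>PiM (grid N {..<K}) (\<lambda>_. mu))
        \<le> ennreal ((3 + \<tau>) / sqrt N + 2 * (e / 4))"
      by (rule quad_L1[OF _ \<gamma> a(2,3) \<tau>]) (use a in simp)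
    also have "\<dots> \<le> ennreal e" using N1[of N] a(1) by (intro ennreal_leI) linarith
    finally show "(\<integral>\<^sup>+x. ennreal \<bar>quad N \<gamma> J i x - ntrace N \<gamma> J x\<bar> \<partial>PiM (grid N {..<K}) (\<lambda>_. mu)) \<le> ennreal e" .
  qed simp
qed

lemma ntrace_L1_small:
  assumes \<gamma>: "\<gamma> > 0" and e: "e > 0"
    and t: "t \<ge> 0" "1 = t + \<alpha> * (\<gamma> * t / (1 + \<gamma> * t))"
  shows "\<exists>N0>0. \<forall>N\<ge>N0. \<forall>K. K \<le> 2 * N \<longrightarrow> \<alpha> = real K / real N \<longrightarrow>
    (\<integral>\<^sup>+x. ennreal \<bar>ntrace N \<gamma> {..<K} x - t\<bar> \<partial>PiM (grid N {..<K}) (\<lambda>_. mu)) \<le> ennreal e"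
proof -
  \<comment> \<open>At most 2 N columns contribute \<gamma> d / N each, in total at most 2 \<gamma>
    d = e/2.\<close>
  define d where "d = e / (4 * \<gamma>)"
  have d: "d > 0" using e \<gamma> by (simp add: d_def)
  obtain N1 where N1': "N1 > 0 \<and> (\<forall>N\<ge>N1. \<forall>(K::nat) i J. i < K \<longrightarrow> J \<subseteq> {..<K} - {i} \<longrightarrow>
    (\<integral>\<^sup>+x. ennreal \<bar>quad N \<gamma> J i x - ntrace N \<gamma> J x\<bar> \<partial>PiM (grid N {..<K}) (\<lambda>_. mu)) \<le> ennreal d)"
    using quad_L1_small[OF \<gamma> d] by (elim exE) (rule that)
  note N1 = N1'[THEN conjunct1] N1'[THEN conjunct2, rule_format]
  have "((\<lambda>N. 2 * \<gamma> / real N) \<longlongrightarrow> 0) sequentially" by real_asymp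
  then have "\<forall>\<^sub>F N in sequentially. 2 * \<gamma> / real N < e / 2"
    using e by (intro order_tendstoD(2)) auto
  then obtain N2 where N2: "\<And>N. N \<ge> N2 \<Longrightarrow> 2 * \<gamma> / real N < e / 2"
    by (auto simp: eventually_sequentially)
  show ?thesis
  proof (intro exI[of _ "max N1 N2"] conjI allI impI)
    show "max N1 N2 > 0" using N1 by simp
    fix N K :: nat assume a: "max N1 N2 \<le> N" "K \<le> 2 * N" "\<alpha> = real K / real N"
    then have N: "N > 0" using N1 by simp
    interpret P: prob_space "PiM (grid N {..<K}) (\<lambda>_. mu)" by (rule prob_space_grid)
    let ?f = "\<lambda>k x. \<bar>quad N \<gamma> ({..<K} - {k}) k x - ntrace N \<gamma> ({..<K} - {k}) x\<bar>"
    have m: "(\<lambda>x. ?f k x) \<in> borel_measurable (PiM (grid N {..<K}) (\<lambda>_. mu))" if "k < K" for k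
    proof -
      have [measurable]: "(\<lambda>x. quad N \<gamma> ({..<K} - {k}) k x) \<in> borel_measurable (PiM (grid N {..<K}) (\<lambda>_. mu))"
        "(\<lambda>x. ntrace N \<gamma> ({..<K} - {k}) x) \<in> borel_measurable (PiM (grid N {..<K}) (\<lambda>_. mu))"
        using that by (auto intro!: quad_measurable ntrace_measurable grid_component)
      show ?thesis by measurable
    qed
    have "(\<integral>\<^sup>+x. ennreal \<bar>ntrace N \<gamma> {..<K} x - t\<bar> \<partial>PiM (grid N {..<K}) (\<lambda>_. mu))
        \<le> (\<integral>\<^sup>+x. ennreal (\<gamma> / real N * (\<Sum>k<K. ?f k x) + \<gamma> * real K / (real N)\<^sup>2) \<partial>PiM (grid N {..<K}) (\<lambda>_. mu))"
      by (intro nn_integral_mono ennreal_leI ntrace_near_fixpoint[OF N \<gamma> t(1)]) (use t(2) a(3) in simp)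
    also have "\<dots> = (\<integral>\<^sup>+x. ennreal (\<gamma> / real N) * (\<Sum>k<K. ennreal (?f k x)) + ennreal (\<gamma> * real K / (real N)\<^sup>2)
        \<partial>PiM (grid N {..<K}) (\<lambda>_. mu))"
    proof (intro nn_integral_cong)
      fix x
      have "(\<Sum>k<K. ennreal (?f k x)) = ennreal (\<Sum>k<K. ?f k x)" by (rule sum_ennreal) simp
      then show "ennreal (\<gamma> / real N * (\<Sum>k<K. ?f k x) + \<gamma> * real K / (real N)\<^sup>2)
          = ennreal (\<gamma> / real N) * (\<Sum>k<K. ennreal (?f k x)) + ennreal (\<gamma> * real K / (real N)\<^sup>2)"
        by (simp only:) (rule ennreal_affine, use \<gamma> in \<open>auto intro!: sum_nonneg\<close>)
    qed
    also have "\<dots> = ennreal (\<gamma> / real N) * (\<Sum>k<K. \<integral>\<^sup>+x. ennreal (?f k x) \<partial>PiM (grid N {..<K}) (\<lambda>_. mu))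
        + ennreal (\<gamma> * real K / (real N)\<^sup>2)"
    proof -
      have mE: "(\<lambda>x. ennreal (?f k x)) \<in> borel_measurable (PiM (grid N {..<K}) (\<lambda>_. mu))" if "k \<in> {..<K}" for k
        using m[of k] that by (intro measurable_compose[OF _ measurable_ennreal]) simp
      note mS = borel_measurable_sum[of "{..<K}" "\<lambda>k x. ennreal (?f k x)", OF mE]
      have "(\<integral>\<^sup>+x. ennreal (\<gamma> / real N) * (\<Sum>k<K. ennreal (?f k x)) + ennreal (\<gamma> * real K / (real N)\<^sup>2)
          \<partial>PiM (grid N {..<K}) (\<lambda>_. mu))
          = (\<integral>\<^sup>+x. ennreal (\<gamma> / real N) * (\<Sum>k<K. ennreal (?f k x)) \<partial>PiM (grid N {..<K}) (\<lambda>_. mu))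
              + ennreal (\<gamma> * real K / (real N)\<^sup>2)"
        by (subst nn_integral_add) (use mS in \<open>auto simp: P.emeasure_space_1 simp del: sum_ennreal\<close>)
      also have "(\<integral>\<^sup>+x. ennreal (\<gamma> / real N) * (\<Sum>k<K. ennreal (?f k x)) \<partial>PiM (grid N {..<K}) (\<lambda>_. mu))
          = ennreal (\<gamma> / real N) * (\<integral>\<^sup>+x. (\<Sum>k<K. ennreal (?f k x)) \<partial>PiM (grid N {..<K}) (\<lambda>_. mu))"
        by (rule nn_integral_cmult[OF mS])
      also have "(\<integral>\<^sup>+x. (\<Sum>k<K. ennreal (?f k x)) \<partial>PiM (grid N {..<K}) (\<lambda>_. mu))
          = (\<Sum>k<K. \<integral>\<^sup>+x. ennreal (?f k x) \<partial>PiM (grid N {..<K}) (\<lambda>_. mu))"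
        by (rule nn_integral_sum[OF mE])
      finally show ?thesis .
    qed
    also have "\<dots> \<le> ennreal (\<gamma> / real N) * (\<Sum>k<K. ennreal d) + ennreal (\<gamma> * real K / (real N)\<^sup>2)"
      using a by (intro add_mono mult_left_mono sum_mono N1(2)) auto
    also have "\<dots> = ennreal (\<gamma> / real N * (\<Sum>k<K. d) + \<gamma> * real K / (real N)\<^sup>2)"
    proof -
      have "(\<Sum>k<K. ennreal d) = ennreal (\<Sum>k<K. d)" using d by (intro sum_ennreal) auto
      then show ?thesis
        by (simp only:) (rule ennreal_affine[symmetric], use \<gamma> d in \<open>auto intro!: sum_nonneg\<close>)
    qed
    also have "\<dots> \<le> ennreal e"
    proof (rule ennreal_leI)
      have K: "real K / real N \<le> 2" using a N by (simp add: divide_le_eq)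
      have "\<gamma> / real N * (\<Sum>k<K. d) = \<gamma> * d * (real K / real N)" by simp
      also have "\<dots> \<le> \<gamma> * d * 2" using K \<gamma> d by (intro mult_left_mono) auto
      also have "\<dots> = e / 2" using \<gamma> by (simp add: d_def)
      finally have 1: "\<gamma> / real N * (\<Sum>k<K. d) \<le> e / 2" .
      have "\<gamma> * real K / (real N)\<^sup>2 = \<gamma> / real N * (real K / real N)" by (simp add: power2_eq_square)
      also have "\<dots> \<le> \<gamma> / real N * 2" using K \<gamma> by (intro mult_left_mono) auto
      also have "\<dots> < e / 2" using N2[of N] a by simp
      finally show "\<gamma> / real N * (\<Sum>k<K. d) + \<gamma> * real K / (real N)\<^sup>2 \<le> e" using 1 by linarith
    qed
    finally show "(\<integral>\<^sup>+x. ennreal \<bar>ntrace N \<gamma> {..<K} x - t\<bar> \<partial>PiM (grid N {..<K}) (\<lambda>_. mu)) \<le> ennreal e" .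
  qed
qed

text \<open>For fixed other columns the cross term is a linear form in column i with coefficient
  vector C x_j, whose norm is at most that of x_j. Hence E (N cross)^2 \<le> E |x_j|^2 = N, and the
  first moment follows from the inequality between arithmetic and geometric mean.\<close>

lemma cross_L1:
  assumes N: "N > 0" and \<gamma>: "\<gamma> > 0" and i: "i < K" and j: "j < K" "j \<noteq> i" and J: "J \<subseteq> {..<K} - {i}"
  shows "(\<integral>\<^sup>+x. ennreal (cross N \<gamma> J i j x) \<partial>PiM (grid N {..<K}) (\<lambda>_. mu)) \<le> ennreal (1 / sqrt N)"
proof -
  have fJ: "finite J" using J finite_subset by blast
  let ?P = "PiM (grid N {..<K}) (\<lambda>_. mu)" and ?Z = "PiM (grid N ({..<K} - {i})) (\<lambda>_. mu)" and ?A = "grid N {i}"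
  let ?Y = "PiM ?A (\<lambda>_. mu)"
  interpret P: prob_space ?P by (rule prob_space_grid)
  interpret Z: prob_space ?Z by (rule prob_space_grid)
  let ?m = "\<lambda>z y. merge (grid N ({..<K} - {i})) ?A (z, y)"
  have [measurable]: "(\<lambda>x. cross N \<gamma> J i j x) \<in> borel_measurable ?P"
    using i j J fJ by (auto intro!: cross_measurable grid_component)
  have "(\<integral>\<^sup>+x. ennreal ((real N * cross N \<gamma> J i j x)\<^sup>2) \<partial>?P)
      = (\<integral>\<^sup>+z. (\<integral>\<^sup>+y. ennreal ((real N * cross N \<gamma> J i j (?m z y))\<^sup>2) \<partial>?Y) \<partial>?Z)"
    by (rule grid_nn_integral_fold[OF i]) measurable
  also have "\<dots> \<le> (\<integral>\<^sup>+z. ennreal (nrm2 N (channel_columns z j)) \<partial>?Z)"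
  proof (rule nn_integral_mono)
    fix z assume z: "z \<in> space ?Z"
    let ?v = "\<lambda>p::nat \<times> nat. cnj (resolvent N (\<gamma> / real N) (channel_columns z) J (channel_columns z j) (fst p))"
    have "(real N * cross N \<gamma> J i j (?m z y))\<^sup>2 = (cmod (\<Sum>p\<in>?A. ?v p * y p))\<^sup>2" for y
    proof -
      have "(\<Sum>p\<in>?A. ?v p * y p) = cnj (\<Sum>p\<in>?A. cnj (y p) * cnj (?v p))" by (simp add: cnj_sum mult.commute)
      then have "cmod (\<Sum>p\<in>?A. ?v p * y p) = cmod (\<Sum>p\<in>?A. cnj (y p) * cnj (?v p))"
        by (simp only: complex_mod_cnj)
      then show ?thesis unfolding merge_cross[OF N \<gamma> J z j] by simp
    qed
    then have "(\<integral>\<^sup>+y. ennreal ((real N * cross N \<gamma> J i j (?m z y))\<^sup>2) \<partial>?Y)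
        = (\<integral>\<^sup>+y. ennreal ((cmod (\<Sum>p\<in>?A. ?v p * y p))\<^sup>2) \<partial>?Y)" by simp
    also have "\<dots> \<le> ennreal (\<Sum>p\<in>?A. (cmod (?v p))\<^sup>2)" by (rule linear_form_power2) simp
    also have "(\<Sum>p\<in>?A. (cmod (?v p))\<^sup>2)
        = nrm2 N (resolvent N (\<gamma> / real N) (channel_columns z) J (channel_columns z j))"
      unfolding sum_grid_column nrm2_def by simp
    also have "ennreal \<dots> \<le> ennreal (nrm2 N (channel_columns z j))"
      by (intro ennreal_leI nrm2_resolvent_le[OF gN[OF N \<gamma>] fJ])
    finally show "(\<integral>\<^sup>+y. ennreal ((real N * cross N \<gamma> J i j (?m z y))\<^sup>2) \<partial>?Y)
        \<le> ennreal (nrm2 N (channel_columns z j))" .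
  qed
  also have "\<dots> = (\<integral>\<^sup>+z. (\<Sum>a<N. ennreal ((cmod (z (a, j)))\<^sup>2)) \<partial>?Z)"
    by (simp add: nrm2_def channel_columns_def)
  also have "\<dots> = (\<Sum>a<N. \<integral>\<^sup>+z. ennreal ((cmod (z (a, j)))\<^sup>2) \<partial>?Z)"
  proof (rule nn_integral_sum)
    fix a assume "a \<in> {..<N}"
    then have [measurable]: "(\<lambda>z. z (a, j)) \<in> borel_measurable ?Z" using j by (intro grid_component) auto
    show "(\<lambda>z. ennreal ((cmod (z (a, j)))\<^sup>2)) \<in> borel_measurable ?Z" by measurable
  qed
  also have "\<dots> = (\<Sum>a<N. 1)"
  proof (rule sum.cong[OF refl])
    fix a assume "a \<in> {..<N}"
    then have "(\<integral>\<^sup>+z. ennreal ((cmod (z (a, j)))\<^sup>2) \<partial>?Z) = (\<integral>\<^sup>+y. ennreal ((cmod y)\<^sup>2) \<partial>mu)"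
      using j by (intro nn_integral_PiM_component[of "(a, j)" _ "\<lambda>y. ennreal ((cmod y)\<^sup>2)"]) auto
    also have "\<dots> = 1" using nn_integral_eq_integral[OF square_integrable] variance by simp
    finally show "(\<integral>\<^sup>+z. ennreal ((cmod (z (a, j)))\<^sup>2) \<partial>?Z) = 1" .
  qed
  also have "\<dots> = ennreal (real N)" by (simp add: ennreal_of_nat_eq_real_of_nat)
  finally have sq: "(\<integral>\<^sup>+x. ennreal ((real N * cross N \<gamma> J i j x)\<^sup>2) \<partial>?P) \<le> ennreal (real N)" .
  have sN: "sqrt (real N) > 0" "sqrt (real N) * sqrt (real N) = real N" using N by auto
  have c0: "cross N \<gamma> J i j x \<ge> 0" for x by (simp add: cross_def)
  have "(\<integral>\<^sup>+x. ennreal (cross N \<gamma> J i j x) \<partial>?P)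
      \<le> (\<integral>\<^sup>+x. ennreal (1 / (2 * sqrt N)) + ennreal (1 / (2 * sqrt N * N)) * ennreal ((real N
          * cross N \<gamma> J i j x)\<^sup>2) \<partial>?P)"
  proof (rule nn_integral_mono)
    fix x
    define c where "c = cross N \<gamma> J i j x"
    have "0 \<le> (sqrt N * c - 1)\<^sup>2 / (2 * sqrt N)" by simp
    also have "\<dots> = 1 / (2 * sqrt N) + real N * c\<^sup>2 / (2 * sqrt N) - c"
      using N sN by (simp add: power2_diff power_mult_distrib add_divide_distrib diff_divide_distrib)
    also have "real N * c\<^sup>2 / (2 * sqrt N) = 1 / (2 * sqrt N * N) * (real N * c)\<^sup>2"
      using N by (simp add: power2_eq_square field_simps)
    finally have "c \<le> 1 / (2 * sqrt N) + 1 / (2 * sqrt N * N) * (real N * c)\<^sup>2" by simp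
    then have "ennreal c \<le> ennreal (1 / (2 * sqrt N) + 1 / (2 * sqrt N * N) * (real N * c)\<^sup>2)" by (rule ennreal_leI)
    also have "\<dots> = ennreal (1 / (2 * sqrt N)) + ennreal (1 / (2 * sqrt N * N)) * ennreal ((real N * c)\<^sup>2)"
      by (subst ennreal_plus, simp, simp, subst ennreal_mult) auto
    finally show "ennreal (cross N \<gamma> J i j x)
      \<le> ennreal (1 / (2 * sqrt N)) + ennreal (1 / (2 * sqrt N * N)) * ennreal ((real N * cross N \<gamma> J i j x)\<^sup>2)"
      unfolding c_def .
  qed
  also have "\<dots> = ennreal (1 / (2 * sqrt N)) + ennreal (1 / (2 * sqrt N * N)) * (\<integral>\<^sup>+x. ennreal ((real N
      * cross N \<gamma> J i j x)\<^sup>2) \<partial>?P)"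
    by (simp add: nn_integral_add nn_integral_cmult P.emeasure_space_1)
  also have "\<dots> \<le> ennreal (1 / (2 * sqrt N)) + ennreal (1 / (2 * sqrt N * N)) * ennreal (real N)"
    by (intro add_mono mult_left_mono sq) auto
  also have "\<dots> = ennreal (1 / (2 * sqrt N) + 1 / (2 * sqrt N * N) * real N)"
    by (subst ennreal_plus, simp, simp, subst ennreal_mult) auto
  also have "1 / (2 * sqrt N) + 1 / (2 * sqrt N * N) * real N = 1 / sqrt N" using N by (simp add: field_simps)
  finally show ?thesis .
qed

end

section \<open>Independent pairing\<close>

text \<open>The right-hand side of \<open>eig_2x2_dist\<close>: it bounds the distance of both
  eigenvalues of the pair from \<open>c\<close>.\<close>

definition pair_error :: "nat \<Rightarrow> real \<Rightarrow> nat \<Rightarrow> real \<Rightarrow> nat \<Rightarrow> nat \<Rightarrow> (nat \<times> nat \<Rightarrow> complex) \<Rightarrow> real" where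
  "pair_error N \<gamma> K c i j x =
     \<bar>\<gamma> * quad N \<gamma> ({..<K} - {i, j}) i x - c\<bar> + \<bar>\<gamma> * quad N \<gamma> ({..<K} - {i, j}) j x - c\<bar>
     + \<gamma> * cross N \<gamma> ({..<K} - {i, j}) i j x"

lemma emeasure_Markov_le:
  assumes [measurable]: "f \<in> borel_measurable M" and e: "e > 0" and d: "d \<ge> 0"
    and le: "(\<integral>\<^sup>+x. ennreal (f x) \<partial>M) \<le> ennreal d"
  shows "emeasure M {x \<in> space M. f x > e} \<le> ennreal (d / e)"
proof -
  have "emeasure M {x \<in> space M. f x > e} = (\<integral>\<^sup>+x. indicator {x \<in> space M. f x > e} x \<partial>M)" by simp
  also have "\<dots> \<le> (\<integral>\<^sup>+x. ennreal (1 / e) * ennreal (f x) \<partial>M)"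
  proof (rule nn_integral_mono)
    fix x
    show "indicator {x \<in> space M. f x > e} x \<le> ennreal (1 / e) * ennreal (f x)"
    proof (cases "x \<in> {x \<in> space M. f x > e}")
      case True
      then have "1 \<le> 1 / e * f x" using e by (simp add: le_divide_eq)
      then have "ennreal 1 \<le> ennreal (1 / e * f x)" by (rule ennreal_leI)
      also have "\<dots> = ennreal (1 / e) * ennreal (f x)" using e by (intro ennreal_mult') simp
      finally show ?thesis using True by simp
    qed simp
  qed
  also have "\<dots> = ennreal (1 / e) * (\<integral>\<^sup>+x. ennreal (f x) \<partial>M)" by (rule nn_integral_cmult) measurable
  also have "\<dots> \<le> ennreal (1 / e) * ennreal d" by (intro mult_left_mono le) simp
  also have "\<dots> = ennreal (d / e)" using e d by (simp add: ennreal_mult'[symmetric])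
  finally show ?thesis .
qed

lemma ntrace_remove_pair:
  assumes "N > 0" "\<gamma> > 0" "i < K" "j < K" "i \<noteq> j"
  shows "\<bar>ntrace N \<gamma> ({..<K} - {i, j}) x - ntrace N \<gamma> {..<K} x\<bar> \<le> 2 / real N"
proof -
  have "insert j ({..<K} - {i, j}) = {..<K} - {i}" "insert i ({..<K} - {i}) = {..<K}"
    using assms by auto
  then have "\<bar>ntrace N \<gamma> ({..<K} - {i}) x - ntrace N \<gamma> ({..<K} - {i, j}) x\<bar> \<le> 1 / real N"
    "\<bar>ntrace N \<gamma> {..<K} x - ntrace N \<gamma> ({..<K} - {i}) x\<bar> \<le> 1 / real N"
    using ntrace_insert[OF assms(1,2), of "{..<K} - {i, j}" j x] ntrace_insert[OF assms(1,2), of "{..<K} - {i}" i x]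
    by simp_all
  moreover have "2 / real N = 1 / real N + 1 / real N" by simp
  ultimately show ?thesis by linarith
qed

text \<open>The exponential bound at a tilt proportional to ln N whose linear term is 4 ln N and
  whose product with the cut-off is ln N / 2. The main factor is N^(-4), and the correction in the
  exponent is of order (ln N)^2 / sqrt N.\<close>

definition chernoff_rate :: "real \<Rightarrow> nat \<Rightarrow> real" where
  "chernoff_rate A N = exp (- 4 * ln (real N) + A * (ln (real N))\<^sup>2 * exp (ln (real N) / 2) / real N)"

lemma chernoff_rate_tendsto:
  assumes "A > 0"
  shows "(\<lambda>N. (real N)\<^sup>2 * chernoff_rate A N) \<longlonglongrightarrow> 0"
  unfolding chernoff_rate_def using assms by real_asymp

lemma chernoff_rate_tendsto':
  assumes "A > 0"
  shows "(\<lambda>N. real N * chernoff_rate A N) \<longlonglongrightarrow> 0"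
  unfolding chernoff_rate_def using assms by real_asymp

context unit_law
begin

lemma pair_error_measurable:
  assumes "i < K" "j < K"
  shows "(\<lambda>x. pair_error N \<gamma> K c i j x) \<in> borel_measurable (PiM (grid N {..<K}) (\<lambda>_. mu))"
proof -
  have [measurable]: "(\<lambda>x. quad N \<gamma> ({..<K} - {i, j}) i x) \<in> borel_measurable (PiM (grid N {..<K}) (\<lambda>_. mu))"
    "(\<lambda>x. quad N \<gamma> ({..<K} - {i, j}) j x) \<in> borel_measurable (PiM (grid N {..<K}) (\<lambda>_. mu))"
    "(\<lambda>x. cross N \<gamma> ({..<K} - {i, j}) i j x) \<in> borel_measurable (PiM (grid N {..<K}) (\<lambda>_. mu))"
    using assms by (auto intro!: quad_measurable cross_measurable grid_component)
  show ?thesis unfolding pair_error_def by measurable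
qed

lemma pair_error_L1_small:
  assumes \<gamma>: "\<gamma> > 0" and e: "e > 0"
    and t: "t \<ge> 0" "1 = t + \<alpha> * (\<gamma> * t / (1 + \<gamma> * t))"
  shows "\<exists>N0>0. \<forall>N\<ge>N0. \<forall>(K::nat) i j. K \<le> 2 * N \<longrightarrow> \<alpha> = real K / real N \<longrightarrow> i < K \<longrightarrow> j < K \<longrightarrow> i \<noteq> j \<longrightarrow>
    (\<integral>\<^sup>+x. ennreal (pair_error N \<gamma> K (\<gamma> * t) i j x) \<partial>PiM (grid N {..<K}) (\<lambda>_. mu)) \<le> ennreal e"
proof -
  \<comment> \<open>The deviations of the two forms count once each and that of the trace twice, so
    they sum to 4 \<gamma> d = e/2.\<close>
  define d where "d = e / (8 * \<gamma>)"
  have d: "d > 0" using e \<gamma> by (simp add: d_def)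
  obtain N1 where N1': "N1 > 0 \<and> (\<forall>N\<ge>N1. \<forall>(K::nat) i J. i < K \<longrightarrow> J \<subseteq> {..<K} - {i} \<longrightarrow>
    (\<integral>\<^sup>+x. ennreal \<bar>quad N \<gamma> J i x - ntrace N \<gamma> J x\<bar> \<partial>PiM (grid N {..<K}) (\<lambda>_. mu)) \<le> ennreal d)"
    using quad_L1_small[OF \<gamma> d] by (elim exE) (rule that)
  note N1 = N1'[THEN conjunct1] N1'[THEN conjunct2, rule_format]
  obtain N2 where N2': "N2 > 0 \<and> (\<forall>N\<ge>N2. \<forall>K. K \<le> 2 * N \<longrightarrow> \<alpha> = real K / real N \<longrightarrow>
    (\<integral>\<^sup>+x. ennreal \<bar>ntrace N \<gamma> {..<K} x - t\<bar> \<partial>PiM (grid N {..<K}) (\<lambda>_. mu)) \<le> ennreal d)"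
    using ntrace_L1_small[OF \<gamma> d t] by (elim exE) (rule that)
  note N2 = N2'[THEN conjunct1] N2'[THEN conjunct2, rule_format]
  have "((\<lambda>N. \<gamma> * (4 / real N + 1 / sqrt (real N))) \<longlongrightarrow> 0) sequentially" by real_asymp
  then have "\<forall>\<^sub>F N in sequentially. \<gamma> * (4 / real N + 1 / sqrt (real N)) < e / 2"
    using e by (intro order_tendstoD(2)) auto
  then obtain N3 where N3: "\<And>N. N \<ge> N3 \<Longrightarrow> \<gamma> * (4 / real N + 1 / sqrt (real N)) < e / 2"
    by (auto simp: eventually_sequentially)
  show ?thesis
  proof (intro exI[of _ "max N1 (max N2 N3)"] conjI allI impI)
    show "max N1 (max N2 N3) > 0" using N1(1) by simp
    fix N K i j :: nat
    assume a: "max N1 (max N2 N3) \<le> N" "K \<le> 2 * N" "\<alpha> = real K / real N" and ij: "i < K" "j < K" "i \<noteq> j"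
    then have N: "N > 0" and le: "N1 \<le> N" "N2 \<le> N" "N3 \<le> N" using N1(1) by auto
    let ?P = "PiM (grid N {..<K}) (\<lambda>_. mu)" and ?J = "{..<K} - {i, j}"
    interpret P: prob_space ?P by (rule prob_space_grid)
    let ?a = "\<lambda>x. \<bar>quad N \<gamma> ?J i x - ntrace N \<gamma> ?J x\<bar>"
    let ?b = "\<lambda>x. \<bar>quad N \<gamma> ?J j x - ntrace N \<gamma> ?J x\<bar>"
    let ?s = "\<lambda>x. \<bar>ntrace N \<gamma> {..<K} x - t\<bar>"
    let ?c = "\<lambda>x. cross N \<gamma> ?J i j x"
    have J: "?J \<subseteq> {..<K} - {i}" "?J \<subseteq> {..<K} - {j}" by auto
    have [measurable]: "(\<lambda>x. quad N \<gamma> ?J i x) \<in> borel_measurable ?P" "(\<lambda>x. quad N \<gamma> ?J j x) \<in> borel_measurable ?P"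
      "(\<lambda>x. ntrace N \<gamma> ?J x) \<in> borel_measurable ?P" "(\<lambda>x. ntrace N \<gamma> {..<K} x) \<in> borel_measurable ?P"
      "(\<lambda>x. cross N \<gamma> ?J i j x) \<in> borel_measurable ?P"
      using ij by (auto intro!: quad_measurable ntrace_measurable cross_measurable grid_component)
    have c0: "?c x \<ge> 0" for x by (simp add: cross_def)
    have pt: "pair_error N \<gamma> K (\<gamma> * t) i j x \<le> \<gamma> * (?a x + ?b x + 2 * ?s x + ?c x) + \<gamma> * (4 / real N)" for x
    proof -
      have r: "\<bar>ntrace N \<gamma> ?J x - ntrace N \<gamma> {..<K} x\<bar> \<le> 2 / real N"
        by (rule ntrace_remove_pair[OF N \<gamma> ij])
      have "\<bar>quad N \<gamma> ?J i x - t\<bar> \<le> ?a x + 2 / real N + ?s x" "\<bar>quad N \<gamma> ?J j x - t\<bar> \<le> ?b x + 2 / real N + ?s x"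
        using r by linarith+
      then have "\<gamma> * \<bar>quad N \<gamma> ?J i x - t\<bar> \<le> \<gamma> * (?a x + 2 / real N + ?s x)"
        "\<gamma> * \<bar>quad N \<gamma> ?J j x - t\<bar> \<le> \<gamma> * (?b x + 2 / real N + ?s x)"
        using \<gamma> by (auto intro!: mult_left_mono)
      moreover have "\<bar>\<gamma> * q - \<gamma> * t\<bar> = \<gamma> * \<bar>q - t\<bar>" for q
        using \<gamma> by (simp add: abs_mult flip: right_diff_distrib)
      moreover have "\<gamma> * (a + 2 / real N + s) + \<gamma> * (b + 2 / real N + s) + \<gamma> * c = \<gamma> * (a + b + 2 * s + c)
          + \<gamma> * (4 / real N)" for a b s c
        by (simp add: algebra_simps)
      ultimately show ?thesis unfolding pair_error_def by (smt (verit))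
    qed
    have key: "ennreal (a + b + 2 * s + c) = ennreal a + ennreal b + ennreal 2 * ennreal s + ennreal c"
      if "a \<ge> 0" "b \<ge> 0" "s \<ge> 0" "c \<ge> 0" for a b s c
      using that by (simp add: ennreal_mult')
    have "(\<integral>\<^sup>+x. ennreal (pair_error N \<gamma> K (\<gamma> * t) i j x) \<partial>?P)
        \<le> (\<integral>\<^sup>+x. ennreal (\<gamma> * (?a x + ?b x + 2 * ?s x + ?c x) + \<gamma> * (4 / real N)) \<partial>?P)"
      by (intro nn_integral_mono ennreal_leI pt)
    also have "\<dots> = (\<integral>\<^sup>+x. ennreal \<gamma> * (ennreal (?a x) + ennreal (?b x) + ennreal 2 * ennreal (?s x)
        + ennreal (?c x)) + ennreal (\<gamma> * (4 / real N)) \<partial>?P)"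
    proof (intro nn_integral_cong)
      fix x
      have "ennreal (?a x + ?b x + 2 * ?s x + ?c x) = ennreal (?a x) + ennreal (?b x)
          + ennreal 2 * ennreal (?s x) + ennreal (?c x)"
        by (rule key) (use c0 in auto)
      then show "ennreal (\<gamma> * (?a x + ?b x + 2 * ?s x + ?c x) + \<gamma> * (4 / real N))
          = ennreal \<gamma> * (ennreal (?a x) + ennreal (?b x) + ennreal 2 * ennreal (?s x) + ennreal (?c x))
              + ennreal (\<gamma> * (4 / real N))"
        by (subst ennreal_affine) (use \<gamma> c0 in \<open>auto intro!: add_nonneg_nonneg\<close>)
    qed
    also have "\<dots> = ennreal \<gamma> * ((\<integral>\<^sup>+x. ennreal (?a x) \<partial>?P) + (\<integral>\<^sup>+x. ennreal (?b x) \<partial>?P)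
        + ennreal 2 * (\<integral>\<^sup>+x. ennreal (?s x) \<partial>?P) + (\<integral>\<^sup>+x. ennreal (?c x) \<partial>?P)) + ennreal (\<gamma> * (4 / real N))"
      by (simp add: nn_integral_add nn_integral_cmult P.emeasure_space_1)
    also have "\<dots> \<le> ennreal \<gamma> * (ennreal d + ennreal d + ennreal 2 * ennreal d + ennreal (1 / sqrt N))
        + ennreal (\<gamma> * (4 / real N))"
      by (intro add_mono mult_left_mono N1(2)[OF le(1) ij(1) J(1)] N1(2)[OF le(1) ij(2) J(2)] N2(2)[OF le(2) a(2,3)]
          cross_L1[OF N \<gamma> ij(1,2) ij(3)[symmetric] J(1)]) auto
    also have "\<dots> = ennreal (\<gamma> * (d + d + 2 * d + 1 / sqrt N) + \<gamma> * (4 / real N))"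
    proof -
      have "ennreal d + ennreal d + ennreal 2 * ennreal d + ennreal (1 / sqrt N) = ennreal (d + d + 2 * d
          + 1 / sqrt N)"
        by (rule key[symmetric]) (use d in auto)
      then show ?thesis by (simp only:) (rule ennreal_affine[symmetric], use \<gamma> d in auto)
    qed
    also have "\<dots> \<le> ennreal e"
    proof (rule ennreal_leI)
      have "\<gamma> * (d + d + 2 * d + 1 / sqrt N) + \<gamma> * (4 / real N) = 4 * (\<gamma> * d) + \<gamma> * (4 / real N + 1 / sqrt N)"
        by (simp add: algebra_simps)
      moreover have "4 * (\<gamma> * d) = e / 2" using \<gamma> by (simp add: d_def)
      ultimately show "\<gamma> * (d + d + 2 * d + 1 / sqrt N) + \<gamma> * (4 / real N) \<le> e" using N3[OF le(3)] by linarith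
    qed
    finally show "(\<integral>\<^sup>+x. ennreal (pair_error N \<gamma> K (\<gamma> * t) i j x) \<partial>?P) \<le> ennreal e" .
  qed
qed

text \<open>The threshold is common to all pairs while the event concerns one fixed pair: exactly
  what conditioning on an independent pairing consumes.\<close>

lemma pair_error_tail_small:
  assumes \<gamma>: "\<gamma> > 0" and e: "e > 0" and \<epsilon>: "\<epsilon> > 0"
    and t: "t \<ge> 0" "1 = t + \<alpha> * (\<gamma> * t / (1 + \<gamma> * t))"
  shows "\<exists>N0>0. \<forall>N\<ge>N0. \<forall>(K::nat) i j. K \<le> 2 * N \<longrightarrow> \<alpha> = real K / real N \<longrightarrow> i < K \<longrightarrow> j < K \<longrightarrow> i \<noteq> j \<longrightarrow>
    emeasure (PiM (grid N {..<K}) (\<lambda>_. mu))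
      {x \<in> space (PiM (grid N {..<K}) (\<lambda>_. mu)). pair_error N \<gamma> K (\<gamma> * t) i j x > \<epsilon>} \<le> ennreal e"
proof -
  have e\<epsilon>: "e * \<epsilon> > 0" using e \<epsilon> by simp
  obtain N0 where N0: "N0 > 0 \<and> (\<forall>N\<ge>N0. \<forall>(K::nat) i j. K \<le> 2 * N \<longrightarrow> \<alpha> = real K / real N \<longrightarrow> i < K \<longrightarrow> j < K \<longrightarrow> i \<noteq> j \<longrightarrow>
    (\<integral>\<^sup>+x. ennreal (pair_error N \<gamma> K (\<gamma> * t) i j x) \<partial>PiM (grid N {..<K}) (\<lambda>_. mu)) \<le> ennreal (e * \<epsilon>))"
    using pair_error_L1_small[OF \<gamma> e\<epsilon> t] by (elim exE) (rule that)
  show ?thesis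
  proof (intro exI[of _ N0] conjI allI impI)
    show "N0 > 0" using N0 by (rule conjunct1)
    fix N K i j :: nat
    assume a: "N0 \<le> N" "K \<le> 2 * N" "\<alpha> = real K / real N" "i < K" "j < K" "i \<noteq> j"
    show "emeasure (PiM (grid N {..<K}) (\<lambda>_. mu))
      {x \<in> space (PiM (grid N {..<K}) (\<lambda>_. mu)). pair_error N \<gamma> K (\<gamma> * t) i j x > \<epsilon>} \<le> ennreal e"
      using emeasure_Markov_le[OF pair_error_measurable[OF a(4,5)] \<epsilon> _ N0[THEN conjunct2, rule_format, OF a]] e
          \<epsilon> by simp
  qed
qed

end

section \<open>Arbitrary pairing\<close>

context unit_law
begin

lemma tail_fourth_moment_tendsto:
  assumes i4: "integrable mu (\<lambda>y. cmod y ^ 4)" and \<delta>: "\<delta> > 0"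
  shows "(\<lambda>N. \<integral>z. cmod z ^ 4 * indicator {z. (cmod z)\<^sup>2 > \<delta> * real N} z \<partial>mu) \<longlonglongrightarrow> 0"
proof -
  let ?f = "\<lambda>(N::nat) z. cmod z ^ 4 * indicator {z. (cmod z)\<^sup>2 > \<delta> * real N} z :: real"
  have "(\<lambda>n. \<integral>z. ?f n z \<partial>mu) \<longlonglongrightarrow> (\<integral>z. 0 \<partial>mu)"
  proof (rule integral_dominated_convergence[where w = "\<lambda>z. cmod z ^ 4"])
    show "AE z in mu. (\<lambda>n. ?f n z) \<longlonglongrightarrow> 0"
    proof (intro AE_I2 tendsto_eventually)
      fix z :: complex
      obtain n0 :: nat where n0: "(cmod z)\<^sup>2 / \<delta> \<le> real n0" using real_arch_simple by blast
      have "(cmod z)\<^sup>2 \<le> \<delta> * real n" if "n \<ge> n0" for n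
      proof -
        have "(cmod z)\<^sup>2 \<le> \<delta> * real n0" using n0 \<delta> by (simp add: divide_le_eq mult.commute)
        also have "\<dots> \<le> \<delta> * real n" using that \<delta> by simp
        finally show ?thesis .
      qed
      then show "\<forall>\<^sub>F n in sequentially. ?f n z = 0"
        by (intro eventually_sequentiallyI[of n0]) (auto simp: indicator_def not_less)
    qed
    show "AE z in mu. norm (?f n z) \<le> cmod z ^ 4" for n by (auto simp: indicator_def)
  qed (use i4 in auto)
  then show ?thesis by simp
qed

text \<open>Each entry exceeds the level with probability at most the truncated fourth moment over
  (\<delta> N)^2, and the number of entries, at most 2 N^2, cancels the N^2. What remains is the
  tail of a convergent integral and tends to 0.\<close>

lemma entry_truncation:
  assumes i4: "integrable mu (\<lambda>y. cmod y ^ 4)" and \<delta>: "\<delta> > 0" and N: "N > 0" and K: "K \<le> 2 * N"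
  shows "emeasure (PiM (grid N {..<K}) (\<lambda>_. mu))
      {x \<in> space (PiM (grid N {..<K}) (\<lambda>_. mu)). \<exists>p\<in>grid N {..<K}. (cmod (x p))\<^sup>2 > \<delta> * real N}
    \<le> ennreal (2 / \<delta>\<^sup>2 * (\<integral>z. cmod z ^ 4 * indicator {z. (cmod z)\<^sup>2 > \<delta> * real N} z \<partial>mu))"
proof -
  let ?I = "grid N {..<K}" and ?P = "PiM (grid N {..<K}) (\<lambda>_. mu)"
  let ?S = "{z. (cmod z)\<^sup>2 > \<delta> * real N}"
  let ?h = "\<lambda>z. cmod z ^ 4 * indicator ?S z :: real"
  interpret P: product_prob_space "\<lambda>_::nat \<times> nat. mu" ?I by (rule product_prob_space_const)
  have S[measurable]: "?S \<in> sets mu" unfolding sets_mu by measurable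
  have \<delta>N: "\<delta> * real N > 0" using \<delta> N by simp
  have ih: "integrable mu ?h"
    by (rule Bochner_Integration.integrable_bound[OF i4]) (auto simp: indicator_def)
  have one: "emeasure mu ?S \<le> ennreal (1 / (\<delta> * real N)\<^sup>2 * (\<integral>z. ?h z \<partial>mu))"
  proof -
    have "emeasure mu ?S = (\<integral>\<^sup>+z. indicator ?S z \<partial>mu)" by simp
    also have "\<dots> \<le> (\<integral>\<^sup>+z. ennreal (1 / (\<delta> * real N)\<^sup>2 * ?h z) \<partial>mu)"
    proof (rule nn_integral_mono)
      fix z
      show "indicator ?S z \<le> ennreal (1 / (\<delta> * real N)\<^sup>2 * ?h z)"
      proof (cases "z \<in> ?S")
        case True
        then have "(\<delta> * real N)\<^sup>2 \<le> ((cmod z)\<^sup>2)\<^sup>2" using \<delta>N by (intro power_mono) auto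
        then have "1 \<le> 1 / (\<delta> * real N)\<^sup>2 * ?h z" using True \<delta> N by (simp add: le_divide_eq)
        then have "ennreal 1 \<le> ennreal (1 / (\<delta> * real N)\<^sup>2 * ?h z)" by (rule ennreal_leI)
        then show ?thesis using True by simp
      qed simp
    qed
    also have "\<dots> = ennreal (\<integral>z. 1 / (\<delta> * real N)\<^sup>2 * ?h z \<partial>mu)"
      by (rule nn_integral_eq_integral) (use ih in auto)
    finally show ?thesis by simp
  qed
  have "{x \<in> space ?P. \<exists>p\<in>?I. (cmod (x p))\<^sup>2 > \<delta> * real N} = (\<Union>p\<in>?I. {x \<in> space ?P. x p \<in> ?S})" by auto
  then have "emeasure ?P {x \<in> space ?P. \<exists>p\<in>?I. (cmod (x p))\<^sup>2 > \<delta> * real N}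
      \<le> (\<Sum>p\<in>?I. emeasure ?P {x \<in> space ?P. x p \<in> ?S})"
    by (simp only:) (rule emeasure_subadditive_finite, auto)
  also have "\<dots> = (\<Sum>p\<in>?I. emeasure mu ?S)"
    by (intro sum.cong refl P.emeasure_PiM_Collect_single) auto
  also have "\<dots> \<le> (\<Sum>p\<in>?I. ennreal (1 / (\<delta> * real N)\<^sup>2 * (\<integral>z. ?h z \<partial>mu)))"
    by (intro sum_mono one)
  also have "\<dots> = ennreal (real (N * K) * (1 / (\<delta> * real N)\<^sup>2 * (\<integral>z. ?h z \<partial>mu)))"
    by (simp add: ennreal_of_nat_eq_real_of_nat ennreal_mult'[symmetric])
  also have "\<dots> \<le> ennreal (2 / \<delta>\<^sup>2 * (\<integral>z. ?h z \<partial>mu))"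
  proof (rule ennreal_leI)
    have "real (N * K) \<le> 2 * (real N)\<^sup>2" 
    proof -
      have "real K \<le> 2 * real N" using K by linarith
      then have "real N * real K \<le> real N * (2 * real N)" by (rule mult_left_mono) simp
      then show ?thesis by (simp add: power2_eq_square)
    qed
    then have "real (N * K) * (1 / (\<delta> * real N)\<^sup>2 * (\<integral>z. ?h z \<partial>mu)) \<le> 2 * (real N)\<^sup>2 * (1 / (\<delta> * real N)\<^sup>2
        * (\<integral>z. ?h z \<partial>mu))"
      by (intro mult_right_mono) auto
    also have "\<dots> = 2 / \<delta>\<^sup>2 * (\<integral>z. ?h z \<partial>mu)" using N by (simp add: power_mult_distrib)
    finally show "real (N * K) * (1 / (\<delta> * real N)\<^sup>2 * (\<integral>z. ?h z \<partial>mu)) \<le> 2 / \<delta>\<^sup>2 * (\<integral>z. ?h z \<partial>mu)" .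
  qed
  finally show ?thesis .
qed

lemma diag_deviation_rate:
  fixes A :: "'i set" and c :: "'i \<Rightarrow> real"
  assumes A: "finite A" "card A = N" "N > 0" and c: "\<And>a. a \<in> A \<Longrightarrow> \<bar>c a\<bar> \<le> 1"
    and i4: "integrable mu (\<lambda>y. cmod y ^ 4)" and \<kappa>: "(\<integral>y. cmod y ^ 4 \<partial>mu) \<le> \<kappa>"
    and \<epsilon>: "\<epsilon> > 0"
  shows "emeasure (PiM A (\<lambda>_. mu))
      {x \<in> space (PiM A (\<lambda>_. mu)). \<bar>\<Sum>a\<in>A. c a * ((cmod (x a))\<^sup>2 - 1)\<bar> > \<epsilon> * real N \<and> (\<forall>a\<in>A. (cmod (x a))\<^sup>2 + 1
          \<le> \<epsilon> / 8 * real N)}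
    \<le> ennreal (2 * chernoff_rate (16 * \<kappa> / \<epsilon>\<^sup>2) N)"
proof -
  \<comment> \<open>Chosen so that t \<epsilon> = 4 ln N, while t times the cut-off \<epsilon>/8 is
    ln N / 2 and exp (t b) stays at sqrt N.\<close>
  let ?t = "4 / \<epsilon> * ln (real N)"
  have "A \<noteq> {}" using A by auto
  have t: "?t \<ge> 0" using \<epsilon> A by simp
  have e1: "- ?t * \<epsilon> = - 4 * ln (real N)" using \<epsilon> by simp
  have e2: "?t * (\<epsilon> / 8) = ln (real N) / 2" using \<epsilon> by simp
  have e3: "?t\<^sup>2 * exp (ln (real N) / 2) * (\<kappa> / real N) = 16 * \<kappa> / \<epsilon>\<^sup>2 * (ln (real N))\<^sup>2 * exp (ln (real N)
      / 2) / real N"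
    using \<epsilon> by (simp add: power_mult_distrib power_divide)
  have "2 * ennreal (exp (- ?t * \<epsilon> + ?t\<^sup>2 * exp (?t * (\<epsilon> / 8)) * (\<kappa> / real N)))
      = ennreal (2 * chernoff_rate (16 * \<kappa> / \<epsilon>\<^sup>2) N)"
    unfolding e1 e2 e3 chernoff_rate_def by (simp add: ennreal_mult')
  then show ?thesis
    using diag_deviation[OF A(1) \<open>A \<noteq> {}\<close> c i4 \<kappa> t, where b = "\<epsilon> / 8" and \<epsilon> = \<epsilon>] \<epsilon> unfolding A(2) by simp
qed

lemma linear_form_deviation_rate:
  fixes A :: "'i set"
  assumes A: "finite A" "N > 0" and v: "(\<Sum>a\<in>A. (cmod (v a))\<^sup>2) \<le> 2 * real N" and \<epsilon>: "\<epsilon> > 0"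
  shows "emeasure (PiM A (\<lambda>_. mu))
      {x \<in> space (PiM A (\<lambda>_. mu)). cmod (\<Sum>a\<in>A. cnj (x a) * v a) > \<epsilon> * real N \<and> (\<forall>a\<in>A. (cmod (x a))\<^sup>2 * 2
          \<le> (\<epsilon> / 16)\<^sup>2 * real N)}
    \<le> ennreal (4 * chernoff_rate (128 / \<epsilon>\<^sup>2) N)"
proof -
  \<comment> \<open>Real and imaginary parts get \<epsilon>/2 each, hence twice the tilt and half
    the cut-off of the diagonal case; 128 = 8^2 * 2 with V = 2.\<close>
  let ?t = "8 / \<epsilon> * ln (real N)"
  have t: "?t \<ge> 0" using \<epsilon> A by simp
  have e1: "- ?t * (\<epsilon> / 2) = - 4 * ln (real N)" using \<epsilon> by simp
  have e2: "?t * (\<epsilon> / 16) = ln (real N) / 2" using \<epsilon> by simp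
  have e3: "?t\<^sup>2 * exp (ln (real N) / 2) * (2 / real N) = 128 / \<epsilon>\<^sup>2 * (ln (real N))\<^sup>2 * exp (ln (real N) / 2)
      / real N"
    using \<epsilon> by (simp add: power_mult_distrib power_divide)
  have "4 * ennreal (exp (- ?t * (\<epsilon> / 2) + ?t\<^sup>2 * exp (?t * (\<epsilon> / 16)) * (2 / real N)))
      = ennreal (4 * chernoff_rate (128 / \<epsilon>\<^sup>2) N)"
    unfolding e1 e2 e3 chernoff_rate_def by (simp add: ennreal_mult')
  then show ?thesis
    using linear_form_deviation[OF A(1) _ v t, where b = "\<epsilon> / 16" and \<epsilon> = \<epsilon>] A \<epsilon> by simp
qed

text \<open>Off-diagonal and diagonal part get \<epsilon> each. The diagonal part is exponentially
  controlled thanks to the small entries; the off-diagonal part has only its fourth moment and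
  limits the whole to O(N^(-2)).\<close>

lemma quad_deviation:
  assumes N: "N > 0" and \<gamma>: "\<gamma> > 0" and i: "i < K" and J: "J \<subseteq> {..<K} - {i}"
    and i4: "integrable mu (\<lambda>y. cmod y ^ 4)" and \<kappa>: "\<kappa> \<ge> 1" "(\<integral>y. cmod y ^ 4 \<partial>mu) \<le> \<kappa>"
    and \<epsilon>: "\<epsilon> > 0" and \<delta>: "\<delta> * real N + 1 \<le> \<epsilon> / 8 * real N"
  shows "emeasure (PiM (grid N {..<K}) (\<lambda>_. mu))
      {x \<in> space (PiM (grid N {..<K}) (\<lambda>_. mu)).
         \<bar>quad N \<gamma> J i x - ntrace N \<gamma> J x\<bar> > 2 * \<epsilon> \<and> (\<forall>p\<in>grid N {i}. (cmod (x p))\<^sup>2 \<le> \<delta> * real N)}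
    \<le> ennreal (12 * \<kappa> * (256 + 48 * \<kappa>) / \<epsilon> ^ 4 / (real N)\<^sup>2 + 2 * chernoff_rate (16 * \<kappa> / \<epsilon>\<^sup>2) N)"
    (is "emeasure ?P ?E \<le> ennreal (?c1 + ?c2)")
proof (rule grid_emeasure_le[OF i])
  have fJ: "finite J" using J finite_subset by blast
  show "?E \<in> sets ?P"
  proof -
    have [measurable]: "(\<lambda>x. quad N \<gamma> J i x) \<in> borel_measurable ?P" "(\<lambda>x. ntrace N \<gamma> J x) \<in> borel_measurable ?P"
      using i J fJ by (auto intro!: quad_measurable ntrace_measurable grid_component)
    have [measurable]: "(\<lambda>x. x p) \<in> borel_measurable ?P" if "p \<in> grid N {i}" for p
      using that i by (cases p) (auto intro!: grid_component)
    show ?thesis by measurable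
  qed
  fix z assume z: "z \<in> space (PiM (grid N ({..<K} - {i})) (\<lambda>_. mu))"
  let ?A = "grid N {i}"
  let ?C = "column_matrix N \<gamma> J z"
  let ?Y = "PiM ?A (\<lambda>_. mu)"
  let ?m = "\<lambda>y. merge (grid N ({..<K} - {i})) ?A (z, y)"
  have C: "hermitian_contraction_on ?A ?C" by (rule column_matrix_contraction[OF N \<gamma> fJ])
  have A: "finite ?A" "?A \<noteq> {}" "card ?A = N" using N by auto
  let ?D1 = "{y \<in> space ?Y. cmod (offdiag ?C ?A y) > \<epsilon> * real N}"
  let ?D2 = "{y \<in> space ?Y. \<bar>\<Sum>p\<in>?A. Re (?C p p) * ((cmod (y p))\<^sup>2 - 1)\<bar> > \<epsilon> * real N \<and> (\<forall>p\<in>?A. (cmod (y p))\<^sup>2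
      + 1 \<le> \<epsilon> / 8 * real N)}"
  have D1: "emeasure ?Y ?D1 \<le> ennreal ?c1"
    using offdiag_deviation[OF A(1,2) C i4 \<kappa> \<epsilon>] unfolding A(3) .
  have D2: "emeasure ?Y ?D2 \<le> ennreal ?c2"
    by (rule diag_deviation_rate[OF A(1,3) N hermitian_contraction_on_diag[OF A(1) C] i4 \<kappa>(2) \<epsilon>])
  have Dm: "?D1 \<in> sets ?Y" "?D2 \<in> sets ?Y" by measurable
  show "\<exists>D \<in> sets ?Y. (\<forall>y \<in> space ?Y. ?m y \<in> ?E \<longrightarrow> y \<in> D) \<and> emeasure ?Y D \<le> ennreal (?c1 + ?c2)"
  proof (intro bexI[of _ "?D1 \<union> ?D2"] conjI ballI impI)
    show "?D1 \<union> ?D2 \<in> sets ?Y" using Dm by (rule sets.Un)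
    have "emeasure ?Y (?D1 \<union> ?D2) \<le> emeasure ?Y ?D1 + emeasure ?Y ?D2" by (rule emeasure_subadditive[OF Dm])
    also have "\<dots> \<le> ennreal ?c1 + ennreal ?c2" by (rule add_mono[OF D1 D2])
    also have "\<dots> = ennreal (?c1 + ?c2)"
      using \<epsilon> \<kappa> by (intro ennreal_plus[symmetric]) (auto simp: chernoff_rate_def)
    finally show "emeasure ?Y (?D1 \<union> ?D2) \<le> ennreal (?c1 + ?c2)" .
    fix y assume y: "y \<in> space ?Y" and E: "?m y \<in> ?E"
    have my: "?m y p = y p" if "p \<in> ?A" for p using that by (auto simp: merge_def)
    have "real N * \<bar>quad N \<gamma> J i (?m y) - ntrace N \<gamma> J (?m y)\<bar> = \<bar>Re (qform ?C ?A y) - (\<Sum>p\<in>?A. Re (?C p p))\<bar>"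
      unfolding merge_quad[OF N \<gamma> J z, symmetric] column_matrix_trace[OF N] merge_ntrace[OF N \<gamma> J z]
      by (simp add: abs_mult flip: right_diff_distrib)
    also have "\<dots> \<le> cmod (offdiag ?C ?A y) + \<bar>\<Sum>p\<in>?A. Re (?C p p) * ((cmod (y p))\<^sup>2 - 1)\<bar>"
      unfolding qform_centred[OF A(1) C] using abs_Re_le_cmod[of "offdiag ?C ?A y"] by linarith
    finally have le: "real N * \<bar>quad N \<gamma> J i (?m y) - ntrace N \<gamma> J (?m y)\<bar>
      \<le> cmod (offdiag ?C ?A y) + \<bar>\<Sum>p\<in>?A. Re (?C p p) * ((cmod (y p))\<^sup>2 - 1)\<bar>" .
    have "real N * (2 * \<epsilon>) < real N * \<bar>quad N \<gamma> J i (?m y) - ntrace N \<gamma> J (?m y)\<bar>"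
      using E N by (intro mult_strict_left_mono) auto
    then have "cmod (offdiag ?C ?A y) > \<epsilon> * real N \<or> \<bar>\<Sum>p\<in>?A. Re (?C p p) * ((cmod (y p))\<^sup>2 - 1)\<bar> > \<epsilon> * real N"
      using le by (simp add: algebra_simps) linarith
    moreover have "(cmod (y p))\<^sup>2 + 1 \<le> \<epsilon> / 8 * real N" if "p \<in> ?A" for p
    proof -
      have "(cmod (?m y p))\<^sup>2 \<le> \<delta> * real N" using E that by blast
      then show ?thesis using \<delta> unfolding my[OF that] by linarith
    qed
    ultimately show "y \<in> ?D1 \<union> ?D2" using y by auto
  qed
qed

text \<open>A squared norm above 2 N is a deviation by more than N of the diagonal form with unit
  coefficients, the case \<epsilon> = 1. It prepares the bound on the coefficients of cross
  terms.\<close>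

lemma column_norm_deviation:
  assumes N: "N > 0" and i: "i < K"
    and i4: "integrable mu (\<lambda>y. cmod y ^ 4)" and \<kappa>: "(\<integral>y. cmod y ^ 4 \<partial>mu) \<le> \<kappa>"
    and \<delta>: "\<delta> * real N + 1 \<le> 1 / 8 * real N"
  shows "emeasure (PiM (grid N {..<K}) (\<lambda>_. mu))
      {x \<in> space (PiM (grid N {..<K}) (\<lambda>_. mu)).
         nrm2 N (channel_columns x i) > 2 * real N \<and> (\<forall>p\<in>grid N {i}. (cmod (x p))\<^sup>2 \<le> \<delta> * real N)}
    \<le> ennreal (2 * chernoff_rate (16 * \<kappa>) N)"
    (is "emeasure ?P ?E \<le> ennreal ?c")
proof (rule grid_emeasure_le[OF i])
  have n: "nrm2 N (channel_columns x i) = (\<Sum>p\<in>grid N {i}. (cmod (x p))\<^sup>2)" for x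
    unfolding sum_grid_column by (simp add: nrm2_def channel_columns_def)
  show "?E \<in> sets ?P"
  proof -
    have [measurable]: "(\<lambda>x. x p) \<in> borel_measurable ?P" if "p \<in> grid N {i}" for p
      using that i by (cases p) (auto intro!: grid_component)
    have [measurable]: "(\<lambda>x. nrm2 N (channel_columns x i)) \<in> borel_measurable ?P"
      unfolding n by (intro borel_measurable_sum) measurable
    show ?thesis by measurable
  qed
  fix z assume "z \<in> space (PiM (grid N ({..<K} - {i})) (\<lambda>_. mu))"
  let ?A = "grid N {i}"
  let ?Y = "PiM ?A (\<lambda>_. mu)"
  let ?m = "\<lambda>y. merge (grid N ({..<K} - {i})) ?A (z, y)"
  have A: "finite ?A" "card ?A = N" using N by auto
  let ?D = "{y \<in> space ?Y. \<bar>\<Sum>p\<in>?A. 1 * ((cmod (y p))\<^sup>2 - 1)\<bar> > 1 * real N \<and> (\<forall>p\<in>?A. (cmod (y p))\<^sup>2 + 1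
      \<le> 1 / 8 * real N)}"
  have D: "emeasure ?Y ?D \<le> ennreal ?c"
    using diag_deviation_rate[OF A N _ i4 \<kappa>, of "\<lambda>_. 1" 1] by simp
  show "\<exists>D \<in> sets ?Y. (\<forall>y \<in> space ?Y. ?m y \<in> ?E \<longrightarrow> y \<in> D) \<and> emeasure ?Y D \<le> ennreal ?c"
  proof (intro bexI[of _ ?D] conjI ballI impI)
    show "?D \<in> sets ?Y" by measurable
    show "emeasure ?Y ?D \<le> ennreal ?c" by (rule D)
    fix y assume y: "y \<in> space ?Y" and E: "?m y \<in> ?E"
    have my: "?m y p = y p" if "p \<in> ?A" for p using that by (auto simp: merge_def)
    have "nrm2 N (channel_columns (?m y) i) = (\<Sum>p\<in>?A. (cmod (y p))\<^sup>2)" unfolding n using my by (intro sum.cong) auto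
    moreover have "nrm2 N (channel_columns (?m y) i) > 2 * real N" using E by blast
    ultimately have "(\<Sum>p\<in>?A. 1 * ((cmod (y p))\<^sup>2 - 1)) > real N"
      by (simp add: sum_subtractf)
    moreover have "(cmod (y p))\<^sup>2 + 1 \<le> 1 / 8 * real N" if "p \<in> ?A" for p
    proof -
      have "(cmod (?m y p))\<^sup>2 \<le> \<delta> * real N" using E that by blast
      then show ?thesis using \<delta> unfolding my[OF that] by linarith
    qed
    ultimately show "y \<in> ?D" using y by auto
  qed
qed

text \<open>The coefficient vector C x_j has squared norm at most that of x_j, hence at most 2 N on
  the event. Column j is among the columns held fixed, so the restriction on its norm either holds
  whatever column i is, or leaves the section empty.\<close>

lemma cross_deviation:
  assumes N: "N > 0" and \<gamma>: "\<gamma> > 0" and i: "i < K" and j: "j < K" "j \<noteq> i" and J: "J \<subseteq> {..<K} - {i}"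
    and \<epsilon>: "\<epsilon> > 0" and \<delta>: "\<delta> * 2 \<le> (\<epsilon> / 16)\<^sup>2"
  shows "emeasure (PiM (grid N {..<K}) (\<lambda>_. mu))
      {x \<in> space (PiM (grid N {..<K}) (\<lambda>_. mu)).
         cross N \<gamma> J i j x > \<epsilon> \<and> nrm2 N (channel_columns x j) \<le> 2 * real N \<and> (\<forall>p\<in>grid N {i}. (cmod (x p))\<^sup>2
             \<le> \<delta> * real N)}
    \<le> ennreal (4 * chernoff_rate (128 / \<epsilon>\<^sup>2) N)"
    (is "emeasure ?P ?E \<le> ennreal ?c")
proof (rule grid_emeasure_le[OF i])
  have fJ: "finite J" using J finite_subset by blast
  show "?E \<in> sets ?P"
  proof -
    have [measurable]: "(\<lambda>x. cross N \<gamma> J i j x) \<in> borel_measurable ?P"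
      using i j J fJ by (auto intro!: cross_measurable grid_component)
    have [measurable]: "(\<lambda>x. x p) \<in> borel_measurable ?P" if "p \<in> grid N {i}" for p
      using that i by (cases p) (auto intro!: grid_component)
    have [measurable]: "(\<lambda>x. nrm2 N (channel_columns x j)) \<in> borel_measurable ?P"
    proof -
      have [measurable]: "(\<lambda>x. x (a, j)) \<in> borel_measurable ?P" if "a \<in> {..<N}" for a
        using that j by (intro grid_component) auto
      show ?thesis unfolding nrm2_def channel_columns_def by (intro borel_measurable_sum) measurable
    qed
    show ?thesis by measurable
  qed
  fix z assume z: "z \<in> space (PiM (grid N ({..<K} - {i})) (\<lambda>_. mu))"
  let ?A = "grid N {i}"
  let ?Y = "PiM ?A (\<lambda>_. mu)"
  let ?m = "\<lambda>y. merge (grid N ({..<K} - {i})) ?A (z, y)"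
  let ?v = "\<lambda>p::nat \<times> nat. resolvent N (\<gamma> / real N) (channel_columns z) J (channel_columns z j) (fst p)"
  show "\<exists>D \<in> sets ?Y. (\<forall>y \<in> space ?Y. ?m y \<in> ?E \<longrightarrow> y \<in> D) \<and> emeasure ?Y D \<le> ennreal ?c"
  proof (cases "nrm2 N (channel_columns z j) \<le> 2 * real N")
    case True
    have "(\<Sum>p\<in>?A. (cmod (?v p))\<^sup>2) = nrm2 N (resolvent N (\<gamma> / real N) (channel_columns z) J (channel_columns z j))"
      unfolding sum_grid_column nrm2_def by simp
    also have "\<dots> \<le> nrm2 N (channel_columns z j)" by (rule nrm2_resolvent_le[OF gN[OF N \<gamma>] fJ])
    finally have v: "(\<Sum>p\<in>?A. (cmod (?v p))\<^sup>2) \<le> 2 * real N" using True by linarith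
    let ?D = "{y \<in> space ?Y. cmod (\<Sum>p\<in>?A. cnj (y p) * ?v p) > \<epsilon> * real N \<and> (\<forall>p\<in>?A. (cmod (y p))\<^sup>2 * 2
        \<le> (\<epsilon> / 16)\<^sup>2 * real N)}"
    show ?thesis
    proof (intro bexI[of _ ?D] conjI ballI impI)
      show "?D \<in> sets ?Y" by measurable
      show "emeasure ?Y ?D \<le> ennreal ?c"
        by (rule linear_form_deviation_rate[OF _ N v \<epsilon>]) simp
      fix y assume y: "y \<in> space ?Y" and E: "?m y \<in> ?E"
      have my: "?m y p = y p" if "p \<in> ?A" for p using that by (auto simp: merge_def)
      have "real N * \<epsilon> < real N * cross N \<gamma> J i j (?m y)"
        using E N by (intro mult_strict_left_mono) auto
      then have "cmod (\<Sum>p\<in>?A. cnj (y p) * ?v p) > \<epsilon> * real N"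
        unfolding merge_cross[OF N \<gamma> J z j] by (simp add: mult.commute)
      moreover have "(cmod (y p))\<^sup>2 * 2 \<le> (\<epsilon> / 16)\<^sup>2 * real N" if "p \<in> ?A" for p
      proof -
        have "(cmod (?m y p))\<^sup>2 \<le> \<delta> * real N" using E that by blast
        then have "(cmod (y p))\<^sup>2 * 2 \<le> (\<delta> * 2) * real N" unfolding my[OF that] by simp
        also have "\<dots> \<le> (\<epsilon> / 16)\<^sup>2 * real N" using \<delta> by (intro mult_right_mono) auto
        finally show ?thesis .
      qed
      ultimately show "y \<in> ?D" using y by blast
    qed
  next
    case False
    have "?m y \<notin> ?E" for y
      using False merge_columns[OF z j, of y] by auto
    then show ?thesis by (intro bexI[of _ "{}"]) auto
  qed
qed

end

text \<open>For one user the error in t is at most \<gamma> \<epsilon> from re-inserting the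
  partner, where \<epsilon>^2 \<le> \<epsilon> bounds the squared cross term, 2 \<epsilon> from the
  form, \<epsilon> from the trace and 1/N from the missing column. Twice \<gamma> times this, plus
  \<gamma> \<epsilon> for the cross term itself, gives 2 \<gamma>^2 + 7 \<gamma>.\<close>

lemma pair_error_le:
  assumes N: "N > 0" and \<gamma>: "\<gamma> > 0" and ij: "i < K" "j < K" "i \<noteq> j" and \<epsilon>: "0 < \<epsilon>" "\<epsilon> \<le> 1"
    and s: "\<bar>ntrace N \<gamma> {..<K} x - t\<bar> \<le> \<epsilon>"
    and q: "\<And>k. k < K \<Longrightarrow> \<bar>quad N \<gamma> ({..<K} - {k}) k x - ntrace N \<gamma> ({..<K} - {k}) x\<bar> \<le> 2 * \<epsilon>"
    and c: "cross N \<gamma> ({..<K} - {i, j}) i j x \<le> \<epsilon>" "cross N \<gamma> ({..<K} - {i, j}) j i x \<le> \<epsilon>"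
  shows "pair_error N \<gamma> K (\<gamma> * t) i j x \<le> \<epsilon> * (2 * \<gamma>\<^sup>2 + 7 * \<gamma>) + 2 * \<gamma> / real N"
proof -
  let ?J = "{..<K} - {i, j}"
  have single: "\<bar>\<gamma> * quad N \<gamma> ?J k x - \<gamma> * t\<bar> \<le> \<gamma> * (\<gamma> * \<epsilon> + 3 * \<epsilon> + 1 / real N)"
    if k: "k < K" "insert l ?J = {..<K} - {k}" "l \<notin> ?J" and cr: "cross N \<gamma> ?J k l x \<le> \<epsilon>" for k l
  proof -
    have "(cross N \<gamma> ?J k l x)\<^sup>2 \<le> \<epsilon>\<^sup>2" using cr by (intro power_mono) (auto simp: cross_def)
    also have "\<dots> \<le> \<epsilon>" using \<epsilon> by (simp add: power2_eq_square mult_left_le)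
    finally have "\<gamma> * (cross N \<gamma> ?J k l x)\<^sup>2 \<le> \<gamma> * \<epsilon>" using \<gamma> by (intro mult_left_mono) auto
    then have "\<bar>quad N \<gamma> ({..<K} - {k}) k x - quad N \<gamma> ?J k x\<bar> \<le> \<gamma> * \<epsilon>"
      using quad_insert[OF N \<gamma> _ k(3), of k x] k(2) by simp
    moreover have "insert k ({..<K} - {k}) = {..<K}" using k(1) by auto
    then have "\<bar>ntrace N \<gamma> {..<K} x - ntrace N \<gamma> ({..<K} - {k}) x\<bar> \<le> 1 / real N"
      using ntrace_insert[OF N \<gamma>, of "{..<K} - {k}" k x] by simp
    ultimately have "\<bar>quad N \<gamma> ?J k x - t\<bar> \<le> \<gamma> * \<epsilon> + 3 * \<epsilon> + 1 / real N"
      using s q[OF k(1)] by linarith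
    then have "\<gamma> * \<bar>quad N \<gamma> ?J k x - t\<bar> \<le> \<gamma> * (\<gamma> * \<epsilon> + 3 * \<epsilon> + 1 / real N)"
      using \<gamma> by (intro mult_left_mono) auto
    then show ?thesis using \<gamma> by (simp add: abs_mult flip: right_diff_distrib)
  qed
  have "\<bar>\<gamma> * quad N \<gamma> ?J i x - \<gamma> * t\<bar> \<le> \<gamma> * (\<gamma> * \<epsilon> + 3 * \<epsilon> + 1 / real N)"
    by (rule single[of i j]) (use ij c in auto)
  moreover have "\<bar>\<gamma> * quad N \<gamma> ?J j x - \<gamma> * t\<bar> \<le> \<gamma> * (\<gamma> * \<epsilon> + 3 * \<epsilon> + 1 / real N)"
    by (rule single[of j i]) (use ij c in auto)
  moreover have "\<gamma> * cross N \<gamma> ?J i j x \<le> \<gamma> * \<epsilon>" using c(1) \<gamma> by (intro mult_left_mono) auto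
  moreover have "\<gamma> * (\<gamma> * \<epsilon> + 3 * \<epsilon> + 1 / real N) + \<gamma> * (\<gamma> * \<epsilon> + 3 * \<epsilon> + 1 / real N) + \<gamma> * \<epsilon>
      = \<epsilon> * (2 * \<gamma>\<^sup>2 + 7 * \<gamma>) + 2 * \<gamma> / real N"
    by (simp add: power2_eq_square algebra_simps)
  ultimately show ?thesis unfolding pair_error_def by linarith
qed

lemma emeasure_UN_finite_le:
  assumes "finite I" "\<And>i. i \<in> I \<Longrightarrow> E i \<in> sets M" "\<And>i. i \<in> I \<Longrightarrow> emeasure M (E i) \<le> ennreal c" "real (card I) * c
      \<le> d" "c \<ge> 0"
  shows "emeasure M (\<Union>i\<in>I. E i) \<le> ennreal d"
proof -
  have "emeasure M (\<Union>i\<in>I. E i) \<le> (\<Sum>i\<in>I. emeasure M (E i))"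
    using assms(1,2) by (intro emeasure_subadditive_finite) auto
  also have "\<dots> \<le> (\<Sum>i\<in>I. ennreal c)" using assms(3) by (rule sum_mono)
  also have "\<dots> = ennreal (real (card I) * c)" using assms(5)
      by (simp add: ennreal_of_nat_eq_real_of_nat ennreal_mult'[symmetric])
  also have "\<dots> \<le> ennreal d" by (intro ennreal_leI assms(4))
  finally show ?thesis .
qed

context unit_law
begin

text \<open>The summands bound the probabilities of a large entry, of a bad trace and, by union over
  columns or pairs, of a bad form, a long column and a large cross term. The last three events
  demand small entries only in the column integrated over, so that each can be bounded with the
  other columns fixed; outside the first event this demand is met automatically.\<close>

lemma pair_error_uniform_bound:
  assumes \<gamma>: "\<gamma> > 0" and \<epsilon>: "0 < \<epsilon>" "\<epsilon> \<le> 1"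
    and i4: "integrable mu (\<lambda>y. cmod y ^ 4)" and \<kappa>: "\<kappa> \<ge> 1" "(\<integral>y. cmod y ^ 4 \<partial>mu) \<le> \<kappa>"
    and N: "N > 0" "1 \<le> \<epsilon> / 16 * real N" and K: "K \<le> 2 * N"
    and s: "(\<integral>\<^sup>+x. ennreal \<bar>ntrace N \<gamma> {..<K} x - t\<bar> \<partial>PiM (grid N {..<K}) (\<lambda>_. mu)) \<le> ennreal d" and d: "d \<ge> 0"
  defines "\<delta> \<equiv> \<epsilon>\<^sup>2 / 512"
  shows "emeasure (PiM (grid N {..<K}) (\<lambda>_. mu))
      {x \<in> space (PiM (grid N {..<K}) (\<lambda>_. mu)). \<exists>i<K. \<exists>j<K. i \<noteq> j \<and>
         pair_error N \<gamma> K (\<gamma> * t) i j x > \<epsilon> * (2 * \<gamma>\<^sup>2 + 7 * \<gamma>) + 2 * \<gamma> / real N}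
    \<le> ennreal (2 / \<delta>\<^sup>2 * (\<integral>z. cmod z ^ 4 * indicator {z. (cmod z)\<^sup>2 > \<delta> * real N} z \<partial>mu) + d / \<epsilon>
        + 2 * real N * (12 * \<kappa> * (256 + 48 * \<kappa>) / \<epsilon> ^ 4 / (real N)\<^sup>2 + 2 * chernoff_rate (16 * \<kappa> / \<epsilon>\<^sup>2) N)
        + 2 * real N * (2 * chernoff_rate (16 * \<kappa>) N) + 4 * (real N)\<^sup>2 * (4 * chernoff_rate (128 / \<epsilon>\<^sup>2) N))"
proof -
  let ?I = "grid N {..<K}"
  let ?P = "PiM ?I (\<lambda>_. mu)"
  let ?T = "\<integral>z. cmod z ^ 4 * indicator {z. (cmod z)\<^sup>2 > \<delta> * real N} z \<partial>mu"
  let ?c2 = "12 * \<kappa> * (256 + 48 * \<kappa>) / \<epsilon> ^ 4 / (real N)\<^sup>2 + 2 * chernoff_rate (16 * \<kappa> / \<epsilon>\<^sup>2) N"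
  let ?c3 = "2 * chernoff_rate (16 * \<kappa>) N" and ?c4 = "4 * chernoff_rate (128 / \<epsilon>\<^sup>2) N"
  let ?Jk = "\<lambda>k. {..<K} - {k}" and ?Jp = "\<lambda>p. {..<K} - {fst p, snd p}"
  define small where "small i x \<longleftrightarrow> (\<forall>p\<in>grid N {i}. (cmod (x p))\<^sup>2 \<le> \<delta> * real N)" for i and x :: "nat \<times> nat \<Rightarrow> complex"
  define B0 where "B0 = {x \<in> space ?P. \<exists>p\<in>?I. (cmod (x p))\<^sup>2 > \<delta> * real N}"
  define B1 where "B1 = {x \<in> space ?P. \<bar>ntrace N \<gamma> {..<K} x - t\<bar> > \<epsilon>}"
  define B2 where "B2 k = {x \<in> space ?P. \<bar>quad N \<gamma> (?Jk k) k x - ntrace N \<gamma> (?Jk k) x\<bar> > 2 * \<epsilon> \<and> small k x}" for k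
  define B3 where "B3 k = {x \<in> space ?P. nrm2 N (channel_columns x k) > 2 * real N \<and> small k x}" for k
  define B4 where "B4 p = {x \<in> space ?P. cross N \<gamma> (?Jp p) (fst p) (snd p) x > \<epsilon>
      \<and> nrm2 N (channel_columns x (snd p)) \<le> 2 * real N \<and> small (fst p) x}" for p
  define pairs where "pairs = {p \<in> {..<K} \<times> {..<K}. snd p \<noteq> fst p}"
  have fp: "finite pairs" by (simp add: pairs_def)
  \<comment> \<open>512 = 2 * 16^2, so that 2 \<delta> is exactly the square of the cut-off
    \<epsilon>/16 for linear forms. As \<epsilon> \<le> 1, the level \<delta> N also fits below the
    cut-offs for diagonal parts, with \<open>N(2)\<close> leaving room for the additional 1.\<close>
  have \<delta>0: "\<delta> > 0" using \<epsilon> by (simp add: \<delta>_def)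
  have "\<epsilon>\<^sup>2 \<le> \<epsilon>" using \<epsilon> by (simp add: power2_eq_square mult_left_le)
  then have "\<delta> * real N \<le> \<epsilon> / 512 * real N" unfolding \<delta>_def by (intro mult_right_mono divide_right_mono) auto
  moreover have "\<epsilon> / 8 * real N = 2 * (\<epsilon> / 16 * real N)" "\<epsilon> / 512 * real N = \<epsilon> / 16 * real N / 32" by simp_all
  ultimately have \<delta>1: "\<delta> * real N + 1 \<le> \<epsilon> / 8 * real N" using N(2) by linarith
  have "\<epsilon> / 8 * real N \<le> 1 / 8 * real N" using \<epsilon> by (intro mult_right_mono) auto
  then have \<delta>2: "\<delta> * real N + 1 \<le> 1 / 8 * real N" using \<delta>1 by linarith
  have \<delta>3: "\<delta> * 2 \<le> (\<epsilon> / 16)\<^sup>2" by (simp add: \<delta>_def power_divide)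
  have T0: "?T \<ge> 0" by simp
  have r0: "chernoff_rate a N \<ge> 0" for a by (simp add: chernoff_rate_def)
  have K2: "real K \<le> 2 * real N" using K by linarith
  have xm[measurable]: "(\<lambda>x. x p) \<in> borel_measurable ?P" if "p \<in> ?I" for p
    using that by (cases p) (auto intro!: grid_component)
  have smallm: "Measurable.pred ?P (small k)" if "k < K" for k
  proof -
    have [measurable]: "(\<lambda>x. x p) \<in> borel_measurable ?P" if "p \<in> grid N {k}" for p
      using that \<open>k < K\<close> by (intro xm) auto
    show ?thesis unfolding small_def by measurable
  qed
  have nm: "(\<lambda>x. nrm2 N (channel_columns x k)) \<in> borel_measurable ?P" if "k < K" for k
  proof -
    have [measurable]: "(\<lambda>x. x (a, k)) \<in> borel_measurable ?P" if "a \<in> {..<N}" for a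
      using that \<open>k < K\<close> by (intro xm) auto
    show ?thesis unfolding nrm2_def channel_columns_def by (intro borel_measurable_sum) measurable
  qed
  have sm: "(\<lambda>x. ntrace N \<gamma> {..<K} x) \<in> borel_measurable ?P"
    by (intro ntrace_measurable grid_component) auto
  have B0m: "B0 \<in> sets ?P" unfolding B0_def by measurable
  have B1m: "B1 \<in> sets ?P" unfolding B1_def using sm by measurable
  have B2m: "B2 k \<in> sets ?P" if "k \<in> {..<K}" for k
  proof -
    have [measurable]: "(\<lambda>x. quad N \<gamma> (?Jk k) k x) \<in> borel_measurable ?P" "(\<lambda>x. ntrace N \<gamma> (?Jk k) x) \<in>
        borel_measurable ?P"
      using that by (auto intro!: quad_measurable ntrace_measurable grid_component)
    have [measurable]: "Measurable.pred ?P (small k)" using that by (intro smallm) simp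
    show ?thesis unfolding B2_def by measurable
  qed
  have B3m: "B3 k \<in> sets ?P" if "k \<in> {..<K}" for k
  proof -
    have [measurable]: "Measurable.pred ?P (small k)" "(\<lambda>x. nrm2 N (channel_columns x k)) \<in> borel_measurable ?P"
      using that by (auto intro!: smallm nm)
    show ?thesis unfolding B3_def by measurable
  qed
  have B4m: "B4 p \<in> sets ?P" if "p \<in> pairs" for p
  proof -
    have [measurable]: "(\<lambda>x. cross N \<gamma> (?Jp p) (fst p) (snd p) x) \<in> borel_measurable ?P"
      "Measurable.pred ?P (small (fst p))" "(\<lambda>x. nrm2 N (channel_columns x (snd p))) \<in> borel_measurable ?P"
      using that by (auto simp: pairs_def intro!: cross_measurable grid_component smallm nm)
    show ?thesis unfolding B4_def by measurable
  qed
  have e0: "emeasure ?P B0 \<le> ennreal (2 / \<delta>\<^sup>2 * ?T)"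
    unfolding B0_def by (rule entry_truncation[OF i4 \<delta>0 N(1) K])
  have e1: "emeasure ?P B1 \<le> ennreal (d / \<epsilon>)"
    unfolding B1_def by (rule emeasure_Markov_le[OF _ \<epsilon>(1) d s]) (use sm in measurable)
  have e2: "emeasure ?P (\<Union>k\<in>{..<K}. B2 k) \<le> ennreal (2 * real N * ?c2)"
  proof (rule emeasure_UN_finite_le)
    show "emeasure ?P (B2 k) \<le> ennreal ?c2" if "k \<in> {..<K}" for k
      unfolding B2_def small_def by (rule quad_deviation[OF N(1) \<gamma> _ _ i4 \<kappa> \<epsilon>(1) \<delta>1]) (use that in auto)
    show "0 \<le> ?c2" using \<kappa> \<epsilon> r0 by simp
    then show "real (card {..<K}) * ?c2 \<le> 2 * real N * ?c2" using K2 by (intro mult_right_mono) auto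
  qed (use B2m in auto)
  have e3: "emeasure ?P (\<Union>k\<in>{..<K}. B3 k) \<le> ennreal (2 * real N * ?c3)"
  proof (rule emeasure_UN_finite_le)
    show "emeasure ?P (B3 k) \<le> ennreal ?c3" if "k \<in> {..<K}" for k
      unfolding B3_def small_def by (rule column_norm_deviation[OF N(1) _ i4 \<kappa>(2) \<delta>2]) (use that in auto)
    show "0 \<le> ?c3" using r0 by simp
    then show "real (card {..<K}) * ?c3 \<le> 2 * real N * ?c3" using K2 by (intro mult_right_mono) auto
  qed (use B3m in auto)
  have e4: "emeasure ?P (\<Union>p\<in>pairs. B4 p) \<le> ennreal (4 * (real N)\<^sup>2 * ?c4)"
  proof (rule emeasure_UN_finite_le)
    show "emeasure ?P (B4 p) \<le> ennreal ?c4" if "p \<in> pairs" for p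
      unfolding B4_def small_def by (rule cross_deviation[OF N(1) \<gamma> _ _ _ _ \<epsilon>(1) \<delta>3]) (use that in \<open>auto simp: pairs_def\<close>)
    show c4: "0 \<le> ?c4" using r0 by simp
    have "card pairs \<le> card ({..<K} \<times> {..<K})" unfolding pairs_def by (intro card_mono) auto
    then have "real (card pairs) \<le> real K * real K" by (simp flip: of_nat_mult)
    also have "\<dots> \<le> (2 * real N) * (2 * real N)" using K2 by (intro mult_mono) auto
    finally show "real (card pairs) * ?c4 \<le> 4 * (real N)\<^sup>2 * ?c4"
      using c4 by (intro mult_right_mono) (auto simp: power2_eq_square)
  qed (use B4m fp in auto)
  let ?U = "B0 \<union> (B1 \<union> ((\<Union>k\<in>{..<K}. B2 k) \<union> ((\<Union>k\<in>{..<K}. B3 k) \<union> (\<Union>p\<in>pairs. B4 p))))"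
  have m2: "(\<Union>k\<in>{..<K}. B2 k) \<in> sets ?P" "(\<Union>k\<in>{..<K}. B3 k) \<in> sets ?P" "(\<Union>p\<in>pairs. B4 p) \<in> sets ?P"
    using B2m B3m B4m fp by (auto intro!: sets.finite_UN)
  have "{x \<in> space ?P. \<exists>i<K. \<exists>j<K. i \<noteq> j \<and> pair_error N \<gamma> K (\<gamma> * t) i j x > \<epsilon> * (2 * \<gamma>\<^sup>2 + 7 * \<gamma>)
      + 2 * \<gamma> / real N} \<subseteq> ?U"
  proof (rule subsetI, rule ccontr)
    fix x
    assume x: "x \<in> {x \<in> space ?P. \<exists>i<K. \<exists>j<K. i \<noteq> j \<and> pair_error N \<gamma> K (\<gamma> * t) i j x > \<epsilon> * (2 * \<gamma>\<^sup>2 + 7 * \<gamma>)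
        + 2 * \<gamma> / real N}"
      and U: "x \<notin> ?U"
    from x have xs: "x \<in> space ?P" by simp
    from x obtain i j where ij: "i < K" "j < K" "i \<noteq> j"
      and big: "pair_error N \<gamma> K (\<gamma> * t) i j x > \<epsilon> * (2 * \<gamma>\<^sup>2 + 7 * \<gamma>) + 2 * \<gamma> / real N" by blast
    have all: "(cmod (x p))\<^sup>2 \<le> \<delta> * real N" if "p \<in> ?I" for p
    proof -
      have "x \<notin> B0" using U by blast
      then show ?thesis using xs that unfolding B0_def mem_Collect_eq by (meson not_less)
    qed
    have sml: "small k x" if "k < K" for k unfolding small_def using that by (intro ballI all) auto
    have s': "\<bar>ntrace N \<gamma> {..<K} x - t\<bar> \<le> \<epsilon>" 
  proof -
      have "x \<notin> B1" using U by blast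
      then show ?thesis using xs unfolding B1_def by simp
    qed
    have q': "\<bar>quad N \<gamma> (?Jk k) k x - ntrace N \<gamma> (?Jk k) x\<bar> \<le> 2 * \<epsilon>" if "k < K" for k
    proof -
      have "x \<notin> B2 k" using U that by blast
      then show ?thesis using xs sml[OF that] unfolding B2_def by simp
    qed
    have n': "nrm2 N (channel_columns x k) \<le> 2 * real N" if "k < K" for k
    proof -
      have "x \<notin> B3 k" using U that by blast
      then show ?thesis using xs sml[OF that] unfolding B3_def by simp
    qed
    have c': "cross N \<gamma> ({..<K} - {k, l}) k l x \<le> \<epsilon>" if "k < K" "l < K" "k \<noteq> l" for k l
    proof -
      have "(k, l) \<in> pairs" using that by (auto simp: pairs_def)
      then have "x \<notin> B4 (k, l)" using U by blast
      then show ?thesis using xs sml[OF that(1)] n'[OF that(2)] unfolding B4_def by simp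
    qed
    have "pair_error N \<gamma> K (\<gamma> * t) i j x \<le> \<epsilon> * (2 * \<gamma>\<^sup>2 + 7 * \<gamma>) + 2 * \<gamma> / real N"
    proof (rule pair_error_le[OF N(1) \<gamma> ij \<epsilon> s' q'])
      show "cross N \<gamma> ({..<K} - {i, j}) i j x \<le> \<epsilon>" by (rule c'[OF ij])
      show "cross N \<gamma> ({..<K} - {i, j}) j i x \<le> \<epsilon>" using c'[OF ij(2,1)] ij(3) by (simp add: insert_commute)
    qed
    then show False using big by simp
  qed
  then have "emeasure ?P {x \<in> space ?P. \<exists>i<K. \<exists>j<K. i \<noteq> j \<and> pair_error N \<gamma> K (\<gamma> * t) i j x > \<epsilon> * (2 * \<gamma>\<^sup>2
      + 7 * \<gamma>) + 2 * \<gamma> / real N} \<le> emeasure ?P ?U"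
    by (rule emeasure_mono) (intro sets.Un B0m B1m m2)
  also have "\<dots> \<le> emeasure ?P B0 + (emeasure ?P B1 + (emeasure ?P (\<Union>k\<in>{..<K}. B2 k)
      + (emeasure ?P (\<Union>k\<in>{..<K}. B3 k) + emeasure ?P (\<Union>p\<in>pairs. B4 p))))"
    by (intro order_trans[OF emeasure_subadditive] add_left_mono sets.Un B0m B1m m2 order_refl)
  also have "\<dots> \<le> ennreal (2 / \<delta>\<^sup>2 * ?T) + (ennreal (d / \<epsilon>) + (ennreal (2 * real N * ?c2) + (ennreal (2 * real N
      * ?c3) + ennreal (4 * (real N)\<^sup>2 * ?c4))))"
    by (intro add_mono e0 e1 e2 e3 e4)
  also have "\<dots> = ennreal (2 / \<delta>\<^sup>2 * ?T + (d / \<epsilon> + (2 * real N * ?c2 + (2 * real N * ?c3 + 4 * (real N)\<^sup>2 * ?c4))))"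
  proof -
    have sum5: "ennreal a + (ennreal b + (ennreal c + (ennreal f + ennreal g))) = ennreal (a + (b + (c + (f + g))))"
      if "a \<ge> 0" "b \<ge> 0" "c \<ge> 0" "f \<ge> 0" "g \<ge> 0" for a b c f g :: real
      using that by simp
    show ?thesis by (rule sum5) (use T0 d \<epsilon> \<kappa> r0 in \<open>auto intro!: mult_nonneg_nonneg add_nonneg_nonneg divide_nonneg_nonneg\<close>)
  qed
  finally show ?thesis by (simp only: add.assoc)
qed

lemma pair_error_uniform_small:
  assumes \<gamma>: "\<gamma> > 0" and e: "e > 0" and \<epsilon>0: "\<epsilon>0 > 0"
    and i4: "integrable mu (\<lambda>y. cmod y ^ 4)"
    and t: "t \<ge> 0" "1 = t + \<alpha> * (\<gamma> * t / (1 + \<gamma> * t))"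
  shows "\<exists>N0>0. \<forall>N\<ge>N0. \<forall>K. K \<le> 2 * N \<longrightarrow> \<alpha> = real K / real N \<longrightarrow>
    emeasure (PiM (grid N {..<K}) (\<lambda>_. mu))
      {x \<in> space (PiM (grid N {..<K}) (\<lambda>_. mu)). \<exists>i<K. \<exists>j<K. i \<noteq> j \<and> pair_error N \<gamma> K (\<gamma> * t) i j x > \<epsilon>0} \<le> ennreal e"
proof -
  define G where "G = 2 * \<gamma>\<^sup>2 + 7 * \<gamma>"
  have G: "G > 0" using \<gamma> by (simp add: G_def add_pos_pos)
  \<comment> \<open>The accuracy of the uniform bound is \<epsilon> G + 2 \<gamma> / N, and each of
    the two terms is kept below half of \<epsilon>0.\<close>
  define \<epsilon> where "\<epsilon> = min 1 (\<epsilon>0 / (2 * G))"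
  have \<epsilon>: "0 < \<epsilon>" "\<epsilon> \<le> 1" using \<epsilon>0 G by (auto simp: \<epsilon>_def)
  have "\<epsilon> * G \<le> \<epsilon>0 / (2 * G) * G" using G by (intro mult_right_mono) (auto simp: \<epsilon>_def)
  then have \<epsilon>G: "\<epsilon> * G \<le> \<epsilon>0 / 2" using G by simp
  define \<kappa> where "\<kappa> = max 1 (\<integral>y. cmod y ^ 4 \<partial>mu)"
  have \<kappa>: "\<kappa> \<ge> 1" "(\<integral>y. cmod y ^ 4 \<partial>mu) \<le> \<kappa>" by (auto simp: \<kappa>_def)
  define \<delta> where "\<delta> = \<epsilon>\<^sup>2 / 512"
  have \<delta>: "\<delta> > 0" using \<epsilon> by (simp add: \<delta>_def)
  \<comment> \<open>Markov's inequality for the trace then costs d / \<epsilon> = e/2; all other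
    probabilities are collected in \<open>R\<close>.\<close>
  define d where "d = e * \<epsilon> / 2"
  have d: "d > 0" using e \<epsilon> by (simp add: d_def)
  obtain N1 where N1': "N1 > 0 \<and> (\<forall>N\<ge>N1. \<forall>K. K \<le> 2 * N \<longrightarrow> \<alpha> = real K / real N \<longrightarrow>
    (\<integral>\<^sup>+x. ennreal \<bar>ntrace N \<gamma> {..<K} x - t\<bar> \<partial>PiM (grid N {..<K}) (\<lambda>_. mu)) \<le> ennreal d)"
    using ntrace_L1_small[OF \<gamma> d t] by (elim exE) (rule that)
  note N1 = N1'[THEN conjunct1] N1'[THEN conjunct2, rule_format]
  define c where "c = 12 * \<kappa> * (256 + 48 * \<kappa>) / \<epsilon> ^ 4"
  let ?T = "\<lambda>N. \<integral>z. cmod z ^ 4 * indicator {z. (cmod z)\<^sup>2 > \<delta> * real N} z \<partial>mu"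
  let ?r = "\<lambda>A N. chernoff_rate A N"
  define R where "R N = 2 / \<delta>\<^sup>2 * ?T N + 2 * c / real N + 4 * (real N * ?r (16 * \<kappa> / \<epsilon>\<^sup>2) N)
      + 4 * (real N * ?r (16 * \<kappa>) N) + 16 * ((real N)\<^sup>2 * ?r (128 / \<epsilon>\<^sup>2) N)" for N
  have "(\<lambda>N. 2 * c / real N) \<longlonglongrightarrow> 0" by real_asymp
  moreover have "16 * \<kappa> / \<epsilon>\<^sup>2 > 0" "16 * \<kappa> > 0" "128 / \<epsilon>\<^sup>2 > 0" using \<kappa> \<epsilon> by auto
  ultimately have "R \<longlonglongrightarrow> 2 / \<delta>\<^sup>2 * 0 + 0 + 4 * 0 + 4 * 0 + 16 * 0"
    unfolding R_def
    by (intro tendsto_add tendsto_mult_left tail_fourth_moment_tendsto[OF i4 \<delta>] chernoff_rate_tendsto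
        chernoff_rate_tendsto')
  then have "\<forall>\<^sub>F N in sequentially. R N < e / 2"
    using e by (intro order_tendstoD(2)) auto
  moreover have "(\<lambda>N. 2 * \<gamma> / real N) \<longlonglongrightarrow> 0" by real_asymp
  then have "\<forall>\<^sub>F N in sequentially. 2 * \<gamma> / real N < \<epsilon>0 / 2"
    using \<epsilon>0 by (intro order_tendstoD(2)) auto
  moreover have "filterlim (\<lambda>N. \<epsilon> / 16 * real N) at_top sequentially" using \<epsilon> by real_asymp
  then have "\<forall>\<^sub>F N in sequentially. 1 \<le> \<epsilon> / 16 * real N" unfolding filterlim_at_top by blast
  ultimately have "\<forall>\<^sub>F N in sequentially. R N < e / 2 \<and> 2 * \<gamma> / real N < \<epsilon>0 / 2 \<and> 1 \<le> \<epsilon> / 16 * real N"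
    by (intro eventually_conj)
  then obtain N2 where N2: "\<And>N. N \<ge> N2 \<Longrightarrow> R N < e / 2 \<and> 2 * \<gamma> / real N < \<epsilon>0 / 2 \<and> 1 \<le> \<epsilon> / 16 * real N"
    by (auto simp: eventually_sequentially)
  show ?thesis
  proof (intro exI[of _ "max N1 N2"] conjI allI impI)
    show "max N1 N2 > 0" using N1(1) by simp
    fix N K :: nat assume a: "max N1 N2 \<le> N" "K \<le> 2 * N" "\<alpha> = real K / real N"
    then have N: "N > 0" "N1 \<le> N" "N2 \<le> N" using N1(1) by auto
    let ?P = "PiM (grid N {..<K}) (\<lambda>_. mu)"
    let ?E = "\<lambda>b. {x \<in> space ?P. \<exists>i<K. \<exists>j<K. i \<noteq> j \<and> pair_error N \<gamma> K (\<gamma> * t) i j x > b}"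
    have b: "\<epsilon> * G + 2 * \<gamma> / real N \<le> \<epsilon>0" using N2[OF N(3)] \<epsilon>G by linarith
    have Em: "?E b \<in> sets ?P" for b
    proof -
      have "?E b = (\<Union>i\<in>{..<K}. \<Union>j\<in>{..<K} - {i}. {x \<in> space ?P. pair_error N \<gamma> K (\<gamma> * t) i j x > b})"
        by blast
      also have "\<dots> \<in> sets ?P"
      proof (intro sets.finite_UN)
        fix i j assume "i \<in> {..<K}" "j \<in> {..<K} - {i}"
        then have [measurable]: "(\<lambda>x. pair_error N \<gamma> K (\<gamma> * t) i j x) \<in> borel_measurable ?P"
          by (intro pair_error_measurable) auto
        show "{x \<in> space ?P. pair_error N \<gamma> K (\<gamma> * t) i j x > b} \<in> sets ?P" by measurable
      qed auto
      finally show ?thesis .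
    qed
    have "?E \<epsilon>0 \<subseteq> ?E (\<epsilon> * G + 2 * \<gamma> / real N)"
    proof
      fix x assume "x \<in> ?E \<epsilon>0"
      then obtain i j where "x \<in> space ?P" "i < K" "j < K" "i \<noteq> j" "pair_error N \<gamma> K (\<gamma> * t) i j x > \<epsilon>0" by blast
      moreover from this(5) b have "pair_error N \<gamma> K (\<gamma> * t) i j x > \<epsilon> * G + 2 * \<gamma> / real N" by linarith
      ultimately show "x \<in> ?E (\<epsilon> * G + 2 * \<gamma> / real N)" by blast
    qed
    then have "emeasure ?P (?E \<epsilon>0) \<le> emeasure ?P (?E (\<epsilon> * G + 2 * \<gamma> / real N))"
      by (rule emeasure_mono) (rule Em)
    also have "\<dots> \<le> ennreal (2 / \<delta>\<^sup>2 * ?T N + d / \<epsilon>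
        + 2 * real N * (c / (real N)\<^sup>2 + 2 * ?r (16 * \<kappa> / \<epsilon>\<^sup>2) N)
        + 2 * real N * (2 * ?r (16 * \<kappa>) N) + 4 * (real N)\<^sup>2 * (4 * ?r (128 / \<epsilon>\<^sup>2) N))"
      using pair_error_uniform_bound[OF \<gamma> \<epsilon> i4 \<kappa> N(1) _ a(2) N1(2)[OF N(2) a(2,3)]] N2[OF N(3)] d
      unfolding G_def[symmetric] \<delta>_def[symmetric] c_def[symmetric] by simp
    also have "\<dots> \<le> ennreal e"
    proof (rule ennreal_leI)
      have "2 * real N * (c / (real N)\<^sup>2 + 2 * ?r (16 * \<kappa> / \<epsilon>\<^sup>2) N) = 2 * c / real N + 4 * (real N * ?r (16 * \<kappa>
          / \<epsilon>\<^sup>2) N)"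
        using N(1) by (simp add: power2_eq_square field_simps)
      moreover have "d / \<epsilon> = e / 2" using \<epsilon> by (simp add: d_def)
      ultimately show "2 / \<delta>\<^sup>2 * ?T N + d / \<epsilon>
        + 2 * real N * (c / (real N)\<^sup>2 + 2 * ?r (16 * \<kappa> / \<epsilon>\<^sup>2) N)
        + 2 * real N * (2 * ?r (16 * \<kappa>) N) + 4 * (real N)\<^sup>2 * (4 * ?r (128 / \<epsilon>\<^sup>2) N) \<le> e"
        using N2[OF N(3)] unfolding R_def by linarith
    qed
    finally show "emeasure ?P (?E \<epsilon>0) \<le> ennreal e" .
  qed
qed

end

section \<open>Transfer to the channel model\<close>

text \<open>Needed because \<open>entries\<close> is \<open>undefined\<close> outside the grid,
  where the rescaled columns of a matrix may have other values; the two agree only on the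
  coordinates that inner products read.\<close>

lemma resolvent_list_cong_below:
  assumes "\<And>k a. k \<in> set ks \<Longrightarrow> a < N \<Longrightarrow> x k a = y k a" "\<And>a. a < N \<Longrightarrow> v a = w a" "a < N"
  shows "resolvent_list N g x ks v a = resolvent_list N g y ks w a"
  using assms
proof (induction ks arbitrary: v w a)
  case Nil
  then show ?case by simp
next
  case (Cons k ks)
  have h: "x k a = y k a" if "a < N" for a using Cons.prems(1) that by simp
  have 1: "resolvent_list N g x ks (x k) a = resolvent_list N g y ks (y k) a" if "a < N" for a
    by (rule Cons.IH) (use Cons.prems that in auto)
  have 2: "resolvent_list N g x ks v a = resolvent_list N g y ks w a" if "a < N" for a
    by (rule Cons.IH) (use Cons.prems that in auto)
  have "ip N (x k) (resolvent_list N g x ks (x k)) = ip N (y k) (resolvent_list N g y ks (y k))"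
    "ip N (x k) (resolvent_list N g x ks v) = ip N (y k) (resolvent_list N g y ks w)"
    unfolding ip_def using h 1 2 by (auto intro!: sum.cong)
  then show ?case using 1 2 Cons.prems(3) by (simp add: rank1_update_def)
qed

lemma ip_resolvent_cong_below:
  assumes "finite J" "\<And>k a. k \<in> insert i (insert j J) \<Longrightarrow> a < N \<Longrightarrow> x k a = y k a"
  shows "ip N (x i) (resolvent N g x J (x j)) = ip N (y i) (resolvent N g y J (y j))"
proof -
  have "resolvent N g x J (x j) a = resolvent N g y J (y j) a" if "a < N" for a
    unfolding resolvent_def by (rule resolvent_list_cong_below) (use assms that in auto)
  then show ?thesis unfolding ip_def using assms(2) by (auto intro!: sum.cong)
qed

text \<open>With h = (1 - (1 - \<alpha>) \<gamma>) / 2 the radicand is h^2 + \<gamma>, so c = sqrt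
  (h^2 + \<gamma>) - h is the nonnegative root of c^2 + 2 h c = \<gamma>. After clearing
  denominators, the limiting trace equation at t = c / \<gamma> is this quadratic.\<close>

lemma fixpoint_value:
  fixes \<alpha> \<gamma> :: real
  assumes \<gamma>: "\<gamma> > 0" and \<alpha>: "\<alpha> \<ge> 0"
  defines "c \<equiv> sqrt ((1 - \<alpha>)\<^sup>2 * \<gamma>\<^sup>2 / 4 + (1 + \<alpha>) * \<gamma> / 2 + 1 / 4) - 1 / 2 + (1 - \<alpha>) * \<gamma> / 2"
  shows "c / \<gamma> \<ge> 0" "1 = c / \<gamma> + \<alpha> * (\<gamma> * (c / \<gamma>) / (1 + \<gamma> * (c / \<gamma>)))"
proof -
  define D where "D = (1 - \<alpha>)\<^sup>2 * \<gamma>\<^sup>2 / 4 + (1 + \<alpha>) * \<gamma> / 2 + 1 / 4"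
  define h where "h = 1 / 2 - (1 - \<alpha>) * \<gamma> / 2"
  have ch: "c = sqrt D - h" by (simp add: c_def D_def h_def)
  have "D \<ge> 0" using \<gamma> \<alpha> by (simp add: D_def)
  have Dh: "D = h\<^sup>2 + \<gamma>" by (simp add: D_def h_def power2_eq_square field_simps)
  have "h \<le> sqrt (h\<^sup>2)" by simp
  also have "\<dots> \<le> sqrt D" unfolding Dh using \<gamma> by (intro real_sqrt_le_mono) simp
  finally have c0: "c \<ge> 0" unfolding ch by simp
  then show "c / \<gamma> \<ge> 0" using \<gamma> by simp
  have "(c + h)\<^sup>2 = D" unfolding ch using \<open>D \<ge> 0\<close> by simp
  then have "c\<^sup>2 + 2 * h * c = \<gamma>" unfolding Dh by (simp add: power2_eq_square algebra_simps)
  then have e: "c * (1 + c) + \<alpha> * \<gamma> * c = \<gamma> * (1 + c)"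
    by (simp add: h_def power2_eq_square field_simps)
  have "1 + c > 0" using c0 by simp
  have "c / \<gamma> + \<alpha> * (c / (1 + c)) = (c * (1 + c) + \<alpha> * \<gamma> * c) / (\<gamma> * (1 + c))"
    using \<gamma> \<open>1 + c > 0\<close> by (simp add: add_frac_eq mult_ac)
  also have "\<dots> = 1" unfolding e using \<gamma> \<open>1 + c > 0\<close> by simp
  finally show "1 = c / \<gamma> + \<alpha> * (\<gamma> * (c / \<gamma>) / (1 + \<gamma> * (c / \<gamma>)))" using \<gamma> by simp
qed

text \<open>Restricted to the grid so that the result is a point of the product space.\<close>

definition entries :: "nat \<Rightarrow> nat \<Rightarrow> complex mat \<Rightarrow> nat \<times> nat \<Rightarrow> complex" where
  "entries N K H = (\<lambda>p\<in>grid N {..<K}. complex_of_real (sqrt (real N)) * H $$ p)"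

lemma ip_entries:
  assumes "i < K" "j < K" "J \<subseteq> {..<K}"
  shows "ip N (scaled_col N H i) (resolvent N g (scaled_col N H) J (scaled_col N H j))
    = ip N (channel_columns (entries N K H) i) (resolvent N g (channel_columns (entries N K H)) J
        (channel_columns (entries N K H) j))"
proof (rule ip_resolvent_cong_below)
  show "finite J" using assms(3) finite_subset by blast
  fix k a assume "k \<in> insert i (insert j J)" "a < N"
  then show "scaled_col N H k a = channel_columns (entries N K H) k a"
    using assms by (auto simp: scaled_col_def channel_columns_def entries_def)
qed

lemma nonzero_eigenvalue_Omega:
  fixes H :: "complex mat"
  assumes H: "H \<in> carrier_mat N K" and N: "N > 0" and s: "s > 0" and \<gamma>: "\<gamma> > 0"
    and ij: "i < K" "j < K" "i \<noteq> j" and r: "r \<in> {1, 2}"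
  defines "x \<equiv> entries N K H" and "J \<equiv> {..<K} - {i, j}"
  shows "nonzero_eigenvalue r (Omega_mat H (complex_of_real (\<gamma> * s) \<cdot>\<^sub>m 1\<^sub>m K) s {i, j})
    = eig_2x2 (if r = 1 then 1 else - 1) (\<gamma> * quad N \<gamma> J i x) (\<gamma> * quad N \<gamma> J j x) (\<gamma> * cross N \<gamma> J i j x)"
proof -
  have J: "J \<subseteq> {..<K}" by (auto simp: J_def)
  show ?thesis
    using Omega_eigenvalues[OF H N s \<gamma> ij, folded J_def] r
    unfolding ip_entries[OF ij(1) ij(1) J] ip_entries[OF ij(2) ij(2) J] ip_entries[OF ij(1) ij(2) J] x_def[symmetric]
    by (auto simp: quad_def cross_def)
qed

locale channel = prob_space M for M :: "'a measure" +
  fixes mu :: "complex measure" and N K :: nat and H :: "'a \<Rightarrow> complex mat" and l :: "'a \<Rightarrow> nat \<Rightarrow> nat"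
    and m :: nat
  assumes N: "N > 0" and K: "K > 0"
    and iid: "iid_channel M mu N K H" and pairing: "random_pairing M K l" and m: "m \<in> {1..K div 2}"
begin

definition X :: "'a \<Rightarrow> nat \<times> nat \<Rightarrow> complex" where "X w = entries N K (H w)"

definition fst_user :: "'a \<Rightarrow> nat" where "fst_user w = l w (2 * m - 1)"
definition snd_user :: "'a \<Rightarrow> nat" where "snd_user w = l w (2 * m)"

lemma H_measurable: "p \<in> grid N {..<K} \<Longrightarrow> (\<lambda>w. H w $$ p) \<in> borel_measurable M"
  using iid unfolding iid_channel_def indep_vars_def2 by auto

lemma H_law:
  "p \<in> grid N {..<K} \<Longrightarrow> distr M borel (\<lambda>w. complex_of_real (sqrt (real N)) * H w $$ p) = mu"
  using iid unfolding iid_channel_def by auto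

lemma X_component: "p \<in> grid N {..<K} \<Longrightarrow> X w p = complex_of_real (sqrt (real N)) * H w $$ p"
  by (simp add: X_def entries_def)

lemma X_entry_measurable: "p \<in> grid N {..<K} \<Longrightarrow> (\<lambda>w. X w p) \<in> borel_measurable M"
  using H_measurable[of p] by (simp add: X_component)

lemma unit_law: "unit_law mu"
proof -
  define p where "p = (0::nat, 0::nat)"
  have p: "p \<in> grid N {..<K}" using N K by (simp add: p_def)
  have Hm[measurable]: "(\<lambda>w. H w $$ p) \<in> borel_measurable M" by (rule H_measurable[OF p])
  let ?Y = "\<lambda>w. complex_of_real (sqrt (real N)) * H w $$ p"
  have mu: "mu = distr M borel ?Y" using H_law[OF p] by simp
  have mean: "(\<integral>w. H w $$ p \<partial>M) = 0" and var: "(\<integral>w. (norm (H w $$ p))\<^sup>2 \<partial>M) = 1 / real N"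
    using iid p unfolding iid_channel_def by auto
  \<comment> \<open>The Bochner integral of a non-integrable function is 0 by convention, so the
    positive variance 1/N already forces integrability.\<close>
  have i2: "integrable M (\<lambda>w. (norm (H w $$ p))\<^sup>2)"
  proof (rule ccontr)
    assume "\<not> integrable M (\<lambda>w. (norm (H w $$ p))\<^sup>2)"
    then have "(\<integral>w. (norm (H w $$ p))\<^sup>2 \<partial>M) = 0" by (rule not_integrable_integral_eq)
    then show False using var N by simp
  qed
  have nY: "(cmod (?Y w))\<^sup>2 = real N * (norm (H w $$ p))\<^sup>2" for w
    by (simp add: norm_mult power_mult_distrib)
  interpret mu: prob_space mu unfolding mu by (rule prob_space_distr) measurable
  show ?thesis
  proof
    show "sets mu = sets borel" by (simp add: mu)
    show "(\<integral>z. z \<partial>mu) = 0" unfolding mu using mean by (subst integral_distr) auto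
    show "integrable mu (\<lambda>z. (cmod z)\<^sup>2)" unfolding mu using i2 by (subst integrable_distr_eq) (auto simp: nY)
    show "(\<integral>z. (cmod z)\<^sup>2 \<partial>mu) = 1" unfolding mu using var N by (subst integral_distr) (auto simp: nY)
  qed
qed

sublocale law: unit_law mu by (rule unit_law)

lemma X_measurable: "X \<in> measurable M (PiM (grid N {..<K}) (\<lambda>_. mu))"
proof -
  have "(\<lambda>w. \<lambda>p\<in>grid N {..<K}. X w p) \<in> measurable M (PiM (grid N {..<K}) (\<lambda>_. mu))"
    using X_entry_measurable by (intro measurable_restrict) (auto simp: measurable_cong_sets[OF refl law.sets_mu])
  moreover have "(\<lambda>p\<in>grid N {..<K}. X w p) = X w" for w by (auto simp: X_def entries_def restrict_def)
  ultimately show ?thesis by simp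
qed

lemma X_distr: "distr M (PiM (grid N {..<K}) (\<lambda>_. mu)) X = PiM (grid N {..<K}) (\<lambda>_. mu)"
proof -
  let ?I = "grid N {..<K}"
  let ?Y = "\<lambda>p w. complex_of_real (sqrt (real N)) * H w $$ p"
  have "indep_vars (\<lambda>_. borel) (\<lambda>p w. H w $$ p) ?I" using iid unfolding iid_channel_def by auto
  then have ind: "indep_vars (\<lambda>_. borel) ?Y ?I"
    by (rule indep_vars_compose2[where Y = "\<lambda>p z. complex_of_real (sqrt (real N)) * z"]) measurable
  have "?I \<noteq> {}" using N K by auto
  then have "distr M (PiM ?I (\<lambda>_. borel)) (\<lambda>w. \<lambda>p\<in>?I. ?Y p w) = PiM ?I (\<lambda>p. distr M borel (?Y p))"
    using ind H_measurable by (subst indep_vars_iff_distr_eq_PiM'[symmetric]) auto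
  also have "PiM ?I (\<lambda>p. distr M borel (?Y p)) = PiM ?I (\<lambda>_. mu)"
    using H_law by (intro PiM_cong) auto
  finally have d: "distr M (PiM ?I (\<lambda>_. borel)) (\<lambda>w. \<lambda>p\<in>?I. ?Y p w) = PiM ?I (\<lambda>_. mu)" .
  have "distr M (PiM ?I (\<lambda>_. mu)) X = distr M (PiM ?I (\<lambda>_. borel)) (\<lambda>w. \<lambda>p\<in>?I. ?Y p w)"
    by (rule distr_cong) (auto simp: X_def entries_def intro!: sets_PiM_cong law.sets_mu)
  then show ?thesis using d by simp
qed

lemma emeasure_X:
  assumes "E \<in> sets (PiM (grid N {..<K}) (\<lambda>_. mu))"
  shows "emeasure M {w \<in> space M. X w \<in> E} = emeasure (PiM (grid N {..<K}) (\<lambda>_. mu)) E"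
proof -
  have "emeasure (PiM (grid N {..<K}) (\<lambda>_. mu)) E = emeasure (distr M (PiM (grid N {..<K}) (\<lambda>_. mu)) X) E"
    unfolding X_distr ..
  also have "\<dots> = emeasure M (X -` E \<inter> space M)" by (rule emeasure_distr[OF X_measurable assms])
  also have "X -` E \<inter> space M = {w \<in> space M. X w \<in> E}" by auto
  finally show ?thesis ..
qed

lemma user_indices: "2 * m - 1 \<in> {1..K}" "2 * m \<in> {1..K}" "2 * m - 1 \<noteq> 2 * m"
  using m by auto

lemma users:
  assumes "w \<in> space M"
  shows "fst_user w < K" "snd_user w < K" "fst_user w \<noteq> snd_user w"
proof -
  have b: "bij_betw (l w) {1..K} {..<K}" using pairing assms unfolding random_pairing_def by auto
  show "fst_user w < K" "snd_user w < K"
    using bij_betw_apply[OF b user_indices(1)] bij_betw_apply[OF b user_indices(2)]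
    by (auto simp: fst_user_def snd_user_def)
  show "fst_user w \<noteq> snd_user w"
    using bij_betw_imp_inj_on[OF b] user_indices unfolding fst_user_def snd_user_def by (metis inj_onD)
qed

lemma user_measurable: "fst_user \<in> measurable M (count_space UNIV)" "snd_user \<in> measurable M (count_space UNIV)"
  using pairing user_indices unfolding random_pairing_def fst_user_def snd_user_def by auto

text \<open>A random pair of users takes countably many values, so measurability reduces to fixed
  pairs. The auxiliary \<open>f'\<close> is 0 at inadmissible pairs, where nothing is known about
  \<open>f\<close>.\<close>

lemma borel_measurable_at_users:
  fixes f :: "nat \<Rightarrow> nat \<Rightarrow> 'a \<Rightarrow> real"
  assumes "\<And>i j. i < K \<Longrightarrow> j < K \<Longrightarrow> i \<noteq> j \<Longrightarrow> f i j \<in> borel_measurable M"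
  shows "(\<lambda>w. f (fst_user w) (snd_user w) w) \<in> borel_measurable M"
proof -
  define f' where "f' i j w = (if i < K \<and> j < K \<and> i \<noteq> j then f i j w else 0)" for i j w
  have f': "f' i j \<in> borel_measurable M" for i j
  proof -
    have "f' i j = (if i < K \<and> j < K \<and> i \<noteq> j then f i j else (\<lambda>_. 0))" unfolding f'_def by (intro ext) presburger
    then show ?thesis using assms[of i j] by simp
  qed
  have "(\<lambda>w. f' (fst_user w) (snd_user w) w) \<in> borel_measurable M"
    by (rule measurable_compose_countable[OF measurable_compose_countable[OF f' user_measurable(2)]
        user_measurable(1)])
  moreover have "f' (fst_user w) (snd_user w) w = f (fst_user w) (snd_user w) w" if "w \<in> space M" for w
    using users[OF that] by (simp add: f'_def)
  ultimately show ?thesis by (simp cong: measurable_cong)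
qed

lemma Omega_eigenvalue_eq:
  assumes "\<gamma> > 0" "s > 0" "r \<in> {1, 2}" "w \<in> space M"
  shows "nonzero_eigenvalue r (Omega_mat (H w) (complex_of_real (\<gamma> * s) \<cdot>\<^sub>m 1\<^sub>m K) s (user_pair (l w) m))
    = eig_2x2 (if r = 1 then 1 else - 1)
        (\<gamma> * quad N \<gamma> ({..<K} - {fst_user w, snd_user w}) (fst_user w) (X w))
        (\<gamma> * quad N \<gamma> ({..<K} - {fst_user w, snd_user w}) (snd_user w) (X w))
        (\<gamma> * cross N \<gamma> ({..<K} - {fst_user w, snd_user w}) (fst_user w) (snd_user w) (X w))"
proof -
  have "H w \<in> carrier_mat N K" using iid assms(4) unfolding iid_channel_def by auto
  moreover have "user_pair (l w) m = {fst_user w, snd_user w}"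
    by (simp add: user_pair_def fst_user_def snd_user_def)
  ultimately show ?thesis
    using nonzero_eigenvalue_Omega[OF _ N assms(2,1) users[OF assms(4)] assms(3)] by (simp add: X_def)
qed

lemma Omega_eigenvalue_measurable:
  assumes "\<gamma> > 0" "s > 0" "r \<in> {1, 2}"
  shows "(\<lambda>w. nonzero_eigenvalue r (Omega_mat (H w) (complex_of_real (\<gamma> * s) \<cdot>\<^sub>m 1\<^sub>m K) s (user_pair (l w) m)))
    \<in> borel_measurable M"
proof -
  have "(\<lambda>w. eig_2x2 (if r = 1 then 1 else - 1) (\<gamma> * quad N \<gamma> ({..<K} - {i, j}) i (X w))
      (\<gamma> * quad N \<gamma> ({..<K} - {i, j}) j (X w)) (\<gamma> * cross N \<gamma> ({..<K} - {i, j}) i j (X w))) \<in> borel_measurable M"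
    if "i < K" "j < K" "i \<noteq> j" for i j
  proof -
    have [measurable]: "(\<lambda>w. quad N \<gamma> ({..<K} - {i, j}) i (X w)) \<in> borel_measurable M"
      "(\<lambda>w. quad N \<gamma> ({..<K} - {i, j}) j (X w)) \<in> borel_measurable M"
      "(\<lambda>w. cross N \<gamma> ({..<K} - {i, j}) i j (X w)) \<in> borel_measurable M"
      using that by (auto intro!: quad_measurable cross_measurable X_entry_measurable)
    show ?thesis unfolding eig_2x2_def by measurable
  qed
  from borel_measurable_at_users[OF this] show ?thesis
    by (subst measurable_cong[OF Omega_eigenvalue_eq[OF assms]])
qed

lemma Omega_eigenvalue_error:
  assumes "\<gamma> > 0" "s > 0" "r \<in> {1, 2}" "w \<in> space M"
  shows "\<bar>nonzero_eigenvalue r (Omega_mat (H w) (complex_of_real (\<gamma> * s) \<cdot>\<^sub>m 1\<^sub>m K) s (user_pair (l w) m)) - c\<bar>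
    \<le> pair_error N \<gamma> K c (fst_user w) (snd_user w) (X w)"
proof -
  have "\<gamma> * cross N \<gamma> ({..<K} - {fst_user w, snd_user w}) (fst_user w) (snd_user w) (X w) \<ge> 0"
    using assms(1) by (simp add: cross_def)
  moreover have "\<bar>if r = 1 then 1 else - 1 :: real\<bar> \<le> 1" by simp
  note eig_2x2_dist[OF this]
  ultimately show ?thesis
    unfolding Omega_eigenvalue_eq[OF assms] pair_error_def by (metis abs_of_nonneg)
qed

lemma error_set_measurable:
  assumes "i < K" "j < K"
  shows "{x \<in> space (PiM (grid N {..<K}) (\<lambda>_. mu)). pair_error N \<gamma> K c i j x
      > \<epsilon>} \<in> sets (PiM (grid N {..<K}) (\<lambda>_. mu))"
  using law.pair_error_measurable[OF assms] by measurable

text \<open>However the pair depends on the channel, its failure implies that some pair fails, and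
  this is an event of the channel alone.\<close>

lemma prob_error_uniform:
  assumes "emeasure (PiM (grid N {..<K}) (\<lambda>_. mu))
      {x \<in> space (PiM (grid N {..<K}) (\<lambda>_. mu)). \<exists>i<K. \<exists>j<K. i \<noteq> j \<and> pair_error N \<gamma> K c i j x > \<epsilon>} \<le> ennreal e"
    and e: "e \<ge> 0" and \<gamma>: "\<gamma> > 0" and s: "s > 0" and r: "r \<in> {1, 2}"
  shows "measure M {w \<in> space M. \<bar>nonzero_eigenvalue r (Omega_mat (H w) (complex_of_real (\<gamma>
      * s) \<cdot>\<^sub>m 1\<^sub>m K) s (user_pair (l w) m)) - c\<bar> > \<epsilon>} \<le> e"
proof -
  let ?P = "PiM (grid N {..<K}) (\<lambda>_. mu)"
  let ?E = "{x \<in> space ?P. \<exists>i<K. \<exists>j<K. i \<noteq> j \<and> pair_error N \<gamma> K c i j x > \<epsilon>}"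
  let ?B = "{w \<in> space M. \<bar>nonzero_eigenvalue r (Omega_mat (H w) (complex_of_real (\<gamma>
      * s) \<cdot>\<^sub>m 1\<^sub>m K) s (user_pair (l w) m)) - c\<bar> > \<epsilon>}"
  have "?E = (\<Union>i\<in>{..<K}. \<Union>j\<in>{..<K} - {i}. {x \<in> space ?P. pair_error N \<gamma> K c i j x > \<epsilon>})"
    by blast
  also have "\<dots> \<in> sets ?P"
    by (intro sets.finite_UN error_set_measurable) auto
  finally have Em: "?E \<in> sets ?P" .
  have "?B \<subseteq> {w \<in> space M. X w \<in> ?E}"
  proof
    fix w assume w: "w \<in> ?B"
    then have ws: "w \<in> space M" by simp
    have "pair_error N \<gamma> K c (fst_user w) (snd_user w) (X w) > \<epsilon>"
      using w Omega_eigenvalue_error[OF \<gamma> s r ws, of c] by auto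
    then show "w \<in> {w \<in> space M. X w \<in> ?E}"
      using ws users[OF ws] measurable_space[OF X_measurable ws] by blast
  qed
  moreover have "{w \<in> space M. X w \<in> ?E} \<in> sets M"
    using measurable_sets[OF X_measurable Em] by (simp add: vimage_def Int_def conj_commute)
  ultimately have "emeasure M ?B \<le> emeasure M {w \<in> space M. X w \<in> ?E}" by (rule emeasure_mono)
  also have "\<dots> \<le> ennreal e" unfolding emeasure_X[OF Em] by (rule assms(1))
  finally show ?thesis using e by (simp add: emeasure_eq_measure)
qed

text \<open>Conditioning on the realized pair, carried out by hand: the error event is covered by
  the sets L p \<inter> F p, where L p fixes the pair and F p is an event of the channel. By
  independence their probabilities multiply; each F p has probability at most e and the L p are
  disjoint, so the sum stays below e, with no factor for the number of pairs.\<close>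

lemma prob_error_independent:
  assumes ind: "pairing_indep_of_channel M N K H l"
    and le: "\<And>i j. i < K \<Longrightarrow> j < K \<Longrightarrow> i \<noteq> j \<Longrightarrow> emeasure (PiM (grid N {..<K}) (\<lambda>_. mu))
      {x \<in> space (PiM (grid N {..<K}) (\<lambda>_. mu)). pair_error N \<gamma> K c i j x > \<epsilon>} \<le> ennreal e"
    and e: "e \<ge> 0" and \<gamma>: "\<gamma> > 0" and s: "s > 0" and r: "r \<in> {1, 2}"
  shows "measure M {w \<in> space M. \<bar>nonzero_eigenvalue r (Omega_mat (H w) (complex_of_real (\<gamma>
      * s) \<cdot>\<^sub>m 1\<^sub>m K) s (user_pair (l w) m)) - c\<bar> > \<epsilon>} \<le> e"
proof -
  let ?I = "grid N {..<K}"
  let ?P = "PiM ?I (\<lambda>_. mu)"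
  let ?E = "\<lambda>p. {x \<in> space ?P. pair_error N \<gamma> K c (fst p) (snd p) x > \<epsilon>}"
  let ?B = "{w \<in> space M. \<bar>nonzero_eigenvalue r (Omega_mat (H w) (complex_of_real (\<gamma>
      * s) \<cdot>\<^sub>m 1\<^sub>m K) s (user_pair (l w) m)) - c\<bar> > \<epsilon>}"
  define pairs where "pairs = {p \<in> {..<K} \<times> {..<K}. fst p \<noteq> snd p}"
  define L where "L p = {w \<in> space M. fst_user w = fst p \<and> snd_user w = snd p}" for p
  define F where "F p = {w \<in> space M. X w \<in> ?E p}" for p
  have fin: "finite pairs" by (simp add: pairs_def)
  have Em: "?E p \<in> sets ?P" if "p \<in> pairs" for p
    using that by (intro error_set_measurable) (auto simp: pairs_def)
  let ?SL = "sets (vimage_algebra (space M) (\<lambda>w. \<lambda>i\<in>{1..K}. l w i) (PiM {1..K} (\<lambda>_. count_space UNIV)))"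
  let ?SH = "sets (vimage_algebra (space M) (\<lambda>w. \<lambda>p\<in>?I. H w $$ p) (PiM ?I (\<lambda>_. borel)))"
  have ind': "indep_set ?SL ?SH" using ind unfolding pairing_indep_of_channel_def .
  have Ls: "L p \<in> ?SL" for p
  proof -
    let ?S = "{h \<in> space (PiM {1..K} (\<lambda>_. count_space (UNIV::nat set))). h (2 * m - 1) = fst p \<and> h (2 * m) = snd p}"
    have [measurable]: "(\<lambda>h. h (2 * m - 1)) \<in> measurable (PiM {1..K} (\<lambda>_. count_space (UNIV::nat set)))
        (count_space UNIV)"
      "(\<lambda>h. h (2 * m)) \<in> measurable (PiM {1..K} (\<lambda>_. count_space (UNIV::nat set))) (count_space UNIV)"
      by (rule measurable_component_singleton[OF user_indices(1)], rule measurable_component_singleton[OF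
          user_indices(2)])
    have "?S \<in> sets (PiM {1..K} (\<lambda>_. count_space UNIV))" by measurable
    from in_vimage_algebra[OF this, of "\<lambda>w. \<lambda>i\<in>{1..K}. l w i" "space M"]
    have "(\<lambda>w. \<lambda>i\<in>{1..K}. l w i) -` ?S \<inter> space M \<in> ?SL" .
    moreover have "(\<lambda>w. \<lambda>i\<in>{1..K}. l w i) -` ?S \<inter> space M = L p"
      using user_indices by (auto simp: L_def fst_user_def snd_user_def space_PiM)
    ultimately show ?thesis by simp
  qed
  have Fs: "F p \<in> ?SH" if p: "p \<in> pairs" for p
  proof -
    let ?g = "\<lambda>h::nat \<times> nat \<Rightarrow> complex. \<lambda>q\<in>?I. complex_of_real (sqrt (real N)) * h q"
    have g: "?g \<in> measurable (PiM ?I (\<lambda>_. borel)) ?P"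
    proof (rule measurable_restrict)
      fix q assume "q \<in> ?I"
      then have "(\<lambda>h. h q) \<in> borel_measurable (PiM ?I (\<lambda>_. borel :: complex measure))"
        by (rule measurable_component_singleton)
      then show "(\<lambda>h. complex_of_real (sqrt (real N)) * h q) \<in> measurable (PiM ?I (\<lambda>_. borel)) mu"
        by (simp add: measurable_cong_sets[OF refl law.sets_mu])
    qed
    let ?S = "?g -` ?E p \<inter> space (PiM ?I (\<lambda>_. borel :: complex measure))"
    have "?S \<in> sets (PiM ?I (\<lambda>_. borel))" by (rule measurable_sets[OF g Em[OF p]])
    from in_vimage_algebra[OF this, of "\<lambda>w. \<lambda>q\<in>?I. H w $$ q" "space M"]
    have "(\<lambda>w. \<lambda>q\<in>?I. H w $$ q) -` ?S \<inter> space M \<in> ?SH" .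
    moreover have "(\<lambda>w. \<lambda>q\<in>?I. H w $$ q) -` ?S \<inter> space M = F p"
    proof -
      have gX: "?g (\<lambda>q\<in>?I. H w $$ q) = X w" for w
        by (auto simp: X_def entries_def restrict_def)
      have sp: "(\<lambda>q\<in>?I. H w $$ q) \<in> space (PiM ?I (\<lambda>_. borel :: complex measure))" for w
        by (simp add: space_PiM)
      define E' where "E' = ?E p"
      show ?thesis
        unfolding F_def E'_def[symmetric] vimage_def Int_def mem_Collect_eq gX
        using sp by blast
    qed
    ultimately show ?thesis by simp
  qed
  have Lm: "L p \<in> sets M" for p by (rule subsetD[OF indep_setD_ev1[OF ind'] Ls])
  have Fm: "F p \<in> sets M" if "p \<in> pairs" for p by (rule subsetD[OF indep_setD_ev2[OF ind'] Fs[OF that]])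
  have Fe: "measure M (F p) \<le> e" if "p \<in> pairs" for p
  proof -
    have "emeasure M (F p) \<le> ennreal e"
      unfolding F_def emeasure_X[OF Em[OF that]] by (rule le) (use that in \<open>auto simp: pairs_def\<close>)
    then show ?thesis using e by (simp add: emeasure_eq_measure)
  qed
  have sub: "?B \<subseteq> (\<Union>p\<in>pairs. L p \<inter> F p)"
  proof
    fix w assume w: "w \<in> ?B"
    then have ws: "w \<in> space M" by simp
    have "pair_error N \<gamma> K c (fst_user w) (snd_user w) (X w) > \<epsilon>"
      using w Omega_eigenvalue_error[OF \<gamma> s r ws, of c] by auto
    then have "w \<in> L (fst_user w, snd_user w) \<inter> F (fst_user w, snd_user w)"
      using ws measurable_space[OF X_measurable ws] by (simp add: L_def F_def)
    moreover have "(fst_user w, snd_user w) \<in> pairs" using users[OF ws] by (auto simp: pairs_def)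
    ultimately show "w \<in> (\<Union>p\<in>pairs. L p \<inter> F p)" by blast
  qed
  have "measure M ?B \<le> measure M (\<Union>p\<in>pairs. L p \<inter> F p)"
    using sub Lm Fm fin by (intro finite_measure_mono) auto
  also have "\<dots> \<le> (\<Sum>p\<in>pairs. measure M (L p \<inter> F p))"
    using Lm Fm fin by (intro finite_measure_subadditive_finite) auto
  also have "\<dots> = (\<Sum>p\<in>pairs. measure M (L p) * measure M (F p))"
    by (intro sum.cong refl indep_setD[OF ind'] Ls Fs)
  also have "\<dots> \<le> (\<Sum>p\<in>pairs. measure M (L p) * e)"
    by (intro sum_mono mult_left_mono Fe) auto
  also have "\<dots> = measure M (\<Union>p\<in>pairs. L p) * e"
    unfolding sum_distrib_right[symmetric] using Lm fin
    by (subst finite_measure_finite_Union) (auto simp: disjoint_family_on_def L_def)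
  also have "\<dots> \<le> 1 * e" by (intro mult_right_mono) (use e in auto)
  finally show ?thesis by simp
qed

end

section \<open>Convergence in probability of both eigenvalues\<close>

theorem theorem6:
  fixes M :: "nat \<Rightarrow> 'a measure"
    and mu :: "complex measure"
    and N K :: "nat \<Rightarrow> nat"
    and H :: "nat \<Rightarrow> 'a \<Rightarrow> complex mat"
    and Phi :: "nat \<Rightarrow> complex mat"
    and l :: "nat \<Rightarrow> 'a \<Rightarrow> nat \<Rightarrow> nat"
    and m :: "nat \<Rightarrow> nat"
    and \<alpha> \<gamma> noise_var :: real
  assumes "\<And>n. prob_space (M n)"
    and "\<And>n. N n > 0"
    and "\<And>n. even (K n)"
    and "\<And>n. N n \<le> K n"
    and "\<And>n. K n \<le> 2 * N n"
    and "filterlim N at_top sequentially"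
    and "\<And>n. \<alpha> = real (K n) / real (N n)"
    and "\<And>n. iid_channel (M n) mu (N n) (K n) (H n)"
    and "noise_var > 0"
    and "\<gamma> > 0"
    and "\<And>n. Phi n \<in> carrier_mat (K n) (K n)"
    and "\<And>n. complex_of_real (1 / noise_var) \<cdot>\<^sub>m Phi n = complex_of_real \<gamma> \<cdot>\<^sub>m 1\<^sub>m (K n)"
    and "\<And>n. random_pairing (M n) (K n) (l n)"
    and "(\<forall>n. pairing_indep_of_channel (M n) (N n) (K n) (H n) (l n))
         \<or> integrable mu (\<lambda>z. norm z ^ 4)"
    and "\<And>n. m n \<in> {1..K n div 2}"
  shows "\<forall>j \<in> {1, 2}.
     converges_in_probability M
       (\<lambda>n w. nonzero_eigenvalue j
          (Omega_mat (H n w) (Phi n) noise_var (user_pair (l n w) (m n))))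
       (sqrt ((1 - \<alpha>)\<^sup>2 * \<gamma>\<^sup>2 / 4 + (1 + \<alpha>) * \<gamma> / 2 + 1 / 4) - 1 / 2 + (1 - \<alpha>) * \<gamma> / 2)"
proof
  fix r :: nat assume r: "r \<in> {1, 2}"
  define c where "c = sqrt ((1 - \<alpha>)\<^sup>2 * \<gamma>\<^sup>2 / 4 + (1 + \<alpha>) * \<gamma> / 2 + 1 / 4) - 1 / 2 + (1 - \<alpha>) * \<gamma> / 2"
  note \<gamma> = \<open>\<gamma> > 0\<close> and s = \<open>noise_var > 0\<close>
  have ch: "channel (M n) mu (N n) (K n) (H n) (l n) (m n)" for n
  proof (intro channel.intro channel_axioms.intro)
    show "K n > 0" using assms(2)[of n] assms(4)[of n] by linarith
  qed (rule assms)+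
  \<comment> \<open>The law \<open>mu\<close> is common to all n, so thresholds obtained for it
    once, from the channel with index 0, serve every n.\<close>
  interpret ch0: channel "M 0" mu "N 0" "K 0" "H 0" "l 0" "m 0" by (rule ch)
  have Phi: "Phi n = complex_of_real (\<gamma> * noise_var) \<cdot>\<^sub>m 1\<^sub>m (K n)" for n
  proof (rule eq_matI)
    fix i j assume "i < dim_row (complex_of_real (\<gamma> * noise_var) \<cdot>\<^sub>m 1\<^sub>m (K n))"
      "j < dim_col (complex_of_real (\<gamma> * noise_var) \<cdot>\<^sub>m 1\<^sub>m (K n))"
    then have ij: "i < K n" "j < K n" by auto
    have "(complex_of_real (1 / noise_var) \<cdot>\<^sub>m Phi n) $$ (i, j) = (complex_of_real \<gamma> \<cdot>\<^sub>m 1\<^sub>m (K n)) $$ (i, j)"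
      unfolding assms(12) ..
    then have "Phi n $$ (i, j) / complex_of_real noise_var = complex_of_real \<gamma> * (if i = j then 1 else 0)"
      using ij assms(11)[of n] by simp
    then show "Phi n $$ (i, j) = (complex_of_real (\<gamma> * noise_var) \<cdot>\<^sub>m 1\<^sub>m (K n)) $$ (i, j)"
      using ij s by (auto simp: field_simps split: if_splits)
  qed (use assms(11)[of n] in auto)
  have "\<alpha> \<ge> 0" using assms(7)[of 0] by simp
  note t = fixpoint_value[OF \<gamma> this, folded c_def]
  have c: "\<gamma> * (c / \<gamma>) = c" using \<gamma> by simp
  \<comment> \<open>The threshold is on \<open>N n\<close>, the dimension that governs the
    estimates; divergence of \<open>N\<close> later turns it into a statement about all large
    n.\<close>
  have small: "\<exists>N0. \<forall>n. N n \<ge> N0 \<longrightarrow>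
      measure (M n) {w \<in> space (M n). \<bar>nonzero_eigenvalue r (Omega_mat (H n w) (Phi n) noise_var (user_pair (l
          n w) (m n))) - c\<bar> > \<epsilon>} \<le> e"
    if \<epsilon>: "\<epsilon> > 0" and e: "e > 0" for \<epsilon> e
    using assms(14)
  proof
    assume ind: "\<forall>n. pairing_indep_of_channel (M n) (N n) (K n) (H n) (l n)"
    obtain N0 where N0: "N0 > 0 \<and> (\<forall>N\<ge>N0. \<forall>(K::nat) i j. K \<le> 2 * N \<longrightarrow> \<alpha> = real K / real N \<longrightarrow> i < K \<longrightarrow> j < K \<longrightarrow> i \<noteq> j \<longrightarrow>
      emeasure (PiM (grid N {..<K}) (\<lambda>_. mu))
        {x \<in> space (PiM (grid N {..<K}) (\<lambda>_. mu)). pair_error N \<gamma> K (\<gamma> * (c / \<gamma>)) i j x > \<epsilon>} \<le> ennreal e)"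
      using ch0.law.pair_error_tail_small[OF \<gamma> e \<epsilon> t] by (elim exE) (rule that)
    show ?thesis
    proof (intro exI[of _ N0] allI impI)
      fix n assume n: "N0 \<le> N n"
      interpret channel "M n" mu "N n" "K n" "H n" "l n" "m n" by (rule ch)
      show "measure (M n) {w \<in> space (M n). \<bar>nonzero_eigenvalue r (Omega_mat (H n w) (Phi n) noise_var
          (user_pair (l n w) (m n))) - c\<bar> > \<epsilon>} \<le> e"
        unfolding Phi
        by (rule prob_error_independent[OF ind[rule_format] N0[THEN conjunct2, rule_format, OF n assms(5,7),
            unfolded c] _ \<gamma> s r])
           (use e in auto)
    qed
  next
    assume i4: "integrable mu (\<lambda>z. norm z ^ 4)"
    obtain N0 where N0: "N0 > 0 \<and> (\<forall>N\<ge>N0. \<forall>K. K \<le> 2 * N \<longrightarrow> \<alpha> = real K / real N \<longrightarrow>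
      emeasure (PiM (grid N {..<K}) (\<lambda>_. mu))
        {x \<in> space (PiM (grid N {..<K}) (\<lambda>_. mu)). \<exists>i<K. \<exists>j<K. i \<noteq> j \<and> pair_error N \<gamma> K (\<gamma> * (c / \<gamma>)) i j x
            > \<epsilon>} \<le> ennreal e)"
      using ch0.law.pair_error_uniform_small[OF \<gamma> e \<epsilon> i4 t] by (elim exE) (rule that)
    show ?thesis
    proof (intro exI[of _ N0] allI impI)
      fix n assume n: "N0 \<le> N n"
      interpret channel "M n" mu "N n" "K n" "H n" "l n" "m n" by (rule ch)
      show "measure (M n) {w \<in> space (M n). \<bar>nonzero_eigenvalue r (Omega_mat (H n w) (Phi n) noise_var
          (user_pair (l n w) (m n))) - c\<bar> > \<epsilon>} \<le> e"
        unfolding Phi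
        by (rule prob_error_uniform[OF N0[THEN conjunct2, rule_format, OF n assms(5,7), unfolded c] _ \<gamma> s r])
           (use e in auto)
    qed
  qed
  show "converges_in_probability M
       (\<lambda>n w. nonzero_eigenvalue r (Omega_mat (H n w) (Phi n) noise_var (user_pair (l n w) (m n))))
       (sqrt ((1 - \<alpha>)\<^sup>2 * \<gamma>\<^sup>2 / 4 + (1 + \<alpha>) * \<gamma> / 2 + 1 / 4) - 1 / 2 + (1 - \<alpha>) * \<gamma> / 2)"
    unfolding converges_in_probability_def c_def[symmetric]
  proof (intro conjI allI impI)
    show "(\<lambda>w. nonzero_eigenvalue r (Omega_mat (H n w) (Phi n) noise_var (user_pair (l n w) (m n)))) \<in>
        borel_measurable (M n)" for n
      unfolding Phi by (rule channel.Omega_eigenvalue_measurable[OF ch \<gamma> s r])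
    fix \<epsilon> :: real assume \<epsilon>: "\<epsilon> > 0"
    show "(\<lambda>n. measure (M n) {w \<in> space (M n). \<bar>nonzero_eigenvalue r (Omega_mat (H n w) (Phi n) noise_var
        (user_pair (l n w) (m n))) - c\<bar> > \<epsilon>}) \<longlonglongrightarrow> 0"
      (is "?p \<longlonglongrightarrow> 0")
    proof (rule tendstoI)
      fix e :: real assume "e > 0"
      \<comment> \<open>Halving \<open>e\<close> provides the strict inequality that the limit
        requires.\<close>
      then obtain N0 where N0: "\<And>n. N n \<ge> N0 \<Longrightarrow> ?p n \<le> e / 2" using small[OF \<epsilon>, of "e / 2"] by auto
      have "\<forall>\<^sub>F n in sequentially. N0 \<le> N n" using assms(6) unfolding filterlim_at_top by blast
      then show "\<forall>\<^sub>F n in sequentially. dist (?p n) 0 < e"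
      proof eventually_elim
        case (elim n)
        then show ?case using N0[of n] \<open>e > 0\<close> by simp
      qed
    qed
  qed
qed

end
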